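(* The following statements hold (all graphs considered are finite, simple and connected). \begin{enumerate} \item For every tree $T$ of order $n$, $\mathrm{avp}(S_n) \le \mathrm{avp}(T) \le \mathrm{avp}(P_n)$. \item There exist non-isomorphic trees $T_1$ and $T_2$ with the same order and with $\mathrm{avp}(T_1)=\mathrm{avp}(T_2)$. \item The set of values of the ratio $\mathrm{avp}(G,v)/\mathrm{avp}(G)$, where $G$ ranges over all graphs of order at least $2$ and $v$ over all vertices of $G$, is dense in $\mathbb{R}^+=(0,+\infty)$. Restricted to trees, i.e. when $G$ ranges over all trees of order at least $2$ and $v$ over all vertices of $G$, this set of values is dense in $(1/2,+\infty)$. \item A vertex $v$ at which $\mathrm{avp}(G,v)$ is maximum can have any degree: for every integer $d\ge 1$ there exist a graph $G$ and a vertex $v$ of $G$ of degree $d$ such that $\mathrm{avp}(G,v)\ge \mathrm{avp}(G,w)$ for all vertices $w$ of $G$. \item Every tree $T$ which is not a star has a $1$-associate $T'$ with $\mathrm{avp}(T')<\mathrm{avp}(T)$. \item Both removing an edge in a graph and contracting an edge in a tree can increase the average path length: there exist a graph $G$ and an edge $e$ of $G$ such that $G-e$ is connected and $\mathrm{avp}(G-e)>\mathrm{avp}(G)$, and there exist a tree $T$ and an edge $f$ of $T$ such that $\mathrm{avp}(T/f)>\mathrm{avp}(T)$. \item For every integer $r\ge 3$, there are graphs $G$ of arbitrarily large order $n$ with minimum degree $\delta(G)\ge r$ for which $\mathrm{avp}(G)=O(\log n)$. That is, for every $r \ge 3$ there are a constant $C_r$ and graphs $G$ of arbitrarily large order $n$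 with $\delta(G)\ge r$ and $\mathrm{avp}(G)\le C_r\log n$. \item For every graph $G$ of order $n$, $\mathrm{avp}(S_n)\le \mathrm{avp}(G)\le \mathrm{avp}(K_n)$. \end{enumerate}
   Context: The order of a graph is its number of vertices. $P_n$, $S_n$ and $K_n$ denote the path, the star and the complete graph of order $n$, respectively (so $S_n=K_{1,n-1}$). For a graph $G$ of order $n$ and an integer $i \ge 0$, $\mathrm{pn}_i(G)$ denotes the number of paths of length $i$ in $G$, i.e. the number of (not necessarily induced) subgraphs of $G$ isomorphic to $P_{i+1}$; paths are thus unoriented, and the single vertices are the paths of length $0$. The path number is $\mathrm{pn}(G)=\sum_{i=0}^{n-1}\mathrm{pn}_i(G)$, and the average path length (average length of the subpaths of $G$) is $$\mathrm{avp}(G)=\frac{\sum_{i=0}^{n-1} i\cdot \mathrm{pn}_i(G)}{\mathrm{pn}(G)}.$$ For a vertex $v$ of $G$, the local average path length $\mathrm{avp}(G,v)$ is the average length of all paths in $G$ containing $v$ (as an end vertex or internal vertex, including the path of length $0$ consisting of $v$ alone). A $1$-associate of a tree $T$ is a tree on the same vertex set obtained from $T$ by removing one edge and adding one edge. $G-e$ denotes the graph obtained from $G$ by deleting the edge $e$ (keeping all vertices), and $T/f$ the tree obtained from $T$ by contracting the edge $f$. *)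

theory Defs
  imports "HOL-Analysis.Analysis"
begin

datatype 'a graph = Graph (verts: "'a set") (edges: "'a set set")

definition simple_graph :: "'a graph \<Rightarrow> bool" where
  "simple_graph G \<longleftrightarrow>
     finite (verts G) \<and> (\<forall>e\<in>edges G. e \<subseteq> verts G \<and> card e = 2)"

definition graph_order :: "'a graph \<Rightarrow> nat" where
  "graph_order G = card (verts G)"

definition vertex_degree :: "'a graph \<Rightarrow> 'a \<Rightarrow> nat" where
  "vertex_degree G v = card {e \<in> edges G. v \<in> e}"

definition min_degree :: "'a graph \<Rightarrow> nat" where
  "min_degree G = Min (vertex_degree G ` verts G)"

definition graph_iso :: "'a graph \<Rightarrow> 'b graph \<Rightarrow> bool" where
  "graph_iso G H \<longleftrightarrow>
     (\<exists>f. bij_betw f (verts G) (verts H) \<and> edges H = (\<lambda>e. f ` e) ` edges G)"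

text \<open>Subgraphs need not be induced.\<close>

definition subgraph :: "'a graph \<Rightarrow> 'a graph \<Rightarrow> bool" where
  "subgraph H G \<longleftrightarrow> simple_graph H \<and> verts H \<subseteq> verts G \<and> edges H \<subseteq> edges G"

text \<open>The index of each standard graph is its order; in particular \<open>star_graph n\<close> is
  $K_{1,n-1}$, with centre \<open>0\<close>. \<open>cycle_graph n\<close> is a cycle only for \<open>n \<ge> 3\<close>.\<close>

definition path_graph :: "nat \<Rightarrow> nat graph" where
  "path_graph n = Graph {..<n} {{i, Suc i} | i. Suc i < n}"

definition star_graph :: "nat \<Rightarrow> nat graph" where
  "star_graph n = Graph {..<n} {{0, i} | i. 0 < i \<and> i < n}"

definition complete_graph :: "nat \<Rightarrow> nat graph" where
  "complete_graph n = Graph {..<n} {{i, j} | i j. i < n \<and> j < n \<and> i \<noteq> j}"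

definition cycle_graph :: "nat \<Rightarrow> nat graph" where
  "cycle_graph n = Graph {..<n} {{i, Suc i mod n} | i. i < n}"

definition connected_graph :: "'a graph \<Rightarrow> bool" where
  "connected_graph G \<longleftrightarrow> simple_graph G \<and> verts G \<noteq> {} \<and>
     (\<forall>u\<in>verts G. \<forall>v\<in>verts G. (u, v) \<in> {(x, y). {x, y} \<in> edges G}\<^sup>*)"

definition acyclic_graph :: "'a graph \<Rightarrow> bool" where
  "acyclic_graph G \<longleftrightarrow>
     \<not> (\<exists>n\<ge>3. \<exists>H. subgraph H G \<and> graph_iso H (cycle_graph n))"

definition tree :: "'a graph \<Rightarrow> bool" where
  "tree T \<longleftrightarrow> connected_graph T \<and> acyclic_graph T"

text \<open>The paths of length \<open>i\<close> in \<open>G\<close>, as subgraphs and hence unoriented.\<close>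

definition paths :: "'a graph \<Rightarrow> nat \<Rightarrow> 'a graph set" where
  "paths G i = {H. subgraph H G \<and> graph_iso H (path_graph (Suc i))}"

definition pn_len :: "'a graph \<Rightarrow> nat \<Rightarrow> nat" where
  "pn_len G i = card (paths G i)"

definition pn :: "'a graph \<Rightarrow> nat" where
  "pn G = (\<Sum>i<graph_order G. pn_len G i)"

definition avp :: "'a graph \<Rightarrow> real" where
  "avp G = real (\<Sum>i<graph_order G. i * pn_len G i) / real (pn G)"

definition paths_at :: "'a graph \<Rightarrow> 'a \<Rightarrow> nat \<Rightarrow> 'a graph set" where
  "paths_at G v i = {H \<in> paths G i. v \<in> verts H}"

definition avp_at :: "'a graph \<Rightarrow> 'a \<Rightarrow> real" where
  "avp_at G v = real (\<Sum>i<graph_order G. i * card (paths_at G v i)) /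
                real (\<Sum>i<graph_order G. card (paths_at G v i))"

definition delete_edge :: "'a graph \<Rightarrow> 'a set \<Rightarrow> 'a graph" where
  "delete_edge G e = Graph (verts G) (edges G - {e})"

text \<open>Contraction as a quotient: the vertices of \<open>G/f\<close> are the edge \<open>f\<close> itself (replacing
  its two ends) and the singletons of all other vertices. Loops and multiple edges vanish.\<close>

definition contract_edge :: "'a graph \<Rightarrow> 'a set \<Rightarrow> 'a set graph" where
  "contract_edge G f =
     (let V = insert f ((\<lambda>x. {x}) ` (verts G - f))
      in Graph V {{A, B} | A B. A \<in> V \<and> B \<in> V \<and> A \<noteq> B \<and>
                                (\<exists>a\<in>A. \<exists>b\<in>B. {a, b} \<in> edges G)})"

definition one_associate :: "'a graph \<Rightarrow> 'a graph \<Rightarrow> bool" where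
  "one_associate T' T \<longleftrightarrow> tree T' \<and> verts T' = verts T \<and>
     (\<exists>e\<in>edges T. \<exists>f. f \<notin> edges T \<and> edges T' = insert f (edges T - {e}))"

definition dense_in :: "'a::topological_space set \<Rightarrow> 'a set \<Rightarrow> bool" where
  "dense_in S X \<longleftrightarrow> S \<subseteq> X \<and> X \<subseteq> closure S"

end

(* Oriented paths are encoded as distinct vertex lists: avp G is the total length of these lists divided
   by their number plus the order of G, the latter because each trivial path has one orientation
   instead of two.

   Items 1, 8: an oriented path of i+1 vertices has at most n-i-1 extensions at its end, with equality in
   the complete graph; the bound on avp then follows by Chebyshev's sum inequality. For the lower bound,
   adding an edge xy to a connected graph creates at least n-2 paths of length at least 2, one from
   every other vertex, so the claim reduces to trees, where avp is a Wiener index up to a constant.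
   Removing leaves one by one bounds the Wiener index by that of the path.

   Item 3: in a tree, a long and a short leg at the centre of a large star yield all ratios above 1/2, while
   2(n^2+n)(n-a) > (n-1)(n^2+1-a^2) for a < n (a the size of a branch at v) gives the lower bound 1/2.
   Ratios below 1 come from a clique K_n with a path of length about y*n and a pendant vertex v attached
   at one vertex: the paths at v have length about n, but typical paths continue into the long path.

   Item 5: if c minimises the distance sum and v is a leaf farthest from c, reattach v to c.

   Items 2, 4, 6, 7: spiders with legs 1,1,1,5 and 2,2,4; complete graphs; a triangle in the middle of a long
   path, and a leaf at the middle of a path; a clique K_r joined to many independent vertices. *)

theory Submission
  imports Defs
begin

text \<open>Apart from complete graphs and the graphs of item 7, every example is grown by attaching
  one vertex at a time: a pendant vertex changes the number and the total length of all lists only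
  through the lists that start at its neighbour. Exact closed forms follow by induction, even when
  the growth starts from a clique whose lists have no simple closed count. In item 8 the lower bound
  cannot be obtained by comparing averages before and after the deletion of an edge, since a
  deletion may raise the average (item 6). What survives a deletion is a lower bound, in terms of
  order and number of edges, for the number of lists with at least three vertices. When each of them
  is charged only length 2, the comparison with the star becomes a polynomial inequality. In item 3
  both families have a real parameter y > 0. For the trees the ratio tends to
  \<open>(l + 1 + y / 2) / (2 + y)\<close>, which falls from (l + 1) / 2 to 1/2 as y grows; for the
  cliques it tends to 1 - (y / (1 + y))^2, which takes every value in (0, 1).\<close>

subsection \<open>Paths as vertex lists\<close>

definition plists :: "'a graph \<Rightarrow> 'a list set" where
  "plists G = {xs. xs \<noteq> [] \<and> distinct xs \<and> set xs \<subseteq> verts G \<and>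
     successively (\<lambda>a b. {a, b} \<in> edges G) xs}"

text \<open>Keeping the edges as a set, beside the relational form with \<open>successively\<close>,
  turns reversal, concatenation and relabelling of paths into equations between sets.\<close>

fun list_edges :: "'a list \<Rightarrow> 'a set set" where
  "list_edges (a # b # xs) = insert {a, b} (list_edges (b # xs))"
| "list_edges xs = {}"

definition list_graph :: "'a list \<Rightarrow> 'a graph" where
  "list_graph xs = Graph (set xs) (list_edges xs)"

lemma verts_list_graph [simp]: "verts (list_graph xs) = set xs"
  and edges_list_graph [simp]: "edges (list_graph xs) = list_edges xs"
  by (simp_all add: list_graph_def)

lemma successively_list_edges:
  "successively (\<lambda>a b. {a, b} \<in> E) xs \<longleftrightarrow> list_edges xs \<subseteq> E"
  by (induction xs rule: list_edges.induct) auto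

lemma list_edges_append:
  "list_edges (xs @ ys) = list_edges xs \<union> list_edges ys \<union>
     (if xs = [] \<or> ys = [] then {} else {{last xs, hd ys}})"
  by (induction xs rule: list_edges.induct) (auto, (cases ys; simp)+)

lemma list_edges_rev [simp]: "list_edges (rev xs) = list_edges xs"
proof (induction xs rule: list_edges.induct)
  case (1 a b xs)
  have "list_edges (rev (b # xs) @ [a]) = list_edges (b # xs) \<union> {{b, a}}"
    unfolding list_edges_append 1 by (simp add: last_rev)
  then show ?case by (simp add: insert_commute)
qed auto

lemma list_edges_map: "list_edges (map f xs) = (`) f ` list_edges xs"
  by (induction xs rule: list_edges.induct) auto

lemma list_edges_subset: "e \<in> list_edges xs \<Longrightarrow> e \<subseteq> set xs"
  by (induction xs rule: list_edges.induct) auto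

lemma card_list_edges: "distinct xs \<Longrightarrow> e \<in> list_edges xs \<Longrightarrow> card e = 2"
  by (induction xs rule: list_edges.induct) auto

lemma list_edges_conv_nth: "list_edges xs = {{xs ! i, xs ! Suc i} | i. Suc i < length xs}"
proof (induction xs rule: list_edges.induct)
  case (1 a b xs)
  show ?case (is "_ = ?R")
  proof -
    have "?R = insert {a, b} {{(b # xs) ! i, (b # xs) ! Suc i} | i. Suc i < length (b # xs)}"
    proof (intro set_eqI iffI)
      fix e assume "e \<in> ?R"
      then obtain i where i: "Suc i < length (a # b # xs)"
        "e = {(a # b # xs) ! i, (a # b # xs) ! Suc i}" by auto
      then show "e \<in> insert {a, b} {{(b # xs) ! i, (b # xs) ! Suc i} | i. Suc i < length (b # xs)}"
        by (cases i) auto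
    next
      fix e assume "e \<in> insert {a, b} {{(b # xs) ! i, (b # xs) ! Suc i} | i. Suc i < length (b # xs)}"
      then consider "e = {a, b}" | i where "Suc i < length (b # xs)"
        "e = {(b # xs) ! i, (b # xs) ! Suc i}" by auto
      then show "e \<in> ?R"
      proof cases
        case 1 then show ?thesis by (auto intro!: exI[of _ 0])
      next
        case 2 then show ?thesis by (auto intro!: exI[of _ "Suc i"])
      qed
    qed
    then show ?thesis using 1 by simp
  qed
qed auto

lemma path_graph_eq: "path_graph n = list_graph [0..<n]"
proof -
  have "{{i, Suc i} | i. Suc i < n} = {{[0..<n] ! i, [0..<n] ! Suc i} | i. Suc i < length [0..<n]}"
    by (rule Collect_cong) (auto, (metis Suc_lessD add_0 nth_upt)+)
  then show ?thesis
    by (simp only: path_graph_def list_graph_def list_edges_conv_nth) auto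
qed

lemma plists_alt:
  "xs \<in> plists G \<longleftrightarrow> xs \<noteq> [] \<and> distinct xs \<and> set xs \<subseteq> verts G \<and> list_edges xs \<subseteq> edges G"
  by (auto simp: plists_def successively_list_edges)

lemma graph_eqI: "verts G = verts H \<Longrightarrow> edges G = edges H \<Longrightarrow> G = H"
  by (rule graph.expand) simp

lemma simple_list_graph: "distinct xs \<Longrightarrow> simple_graph (list_graph xs)"
  unfolding simple_graph_def using list_edges_subset card_list_edges by fastforce

text \<open>The witness is the inverse of \<open>(!) xs\<close>. As it sends \<open>xs\<close> to
  \<open>[0..<length xs]\<close>, it serves as the isomorphism onto the standard path and also onto
  the standard cycle.\<close>

lemma index_bij:
  assumes "distinct xs"
  obtains f where "bij_betw f (set xs) {..<length xs}" "map f xs = [0..<length xs]"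
proof
  define f where "f = inv_into {..<length xs} ((!) xs)"
  have inj: "inj_on ((!) xs) {..<length xs}"
    using assms by (auto intro: inj_on_nth)
  have im: "(!) xs ` {..<length xs} = set xs"
    by (auto simp: in_set_conv_nth)
  show "bij_betw f (set xs) {..<length xs}"
    unfolding f_def by (rule bij_betw_inv_into) (use inj im in \<open>auto simp: bij_betw_def\<close>)
  show "map f xs = [0..<length xs]"
    by (rule nth_equalityI) (use inj in \<open>auto simp: f_def\<close>)
qed

lemma list_graph_iso_path:
  assumes "distinct xs"
  shows "graph_iso (list_graph xs) (path_graph (length xs))"
proof -
  obtain f where f: "bij_betw f (set xs) {..<length xs}" "map f xs = [0..<length xs]"
    using index_bij[OF assms] by blast
  then have "list_edges [0..<length xs] = (`) f ` list_edges xs"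
    using list_edges_map[of f xs] by simp
  with f(1) show ?thesis
    unfolding graph_iso_def path_graph_eq by (intro exI[of _ f]) (simp add: lessThan_atLeast0)
qed

lemma inv_into_edge:
  assumes "simple_graph G" "bij_betw f (verts G) V" "d \<in> edges G"
  shows "inv_into (verts G) f ` f ` d = d"
  using assms by (intro inv_into_image_cancel) (simp_all add: simple_graph_def bij_betw_def)

text \<open>The list is \<open>[0..<n]\<close> pulled back along the isomorphism. Simplicity of
  \<open>H\<close> keeps the edges inside the vertex set, where the inverse map really undoes
  \<open>f\<close>.\<close>

lemma iso_path_imp_list_graph:
  assumes H: "simple_graph H" and iso: "graph_iso H (path_graph n)"
  shows "\<exists>xs. distinct xs \<and> length xs = n \<and> H = list_graph xs"
proof -
  from iso obtain f where f: "bij_betw f (verts H) {..<n}"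
    and e: "list_edges [0..<n] = (`) f ` edges H"
    unfolding graph_iso_def path_graph_eq by (auto simp: lessThan_atLeast0)
  define g where "g = inv_into (verts H) f"
  have g: "bij_betw g {..<n} (verts H)" unfolding g_def by (rule bij_betw_inv_into[OF f])
  define xs where "xs = map g [0..<n]"
  have "set xs = verts H" using g by (auto simp: xs_def bij_betw_def lessThan_atLeast0)
  moreover have "distinct xs" using g by (auto simp: xs_def distinct_map bij_betw_def lessThan_atLeast0)
  moreover have "list_edges xs = edges H"
  proof -
    have "g ` f ` d = d" if "d \<in> edges H" for d
      unfolding g_def by (rule inv_into_edge[OF H f that])
    then show ?thesis unfolding xs_def list_edges_map e by (simp add: image_image)
  qed
  ultimately show ?thesis
    by (intro exI[of _ xs]) (auto intro: graph_eqI simp: xs_def)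
qed

section \<open>Unoriented paths and their two orientations\<close>

lemma paths_eq_image: "paths G i = list_graph ` {xs \<in> plists G. length xs = Suc i}"
proof (intro set_eqI iffI)
  fix H assume "H \<in> paths G i"
  then have H: "subgraph H G" "graph_iso H (path_graph (Suc i))" by (auto simp: paths_def)
  then obtain xs where "distinct xs" "length xs = Suc i" "H = list_graph xs"
    using iso_path_imp_list_graph by (metis subgraph_def)
  then show "H \<in> list_graph ` {xs \<in> plists G. length xs = Suc i}"
    using H(1) by (auto simp: plists_alt subgraph_def intro!: image_eqI)
next
  fix H assume "H \<in> list_graph ` {xs \<in> plists G. length xs = Suc i}"
  then show "H \<in> paths G i"
    using simple_list_graph list_graph_iso_path
    by (fastforce simp: paths_def plists_alt subgraph_def)
qed

text \<open>The head lies in no edge of the tail, so the single edge at the head determines the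
  second vertex, and the induction continues with the tails.\<close>

lemma list_edges_eq_hd:
  assumes "distinct xs" "distinct ys" "set xs = set ys" "list_edges xs = list_edges ys" "xs \<noteq> []" "hd xs = hd ys"
  shows "xs = ys"
  using assms
proof (induction xs arbitrary: ys)
  case (Cons a xs)
  then obtain ys' where ys: "ys = a # ys'" by (cases ys) auto
  show ?case
  proof (cases xs)
    case Nil
    then show ?thesis using Cons.prems ys by (cases ys') auto
  next
    case (Cons b xs')
    then obtain c zs where ys': "ys' = c # zs"
      using Cons.prems ys by (cases ys') auto
    have na: "e \<in> list_edges (b # xs') \<Longrightarrow> a \<notin> e" "e \<in> list_edges (c # zs) \<Longrightarrow> a \<notin> e" for e
      using list_edges_subset[of e "b # xs'"] list_edges_subset[of e "c # zs"]
        Cons.prems ys ys' Cons by auto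
    have eq: "insert {a, b} (list_edges (b # xs')) = insert {a, c} (list_edges (c # zs))"
      using Cons.prems Cons ys ys' by simp
    then have "{a, b} \<in> insert {a, c} (list_edges (c # zs))" by blast
    then have "b = c" using na(2) by (auto simp: doubleton_eq_iff)
    with eq na have "list_edges (b # xs') = list_edges (c # zs)" by blast
    then have "xs = ys'" using Cons.IH[of ys'] Cons.prems ys ys' Cons \<open>b = c\<close>
      by (auto simp: insert_eq_iff)
    then show ?thesis using ys by simp
  qed
qed auto

text \<open>Inner vertices have two neighbours on the path, an end has at most one
  (\<open>list_edges_hd_unique\<close>); this recovers the ends of a path from its unoriented
  graph.\<close>

lemma list_edges_degree:
  assumes "distinct xs" "x \<in> set xs" "x \<noteq> hd xs" "x \<noteq> last xs"
  shows "\<exists>a b. a \<noteq> b \<and> {a, x} \<in> list_edges xs \<and> {x, b} \<in> list_edges xs"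
proof -
  obtain us vs where xs: "xs = us @ x # vs" using assms(2) by (meson split_list)
  have "us \<noteq> []" "vs \<noteq> []" using assms xs by auto
  then obtain us' a b vs' where "us = us' @ [a]" "vs = b # vs'"
    by (metis list.exhaust rev_exhaust)
  then show ?thesis using xs assms
    by (intro exI[of _ a] exI[of _ b]) (auto simp: list_edges_append)
qed

lemma list_edges_hd_unique:
  assumes "distinct xs" "{hd xs, a} \<in> list_edges xs" "{hd xs, b} \<in> list_edges xs"
  shows "a = b"
proof -
  obtain x y zs where xs: "xs = x # y # zs" using assms by (cases xs rule: list_edges.cases) auto
  have "e \<in> list_edges (y # zs) \<Longrightarrow> x \<notin> e" for e
    using list_edges_subset[of e "y # zs"] assms xs by auto
  then show ?thesis using assms xs by (auto simp: doubleton_eq_iff)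
qed

text \<open>By the degree criterion the head of \<open>xs\<close> is an end of \<open>ys\<close>;
  after reversing \<open>ys\<close> if necessary the heads agree, and then the lists do.\<close>

lemma list_graph_eq_iff:
  assumes "distinct xs" "distinct ys" "xs \<noteq> []"
  shows "list_graph xs = list_graph ys \<longleftrightarrow> ys = xs \<or> ys = rev xs"
proof
  assume "list_graph xs = list_graph ys"
  then have eq: "set xs = set ys" "list_edges xs = list_edges ys"
    by (auto simp: list_graph_def)
  have "hd xs = hd ys \<or> hd xs = last ys"
  proof (rule ccontr)
    assume "\<not> ?thesis"
    then obtain a b where "a \<noteq> b" "{a, hd xs} \<in> list_edges ys" "{hd xs, b} \<in> list_edges ys"
      using list_edges_degree[of ys "hd xs"] assms eq by (metis hd_in_set)
    then show False using list_edges_hd_unique[of xs a b] assms eq by (auto simp: insert_commute)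
  qed
  moreover have "ys \<noteq> []" using eq assms by auto
  ultimately show "ys = xs \<or> ys = rev xs"
    using list_edges_eq_hd[of xs ys] list_edges_eq_hd[of xs "rev ys"] assms eq
    by (auto simp: hd_rev)
next
  assume "ys = xs \<or> ys = rev xs"
  then show "list_graph xs = list_graph ys" by (auto simp: list_graph_def)
qed

lemma rev_neq: "distinct xs \<Longrightarrow> length xs \<ge> 2 \<Longrightarrow> rev xs \<noteq> xs"
proof
  assume d: "distinct xs" and l: "length xs \<ge> 2" and r: "rev xs = xs"
  obtain a b zs where xs: "xs = a # b # zs" using l by (cases xs rule: list_edges.cases) auto
  have "hd xs = last xs" using r by (metis hd_rev)
  then have "a \<in> set (b # zs)" unfolding xs by (metis last_ConsR last_in_set list.discI list.sel(1))
  then show False using d unfolding xs by simp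
qed

lemma rev_in_plists: "xs \<in> plists G \<Longrightarrow> rev xs \<in> plists G"
  by (auto simp: plists_alt)

lemma rev_in_plists_iff [simp]: "rev xs \<in> plists G \<longleftrightarrow> xs \<in> plists G"
  using rev_in_plists[of xs] rev_in_plists[of "rev xs"] by auto

lemma length_plists: "simple_graph G \<Longrightarrow> xs \<in> plists G \<Longrightarrow> length xs \<le> graph_order G"
  by (auto simp: plists_def simple_graph_def graph_order_def simp flip: distinct_card intro: card_mono)

lemma finite_plists [simp]: "simple_graph G \<Longrightarrow> finite (plists G)"
proof -
  assume s: "simple_graph G"
  then have "plists G \<subseteq> {xs. set xs \<subseteq> verts G \<and> length xs \<le> graph_order G}"
    using length_plists[OF s] by (auto simp: plists_def)
  moreover have "finite {xs. set xs \<subseteq> verts G \<and> length xs \<le> graph_order G}"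
    using s by (intro finite_lists_length_le) (auto simp: simple_graph_def)
  ultimately show ?thesis by (rule finite_subset)
qed

text \<open>The fibres of \<open>list_graph\<close> on a set closed under reversal are the pairs
  \<open>{xs, rev xs}\<close>; length at least 2 makes the two members distinct.\<close>

lemma card_list_graph_image:
  assumes fin: "finite A" and A: "\<And>xs. xs \<in> A \<Longrightarrow> distinct xs \<and> length xs \<ge> 2 \<and> rev xs \<in> A"
  shows "2 * card (list_graph ` A) = card A"
proof -
  have "card A = (\<Sum>H\<in>list_graph ` A. card {xs \<in> A. list_graph xs = H})"
    using sum.image_gen[OF fin, of "\<lambda>_. 1::nat" list_graph] by simp
  also have "\<dots> = (\<Sum>H\<in>list_graph ` A. 2)"
  proof (rule sum.cong[OF refl])
    fix H assume "H \<in> list_graph ` A"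
    then obtain xs where xs: "xs \<in> A" "H = list_graph xs" by auto
    have "{ys \<in> A. list_graph ys = H} = {xs, rev xs}"
    proof -
      have "ys \<in> A \<Longrightarrow> list_graph xs = list_graph ys \<longleftrightarrow> ys = xs \<or> ys = rev xs" for ys
        by (rule list_graph_eq_iff) (use A[OF xs(1)] A[of ys] in auto)
      then show ?thesis using A[OF xs(1)] xs by (auto simp: eq_commute)
    qed
    then show "card {ys \<in> A. list_graph ys = H} = 2"
      using rev_neq A[OF xs(1)] by (metis card_2_iff)
  qed
  finally show ?thesis by simp
qed

lemma plists_singleton: "{xs \<in> plists G. length xs = Suc 0} = (\<lambda>v. [v]) ` verts G"
  by (auto simp: plists_def length_Suc_conv)

text \<open>The parameter \<open>Q\<close> treats all paths and the paths through a fixed vertex at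
  once. As a condition on the vertex set it is invariant under reversal.\<close>

lemma card_paths_where:
  assumes G: "simple_graph G" and i: "i > 0"
  shows "2 * card {H \<in> paths G i. Q (verts H)} = card {xs \<in> plists G. length xs = Suc i \<and> Q (set xs)}"
proof -
  let ?A = "{xs \<in> plists G. length xs = Suc i \<and> Q (set xs)}"
  have "{H \<in> paths G i. Q (verts H)} = list_graph ` ?A"
    unfolding paths_eq_image by auto
  moreover have "2 * card (list_graph ` ?A) = card ?A"
  proof (rule card_list_graph_image)
    show "finite ?A" using G by simp
    show "distinct xs \<and> length xs \<ge> 2 \<and> rev xs \<in> ?A" if "xs \<in> ?A" for xs
      using that i by (simp add: plists_alt)
  qed
  ultimately show ?thesis by simp
qed

lemma card_paths_where_0:
  assumes G: "simple_graph G"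
  shows "card {H \<in> paths G 0. Q (verts H)} = card {xs \<in> plists G. length xs = Suc 0 \<and> Q (set xs)}"
proof -
  let ?A = "{xs \<in> plists G. length xs = Suc 0 \<and> Q (set xs)}"
  have "{H \<in> paths G 0. Q (verts H)} = list_graph ` ?A"
    unfolding paths_eq_image by auto
  moreover have "inj_on list_graph ?A"
    by (auto simp: inj_on_def list_graph_def length_Suc_conv)
  ultimately show ?thesis by (simp add: card_image)
qed

lemma sum_plists_by_length:
  fixes f :: "nat \<Rightarrow> nat"
  assumes G: "simple_graph G"
  shows "(\<Sum>i<graph_order G. f i * card {xs \<in> plists G. length xs = Suc i \<and> Q (set xs)})
       = (\<Sum>xs | xs \<in> plists G \<and> Q (set xs). f (length xs - 1))"
proof -
  let ?S = "{xs \<in> plists G. Q (set xs)}"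
  have fin: "finite ?S" using G by simp
  have "(\<Sum>xs\<in>?S. f (length xs - 1)) =
     (\<Sum>i<graph_order G. \<Sum>xs | xs \<in> ?S \<and> length xs - 1 = i. f (length xs - 1))"
  proof (rule sum.group[symmetric])
    show "(\<lambda>xs. length xs - 1) ` ?S \<subseteq> {..<graph_order G}"
    proof clarify
      fix xs assume "xs \<in> plists G"
      then have "length xs \<le> graph_order G" "xs \<noteq> []"
        using length_plists[OF G] by (simp_all add: plists_def)
      then show "length xs - 1 < graph_order G" by (cases xs) auto
    qed
  qed (use fin in auto)
  also have "\<dots> = (\<Sum>i<graph_order G. f i * card {xs \<in> plists G. length xs = Suc i \<and> Q (set xs)})"
  proof (rule sum.cong[OF refl])
    fix i
    have "{xs \<in> ?S. length xs - 1 = i} = {xs \<in> plists G. length xs = Suc i \<and> Q (set xs)}"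
    proof -
      have "length xs - 1 = i \<longleftrightarrow> length xs = Suc i" if "xs \<in> plists G" for xs
        using that by (cases xs) (simp_all add: plists_def)
      then show ?thesis by blast
    qed
    then show "(\<Sum>xs | xs \<in> ?S \<and> length xs - 1 = i. f (length xs - 1)) =
       f i * card {xs \<in> plists G. length xs = Suc i \<and> Q (set xs)}"
      by (simp add: mult.commute)
  qed
  finally show ?thesis by simp
qed

lemma sum_paths_where:
  assumes G: "simple_graph G"
  shows "2 * (\<Sum>i<graph_order G. i * card {H \<in> paths G i. Q (verts H)}) =
           (\<Sum>xs | xs \<in> plists G \<and> Q (set xs). length xs - 1)"
    and "2 * (\<Sum>i<graph_order G. card {H \<in> paths G i. Q (verts H)}) =
           card {xs \<in> plists G. length xs = Suc 0 \<and> Q (set xs)} + card {xs \<in> plists G. Q (set xs)}"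
proof -
  let ?c = "\<lambda>i. card {H \<in> paths G i. Q (verts H)}"
  let ?d = "\<lambda>i. card {xs \<in> plists G. length xs = Suc i \<and> Q (set xs)}"
  have d: "2 * ?c i = ?d i + (if i = 0 then ?d 0 else 0)" for i
    using card_paths_where[OF G, of i Q] card_paths_where_0[OF G, of Q] by auto
  have "2 * (i * ?c i) = i * ?d i" for i using d[of i] by (cases "i = 0") simp_all
  then have "2 * (\<Sum>i<graph_order G. i * ?c i) = (\<Sum>i<graph_order G. i * ?d i)"
    unfolding sum_distrib_left by (intro sum.cong) simp_all
  then show "2 * (\<Sum>i<graph_order G. i * ?c i) = (\<Sum>xs | xs \<in> plists G \<and> Q (set xs). length xs - 1)"
    using sum_plists_by_length[OF G, of "\<lambda>i. i" Q] by simp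
  \<comment> \<open>In an empty graph the range of summation does not contain 0, so the correction
    for trivial paths has to vanish by itself.\<close>
  have 0: "?d 0 = 0" if "graph_order G = 0"
  proof -
    have "verts G = {}" using that G by (simp add: graph_order_def simple_graph_def)
    then have "{xs \<in> plists G. length xs = Suc 0 \<and> Q (set xs)} = {}"
      by (auto simp: plists_def)
    then show ?thesis by (simp only: card.empty)
  qed
  have "2 * (\<Sum>i<graph_order G. ?c i) = (\<Sum>i<graph_order G. ?d i + (if i = 0 then ?d 0 else 0))"
    unfolding sum_distrib_left d ..
  also have "\<dots> = (\<Sum>i<graph_order G. 1 * ?d i) + ?d 0"
    using 0 by (cases "graph_order G = 0") (simp_all add: sum.distrib sum.delta)
  also have "\<dots> = card {xs \<in> plists G. Q (set xs)} + ?d 0"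
    unfolding sum_plists_by_length[OF G, of "\<lambda>_. 1" Q] by simp
  finally show "2 * (\<Sum>i<graph_order G. ?c i) = ?d 0 + card {xs \<in> plists G. Q (set xs)}" by simp
qed

text \<open>Lengths count edges; the truncated subtraction could only matter for \<open>[]\<close>,
  which is never a path list.\<close>

definition path_sum :: "'a list set \<Rightarrow> nat" where
  "path_sum A = (\<Sum>xs\<in>A. length xs - 1)"

lemma double_ratio: "2 * (a::nat) = c \<Longrightarrow> 2 * b = d \<Longrightarrow> real a / real b = real c / real d"
  by auto

lemma avp_plists:
  assumes G: "simple_graph G"
  shows "avp G = path_sum (plists G) / real (graph_order G + card (plists G))"
  unfolding avp_def pn_def pn_len_def path_sum_def
proof (rule double_ratio)
  show "2 * (\<Sum>i<graph_order G. i * card (paths G i)) = (\<Sum>xs\<in>plists G. length xs - 1)"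
    using sum_paths_where(1)[OF G, of "\<lambda>_. True"] by simp
  have "card {xs \<in> plists G. length xs = Suc 0} = graph_order G"
    unfolding plists_singleton graph_order_def by (simp add: card_image inj_on_def)
  then show "2 * (\<Sum>i<graph_order G. card (paths G i)) = graph_order G + card (plists G)"
    using sum_paths_where(2)[OF G, of "\<lambda>_. True"] by simp
qed

lemma avp_at_plists:
  assumes G: "simple_graph G" and v: "v \<in> verts G"
  shows "avp_at G v = path_sum {xs \<in> plists G. v \<in> set xs} /
           real (1 + card {xs \<in> plists G. v \<in> set xs})"
  unfolding avp_at_def paths_at_def path_sum_def
proof (rule double_ratio)
  show "2 * (\<Sum>i<graph_order G. i * card {H \<in> paths G i. v \<in> verts H}) =
     (\<Sum>xs | xs \<in> plists G \<and> v \<in> set xs. length xs - 1)"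
    using sum_paths_where(1)[OF G, of "\<lambda>V. v \<in> V"] by simp
  have "{xs \<in> plists G. length xs = Suc 0 \<and> v \<in> set xs} = {[v]}"
    using v by (auto simp: plists_def length_Suc_conv)
  then show "2 * (\<Sum>i<graph_order G. card {H \<in> paths G i. v \<in> verts H}) =
     1 + card {xs \<in> plists G. v \<in> set xs}"
    using sum_paths_where(2)[OF G, of "\<lambda>V. v \<in> V"] by simp
qed

section \<open>Invariance under isomorphism\<close>

lemma plists_iso:
  assumes G: "simple_graph G" and H: "simple_graph H"
    and f: "bij_betw f (verts G) (verts H)" and e: "edges H = (\<lambda>d. f ` d) ` edges G"
  shows "plists H = map f ` plists G"
proof (intro set_eqI iffI)
  fix ys assume ys: "ys \<in> map f ` plists G"
  then obtain xs where xs: "xs \<in> plists G" "ys = map f xs" by auto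
  then have "inj_on f (set xs)" using f by (auto simp: plists_def bij_betw_def intro: inj_on_subset)
  moreover have "f ` set xs \<subseteq> verts H" using xs f by (auto simp: plists_def bij_betw_def)
  ultimately show "ys \<in> plists H" using xs e
    by (auto simp: plists_alt distinct_map list_edges_map)
next
  fix ys assume ys: "ys \<in> plists H"
  define g where "g = inv_into (verts G) f"
  have g: "bij_betw g (verts H) (verts G)" unfolding g_def by (rule bij_betw_inv_into[OF f])
  have fg: "map f (map g ys) = ys"
  proof -
    have "set ys \<subseteq> f ` verts G" using ys f by (simp add: plists_def bij_betw_def)
    then have "f (g y) = y" if "y \<in> set ys" for y
      unfolding g_def using that by (blast intro: f_inv_into_f)
    then show ?thesis by (simp add: map_idI)
  qed
  have gf: "g ` f ` d = d" if "d \<in> edges G" for d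
    unfolding g_def by (rule inv_into_edge[OF G f that])
  have "inj_on g (set ys)" using g ys by (auto simp: plists_def bij_betw_def intro: inj_on_subset)
  moreover have "list_edges (map g ys) \<subseteq> edges G"
  proof -
    have "list_edges ys \<subseteq> (\<lambda>d. f ` d) ` edges G" using ys e by (auto simp: plists_alt)
    then have "list_edges (map g ys) \<subseteq> (\<lambda>d. g ` f ` d) ` edges G"
      unfolding list_edges_map by blast
    then show ?thesis using gf by auto
  qed
  ultimately have "map g ys \<in> plists G"
    using ys g by (auto simp: plists_alt distinct_map bij_betw_def)
  then show "ys \<in> map f ` plists G" using fg by (metis image_eqI)
qed

lemma inj_map_plists:
  assumes f: "bij_betw f (verts G) (verts H)"
  shows "inj_on (map f) (plists G)"
proof (rule inj_onI)
  fix xs ys assume "xs \<in> plists G" "ys \<in> plists G" and eq: "map f xs = map f ys"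
  then have "inj_on f (set xs \<union> set ys)"
    using f by (auto simp: plists_def bij_betw_def intro: inj_on_subset)
  with eq show "xs = ys" using inj_on_map_eq_map by blast
qed

lemma graph_iso_order: "graph_iso G H \<Longrightarrow> graph_order G = graph_order H"
  by (auto simp: graph_iso_def graph_order_def dest: bij_betw_same_card)

lemma avp_iso:
  assumes G: "simple_graph G" and H: "simple_graph H" and iso: "graph_iso G H"
  shows "avp G = avp H"
proof -
  from iso obtain f where f: "bij_betw f (verts G) (verts H)" "edges H = (\<lambda>d. f ` d) ` edges G"
    by (auto simp: graph_iso_def)
  have "plists H = map f ` plists G" by (rule plists_iso[OF G H f])
  then have "path_sum (plists H) = path_sum (plists G)" "card (plists H) = card (plists G)"
    unfolding path_sum_def using inj_map_plists[OF f(1)]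
    by (simp_all add: sum.reindex card_image)
  then show ?thesis using graph_iso_order[OF iso] by (simp add: avp_plists G H)
qed

lemma avp_at_iso:
  assumes G: "simple_graph G" and H: "simple_graph H"
    and f: "bij_betw f (verts G) (verts H)" "edges H = (\<lambda>d. f ` d) ` edges G" and v: "v \<in> verts G"
  shows "avp_at H (f v) = avp_at G v"
proof -
  have inj: "inj_on f (verts G)" using f by (auto simp: bij_betw_def)
  have "f v \<in> set (map f xs) \<longleftrightarrow> v \<in> set xs" if "xs \<in> plists G" for xs
    using inj_on_image_mem_iff[OF inj v, of "set xs"] that by (auto simp: plists_def)
  then have eq: "{ys \<in> plists H. f v \<in> set ys} = map f ` {xs \<in> plists G. v \<in> set xs}"
    unfolding plists_iso[OF G H f] by auto
  have "inj_on (map f) {xs \<in> plists G. v \<in> set xs}"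
    by (rule inj_on_subset[OF inj_map_plists[OF f(1)]]) auto
  then have "path_sum {ys \<in> plists H. f v \<in> set ys} = path_sum {xs \<in> plists G. v \<in> set xs}"
    "card {ys \<in> plists H. f v \<in> set ys} = card {xs \<in> plists G. v \<in> set xs}"
    unfolding path_sum_def eq by (simp_all add: sum.reindex card_image)
  moreover have "f v \<in> verts H" using f v by (auto simp: bij_betw_def)
  ultimately show ?thesis using v by (simp add: avp_at_plists G H)
qed

subsection \<open>Trees and pendant vertices\<close>

definition plists_from :: "'a graph \<Rightarrow> 'a \<Rightarrow> 'a list set" where
  "plists_from G u = {xs \<in> plists G. hd xs = u}"

definition plists_between :: "'a graph \<Rightarrow> 'a \<Rightarrow> 'a \<Rightarrow> 'a list set" where
  "plists_between G u v = {xs \<in> plists G. hd xs = u \<and> last xs = v}"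

lemma finite_plists_from [simp]: "simple_graph G \<Longrightarrow> finite (plists_from G u)"
  and finite_plists_between [simp]: "simple_graph G \<Longrightarrow> finite (plists_between G u v)"
  by (simp_all add: plists_from_def plists_between_def)

text \<open>Closed detours are cut out until no vertex repeats. The control over vertices and length
  is what later yields the triangle inequality for distances in trees.\<close>

lemma walk_imp_plist:
  assumes "xs \<noteq> []" "set xs \<subseteq> verts G" "list_edges xs \<subseteq> edges G"
  shows "\<exists>ys \<in> plists_between G (hd xs) (last xs). set ys \<subseteq> set xs \<and> length ys \<le> length xs"
  using assms
proof (induction "length xs" arbitrary: xs rule: less_induct)
  case less
  show ?case
  proof (cases "distinct xs")
    case True
    then show ?thesis using less.prems by (intro bexI[of _ xs]) (auto simp: plists_between_def plists_alt)
  next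
    case False
    then obtain as y bs cs where xs: "xs = as @ [y] @ bs @ [y] @ cs"
      using not_distinct_decomp by blast
    \<comment> \<open>The detour between two occurrences of \<open>y\<close> is dropped; the ends
      are kept, and every edge of \<open>zs\<close> is already one of \<open>xs\<close>.\<close>
    define zs where "zs = as @ [y] @ cs"
    have "\<exists>ys \<in> plists_between G (hd zs) (last zs). set ys \<subseteq> set zs \<and> length ys \<le> length zs"
    proof (rule less.hyps)
      show "length zs < length xs" "zs \<noteq> []" "set zs \<subseteq> verts G"
        using less.prems unfolding xs zs_def by auto
      show "list_edges zs \<subseteq> edges G"
      proof -
        have xs': "xs = as @ (y # bs) @ (y # cs)" and zs': "zs = as @ (y # cs)"
          unfolding xs zs_def by simp_all
        show ?thesis using less.prems(3) unfolding xs' zs' list_edges_append by auto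
      qed
    qed
    moreover have "hd zs = hd xs" "last zs = last xs" "set zs \<subseteq> set xs" "length zs \<le> length xs"
      unfolding xs zs_def by (cases as; auto)+
    ultimately show ?thesis by (metis order_trans)
  qed
qed

lemma list_edges_rtrancl:
  "xs \<noteq> [] \<Longrightarrow> list_edges xs \<subseteq> E \<Longrightarrow> (hd xs, last xs) \<in> {(x, y). {x, y} \<in> E}\<^sup>*"
proof (induction xs rule: list_edges.induct)
  case (1 a b xs)
  then have "(a, b) \<in> {(x, y). {x, y} \<in> E}" "(b, last (b # xs)) \<in> {(x, y). {x, y} \<in> E}\<^sup>*" by auto
  then show ?case by (simp add: converse_rtrancl_into_rtrancl)
qed auto

lemma connected_graph_plists:
  "connected_graph G \<longleftrightarrow> simple_graph G \<and> verts G \<noteq> {} \<and>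
     (\<forall>u\<in>verts G. \<forall>v\<in>verts G. plists_between G u v \<noteq> {})"
proof -
  let ?r = "{(x, y). {x, y} \<in> edges G}"
  have ne: "plists_between G u v \<noteq> {}"
    if s: "simple_graph G" and u: "u \<in> verts G" and r: "(u, v) \<in> ?r\<^sup>*" for u v
  proof -
    have "\<exists>xs. xs \<noteq> [] \<and> set xs \<subseteq> verts G \<and> list_edges xs \<subseteq> edges G \<and> hd xs = u \<and> last xs = v"
      using r
    proof (induction rule: rtrancl_induct)
      case base
      then show ?case using u by (intro exI[of _ "[u]"]) simp
    next
      case (step y z)
      then obtain xs where "xs \<noteq> []" "set xs \<subseteq> verts G" "list_edges xs \<subseteq> edges G" "hd xs = u" "last xs = y"
        by blast
      moreover have "z \<in> verts G" using step(2) s by (auto simp: simple_graph_def)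
      ultimately show ?case using step(2) 
        by (intro exI[of _ "xs @ [z]"]) (auto simp: list_edges_append)
    qed
    then obtain xs where "xs \<noteq> []" "set xs \<subseteq> verts G" "list_edges xs \<subseteq> edges G" "hd xs = u" "last xs = v"
      by blast
    then show ?thesis using walk_imp_plist[of xs G] by auto
  qed
  show ?thesis
  proof
    assume "connected_graph G"
    then show "simple_graph G \<and> verts G \<noteq> {} \<and> (\<forall>u\<in>verts G. \<forall>v\<in>verts G. plists_between G u v \<noteq> {})"
      using ne unfolding connected_graph_def by blast
  next
    assume R: "simple_graph G \<and> verts G \<noteq> {} \<and> (\<forall>u\<in>verts G. \<forall>v\<in>verts G. plists_between G u v \<noteq> {})"
    have "(u, v) \<in> ?r\<^sup>*" if "u \<in> verts G" "v \<in> verts G" for u v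
    proof -
      have "plists_between G u v \<noteq> {}" using R that by simp
      then obtain xs where "xs \<in> plists_between G u v" by auto
      then have "xs \<noteq> []" "list_edges xs \<subseteq> edges G" "hd xs = u" "last xs = v"
        by (simp_all add: plists_between_def plists_alt)
      then show ?thesis using list_edges_rtrancl[of xs "edges G"] by simp
    qed
    then show "connected_graph G" using R unfolding connected_graph_def by blast
  qed
qed

lemma cycle_graph_eq:
  assumes "n > 0"
  shows "cycle_graph n = Graph (set [0..<n]) (insert {last [0..<n], hd [0..<n]} (list_edges [0..<n]))"
proof -
  have p: "list_edges [0..<n] = {{i, Suc i} | i. Suc i < n}"
    using path_graph_eq[of n] by (simp add: path_graph_def list_graph_def)
  have "{{i, Suc i mod n} | i. i < n} = insert {n - 1, 0} {{i, Suc i} | i. Suc i < n}" (is "?L = ?R")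
  proof (intro set_eqI iffI)
    fix e assume "e \<in> ?L"
    then obtain i where i: "i < n" "e = {i, Suc i mod n}" by blast
    show "e \<in> ?R"
    proof (cases "Suc i < n")
      case True
      then show ?thesis using i by auto
    next
      case False
      then have "Suc i = n" using i by simp
      then show ?thesis using i by auto
    qed
  next
    fix e assume "e \<in> ?R"
    then consider "e = {n - 1, 0}" | i where "Suc i < n" "e = {i, Suc i}" by blast
    then show "e \<in> ?L"
    proof cases
      case 1
      then show ?thesis using assms by (intro CollectI exI[of _ "n - 1"]) simp
    next
      case 2
      then show ?thesis by (intro CollectI exI[of _ i]) simp
    qed
  qed
  then show ?thesis using assms by (simp add: cycle_graph_def p lessThan_atLeast0)
qed

text \<open>A cycle is a path on at least three vertices closed by an edge between its ends.
  \<open>cycle_graph_eq\<close> puts the standard cycle into this form, and relabelling passes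
  between the two.\<close>

lemma acyclic_graph_plists:
  assumes G: "simple_graph G"
  shows "acyclic_graph G \<longleftrightarrow> \<not> (\<exists>xs \<in> plists G. length xs \<ge> 3 \<and> {last xs, hd xs} \<in> edges G)"
proof -
  have 1: "\<exists>H. subgraph H G \<and> graph_iso H (cycle_graph (length xs))"
    if xs: "xs \<in> plists G" "length xs \<ge> 3" "{last xs, hd xs} \<in> edges G" for xs
  proof -
    define H where "H = Graph (set xs) (insert {last xs, hd xs} (list_edges xs))"
    have d: "distinct xs" "xs \<noteq> []" using xs by (auto simp: plists_alt)
    then obtain f where f: "bij_betw f (set xs) {..<length xs}" "map f xs = [0..<length xs]"
      using index_bij by blast
    have "subgraph H G"
    proof -
      have "e \<subseteq> set xs" if "e \<in> insert {last xs, hd xs} (list_edges xs)" for e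
        using that d list_edges_subset[of e xs] by auto
      moreover have E: "insert {last xs, hd xs} (list_edges xs) \<subseteq> edges G" and "set xs \<subseteq> verts G"
        using xs by (simp_all add: plists_alt)
      moreover have "card e = 2" if "e \<in> insert {last xs, hd xs} (list_edges xs)" for e
        using that E G unfolding simple_graph_def by blast
      ultimately show ?thesis
        by (simp add: subgraph_def H_def simple_graph_def)
    qed
    moreover have "graph_iso H (cycle_graph (length xs))"
      unfolding graph_iso_def
    proof (intro exI conjI)
      show "bij_betw f (verts H) (verts (cycle_graph (length xs)))"
        using f by (simp add: H_def cycle_graph_def)
      have "cycle_graph (length xs) =
         Graph (set (map f xs)) (insert {last (map f xs), hd (map f xs)} (list_edges (map f xs)))"
        unfolding f(2) using d by (intro cycle_graph_eq) simp
      then show "edges (cycle_graph (length xs)) = (\<lambda>e. f ` e) ` edges H"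
        unfolding list_edges_map using d by (simp add: H_def hd_map last_map)
    qed
    ultimately show ?thesis by blast
  qed
  have 2: "\<exists>xs \<in> plists G. length xs \<ge> 3 \<and> {last xs, hd xs} \<in> edges G"
    if n: "n \<ge> 3" and H: "subgraph H G" "graph_iso H (cycle_graph n)" for n H
  proof -
    from n have n0: "n > 0" by simp
    from H(2) obtain f where f: "bij_betw f (verts H) {..<n}" "edges (cycle_graph n) = (\<lambda>e. f ` e) ` edges H"
      by (auto simp: graph_iso_def cycle_graph_def)
    define g where "g = inv_into (verts H) f"
    have g: "bij_betw g {..<n} (verts H)" unfolding g_def by (rule bij_betw_inv_into[OF f(1)])
    define xs where "xs = map g [0..<n]"
    have "set xs = verts H" "distinct xs" using g
      by (auto simp: xs_def distinct_map bij_betw_def lessThan_atLeast0)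
    moreover have "edges H = insert {last xs, hd xs} (list_edges xs)"
    proof -
      have "g ` f ` d = d" if "d \<in> edges H" for d
        unfolding g_def using H(1) by (intro inv_into_edge[OF _ f(1) that]) (simp add: subgraph_def)
      then have "edges H = (\<lambda>e. g ` e) ` edges (cycle_graph n)"
        unfolding f(2) by (simp add: image_image)
      also have "\<dots> = insert {last xs, hd xs} (list_edges xs)"
        unfolding xs_def list_edges_map cycle_graph_eq[OF n0] using n0
        by (simp add: hd_map last_map)
      finally show ?thesis .
    qed
    moreover have "length xs = n" by (simp add: xs_def)
    ultimately show ?thesis using H(1) n
      by (intro bexI[of _ xs]) (auto simp: plists_alt subgraph_def)
  qed
  show ?thesis unfolding acyclic_graph_def using 1 2 by blast
qed

lemma plists_mono:
  "verts H \<subseteq> verts G \<Longrightarrow> edges H \<subseteq> edges G \<Longrightarrow> plists H \<subseteq> plists G"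
proof
  fix xs assume "verts H \<subseteq> verts G" "edges H \<subseteq> edges G" "xs \<in> plists H"
  then show "xs \<in> plists G" unfolding plists_alt by blast
qed

section \<open>Attaching a pendant vertex\<close>

definition pend :: "'a graph \<Rightarrow> 'a \<Rightarrow> 'a \<Rightarrow> 'a graph" where
  "pend G u w = Graph (insert w (verts G)) (insert {u, w} (edges G))"

lemma verts_pend [simp]: "verts (pend G u w) = insert w (verts G)"
  and edges_pend [simp]: "edges (pend G u w) = insert {u, w} (edges G)"
  by (simp_all add: pend_def)

locale pendant =
  fixes G :: "'a graph" and u w :: 'a
  assumes simple: "simple_graph G" and u: "u \<in> verts G" and w: "w \<notin> verts G"
begin

lemma uw: "u \<noteq> w" using u w by auto

lemma simple_pend: "simple_graph (pend G u w)"
  using simple u w uw by (auto simp: simple_graph_def)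

lemma order_pend: "graph_order (pend G u w) = Suc (graph_order G)"
  using simple w by (simp add: graph_order_def simple_graph_def)

lemma w_notin_edge: "e \<in> edges G \<Longrightarrow> w \<notin> e"
  using simple w by (auto simp: simple_graph_def)

text \<open>Having \<open>u\<close> as its only neighbour, \<open>w\<close> can never be an inner
  vertex of a path. So a new path is \<open>[w]\<close>, or a path from \<open>u\<close> with
  \<open>w\<close> put in front, in one of two orientations.\<close>

lemma plists_pend:
  "plists (pend G u w) = plists G \<union> {[w]} \<union> (#) w ` plists_from G u \<union>
     (\<lambda>xs. rev (w # xs)) ` plists_from G u" (is "_ = ?R")
proof (intro set_eqI iffI)
  have cons: "w # xs \<in> plists (pend G u w)" if "xs \<in> plists_from G u" for xs
  proof -
    have "w \<notin> set xs" "list_edges (w # xs) \<subseteq> insert {u, w} (edges G)"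
      using that w by (cases xs; auto simp: plists_from_def plists_alt)+
    then show ?thesis using that by (auto simp: plists_from_def plists_alt)
  qed
  fix xs assume "xs \<in> ?R"
  then show "xs \<in> plists (pend G u w)"
  proof (elim UnE)
    assume "xs \<in> (\<lambda>xs. rev (w # xs)) ` plists_from G u"
    then obtain ys where "xs = rev (w # ys)" "ys \<in> plists_from G u" by blast
    then show ?thesis using cons by (simp del: rev.simps)
  next
    assume "xs \<in> plists G"
    then show ?thesis by (auto simp: plists_alt)
  next
    assume "xs \<in> (#) w ` plists_from G u"
    then show ?thesis using cons by blast
  next
    assume "xs \<in> {[w]}"
    then show ?thesis by (simp add: plists_alt)
  qed
next
  have old: "xs \<in> plists G" if "xs \<in> plists (pend G u w)" "w \<notin> set xs" for xs
    using that list_edges_subset[of "{u, w}" xs] by (auto simp: plists_alt)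
  have cons: "xs = [w] \<or> tl xs \<in> plists_from G u" if "xs \<in> plists (pend G u w)" "hd xs = w" for xs
  proof (cases xs rule: list_edges.cases)
    case (1 a b ys)
    then have ab: "a = w" "{w, b} \<in> insert {u, w} (edges G)" "w \<notin> set (b # ys)"
      using that by (auto simp: plists_alt)
    then have "b = u" using w_notin_edge[of "{w, b}"] by (auto simp: doubleton_eq_iff)
    have "tl xs \<in> plists (pend G u w)" using that 1 by (auto simp: plists_alt)
    then show ?thesis using old[of "tl xs"] 1 ab \<open>b = u\<close> by (simp add: plists_from_def)
  qed (use that in \<open>auto simp: plists_alt\<close>)
  fix xs assume xs: "xs \<in> plists (pend G u w)"
  consider "w \<notin> set xs" | "hd xs = w" | "last xs = w"
    | "w \<in> set xs" "w \<noteq> hd xs" "w \<noteq> last xs" by auto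
  then show "xs \<in> ?R"
  proof cases
    case 1
    then show ?thesis using old xs by blast
  next
    case 2
    have ne: "xs \<noteq> []" using xs by (simp add: plists_alt)
    show ?thesis using cons[OF xs 2]
    proof
      assume "tl xs \<in> plists_from G u"
      moreover have "xs = w # tl xs" using 2 ne by (cases xs) auto
      ultimately show ?thesis by blast
    qed simp
  next
    case 3
    have ne: "xs \<noteq> []" using xs by (simp add: plists_alt)
    have r: "rev xs \<in> plists (pend G u w)" "hd (rev xs) = w" using xs 3 ne by (simp_all add: hd_rev)
    show ?thesis using cons[OF r]
    proof
      assume t: "tl (rev xs) \<in> plists_from G u"
      have "rev xs = w # tl (rev xs)" using r(2) ne by (metis list.collapse rev_is_Nil_conv)
      then have "xs = rev (w # tl (rev xs))" by (metis rev_rev_ident)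
      with t show ?thesis by blast
    next
      assume "rev xs = [w]"
      then show ?thesis by simp
    qed
  next
    case 4
    then obtain a b where "a \<noteq> b" "{a, w} \<in> list_edges xs" "{w, b} \<in> list_edges xs"
      using list_edges_degree[of xs w] xs by (auto simp: plists_alt)
    then have "a \<noteq> b" "{a, w} \<in> insert {u, w} (edges G)" "{w, b} \<in> insert {u, w} (edges G)"
      using xs by (auto simp: plists_alt)
    then have False using w_notin_edge[of "{a, w}"] w_notin_edge[of "{w, b}"]
      by (auto simp: doubleton_eq_iff)
    then show ?thesis ..
  qed
qed

lemma w_notin_plists: "xs \<in> plists G \<Longrightarrow> w \<notin> set xs"
  using w by (auto simp: plists_alt)

lemma from_pend_new: "plists_from (pend G u w) w = insert [w] ((#) w ` plists_from G u)"
proof -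
  have "hd xs \<noteq> w" if "xs \<in> plists G" for xs
    using w_notin_plists[OF that] that by (auto simp: plists_alt)
  moreover have "hd (rev xs @ [w]) \<noteq> w" if "xs \<in> plists_from G u" for xs
    using w_notin_plists[of xs] that
    by (auto simp: plists_from_def plists_alt hd_append hd_rev)
  ultimately have e: "{xs \<in> plists G. hd xs = w} = {}"
    "{xs \<in> (\<lambda>xs. rev (w # xs)) ` plists_from G u. hd xs = w} = {}" by auto
  have "plists_from (pend G u w) w = {xs \<in> plists G. hd xs = w} \<union>
      insert [w] ((#) w ` plists_from G u) \<union> {xs \<in> (\<lambda>xs. rev (w # xs)) ` plists_from G u. hd xs = w}"
    unfolding plists_from_def[of "pend G u w"] plists_pend by (auto simp del: rev.simps)
  then show ?thesis unfolding e by simp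
qed

lemma from_pend_old:
  assumes x: "x \<in> verts G"
  shows "plists_from (pend G u w) x = plists_from G x \<union> (\<lambda>xs. xs @ [w]) ` plists_between G x u"
proof -
  have xw: "x \<noteq> w" using x w by auto
  have "{xs \<in> (\<lambda>xs. rev (w # xs)) ` plists_from G u. hd xs = x} = (\<lambda>xs. xs @ [w]) ` plists_between G x u"
  proof (intro set_eqI iffI)
    fix xs assume "xs \<in> {xs \<in> (\<lambda>xs. rev (w # xs)) ` plists_from G u. hd xs = x}"
    then obtain ys where ys: "ys \<in> plists G" "hd ys = u" "xs = rev ys @ [w]" "hd xs = x"
      by (auto simp: plists_from_def)
    then have "rev ys \<in> plists_between G x u"
      by (auto simp: plists_between_def last_rev plists_alt)
    then show "xs \<in> (\<lambda>xs. xs @ [w]) ` plists_between G x u" using ys by blast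
  next
    fix xs assume "xs \<in> (\<lambda>xs. xs @ [w]) ` plists_between G x u"
    then obtain ys where ys: "ys \<in> plists G" "hd ys = x" "last ys = u" "xs = ys @ [w]"
      by (auto simp: plists_between_def)
    then have "ys \<noteq> []" by (simp add: plists_alt)
    then have "xs = rev (w # rev ys)" "rev ys \<in> plists_from G u" "hd xs = x"
      using ys by (auto simp: plists_from_def hd_rev)
    then show "xs \<in> {xs \<in> (\<lambda>xs. rev (w # xs)) ` plists_from G u. hd xs = x}" by blast
  qed
  moreover have "plists_from (pend G u w) x =
      plists_from G x \<union> {xs \<in> (\<lambda>xs. rev (w # xs)) ` plists_from G u. hd xs = x}"
    unfolding plists_from_def[of _ x] plists_pend using xw by auto
  ultimately show ?thesis by simp
qed

lemma between_pend_new: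
  assumes x: "x \<in> verts G"
  shows "plists_between (pend G u w) x w = (\<lambda>xs. xs @ [w]) ` plists_between G x u"
proof -
  have "plists_between (pend G u w) x w = {xs \<in> plists_from (pend G u w) x. last xs = w}"
    by (auto simp: plists_from_def plists_between_def)
  moreover have "last xs \<noteq> w" if "xs \<in> plists G" for xs
    using w_notin_plists[OF that] that by (auto simp: plists_alt)
  ultimately show ?thesis unfolding from_pend_old[OF x] by (auto simp: plists_from_def)
qed

lemma between_pend_old:
  assumes x: "x \<in> verts G" and y: "y \<in> verts G"
  shows "plists_between (pend G u w) x y = plists_between G x y"
proof -
  have "plists_between (pend G u w) x y = {xs \<in> plists_from (pend G u w) x. last xs = y}"
    by (auto simp: plists_from_def plists_between_def)
  moreover have "y \<noteq> w" using y w by auto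
  ultimately show ?thesis unfolding from_pend_old[OF x]
    by (auto simp: plists_from_def plists_between_def)
qed

lemma between_pend_self: "plists_between (pend G u w) w w = {[w]}"
proof -
  have "last (w # ys) \<noteq> w" if "ys \<in> plists_from G u" for ys
    using w_notin_plists[of ys] that by (auto simp: plists_alt plists_from_def)
  then have e: "{xs \<in> (#) w ` plists_from G u. last xs = w} = {}" by blast
  have "plists_between (pend G u w) w w = {xs \<in> plists_from (pend G u w) w. last xs = w}"
    by (auto simp: plists_from_def plists_between_def)
  moreover have "{xs \<in> insert [w] S. last xs = w} = insert [w] {xs \<in> S. last xs = w}" for S
    by auto
  ultimately show ?thesis unfolding from_pend_new by (simp only: e)
qed

end

lemma path_sum_Un:
  "finite A \<Longrightarrow> finite B \<Longrightarrow> A \<inter> B = {} \<Longrightarrow> path_sum (A \<union> B) = path_sum A + path_sum B"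
  by (simp add: path_sum_def sum.union_disjoint)

lemma path_sum_insert:
  "finite A \<Longrightarrow> x \<notin> A \<Longrightarrow> path_sum (insert x A) = (length x - 1) + path_sum A"
  by (simp add: path_sum_def)

lemma path_sum_Cons_image:
  assumes "finite A" "[] \<notin> A"
  shows "path_sum ((#) w ` A) = path_sum A + card A"
proof -
  have "path_sum ((#) w ` A) = (\<Sum>xs\<in>A. length xs)"
    unfolding path_sum_def by (subst sum.reindex) auto
  also have "\<dots> = (\<Sum>xs\<in>A. (length xs - 1) + 1)"
    using assms by (intro sum.cong refl) (metis One_nat_def Suc_eq_plus1 Suc_pred length_greater_0_conv)
  also have "\<dots> = path_sum A + card A" unfolding path_sum_def sum.distrib by simp
  finally show ?thesis .
qed

lemma path_sum_rev_image: "path_sum (rev ` A) = path_sum A"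
  unfolding path_sum_def by (subst sum.reindex) (auto simp: inj_on_def)

lemma card_rev_image: "card (rev ` A) = card A"
  by (rule card_image) (auto simp: inj_on_def)

lemma card_insert_rev_closed:
  "finite A \<Longrightarrow> A \<inter> rev ` A = {} \<Longrightarrow> x \<notin> A \<union> rev ` A \<Longrightarrow>
     card (insert x (A \<union> rev ` A)) = 1 + 2 * card A"
  by (simp add: card_Un_disjoint card_rev_image)

lemma path_sum_insert_rev_closed:
  "finite A \<Longrightarrow> A \<inter> rev ` A = {} \<Longrightarrow> x \<notin> A \<union> rev ` A \<Longrightarrow>
     path_sum (insert x (A \<union> rev ` A)) = (length x - 1) + 2 * path_sum A"
  by (simp add: path_sum_insert path_sum_Un path_sum_rev_image)

context pendant
begin

lemma nil_notin: "[] \<notin> plists_from G x" "[] \<notin> plists_between G x y"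
  by (auto simp: plists_from_def plists_between_def plists_alt)

lemma rev_Cons_image: "(\<lambda>xs. rev (w # xs)) ` A = rev ` (#) w ` A"
  by (simp add: image_image)

lemma append_image: "(\<lambda>xs. xs @ [w]) ` A = rev ` (#) w ` rev ` A"
  by (simp add: image_image)

lemma at_pend: "{xs \<in> plists (pend G u w). w \<in> set xs} =
    insert [w] ((#) w ` plists_from G u \<union> rev ` (#) w ` plists_from G u)"
  unfolding plists_pend rev_Cons_image using w_notin_plists by auto

text \<open>A list that starts with \<open>w\<close> and one that ends with \<open>w\<close> after a
  path of \<open>G\<close> differ in their first vertices. Hence the two orientations are counted
  separately and the recurrences are exact.\<close>

lemma disjoint_parts:
  "(#) w ` plists_from G u \<inter> rev ` (#) w ` plists_from G u = {}"
  "[w] \<notin> (#) w ` plists_from G u \<union> rev ` (#) w ` plists_from G u"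
proof -
  have neq: "w # xs \<noteq> rev (w # ys)" if "xs \<in> plists_from G u" "ys \<in> plists_from G u" for xs ys
  proof
    assume "w # xs = rev (w # ys)"
    then have "hd (w # xs) = hd (rev (w # ys))" by simp
    moreover have "hd (rev (w # ys)) = last ys" "last ys \<in> set ys" 
      using that by (auto simp: hd_append hd_rev plists_from_def plists_alt)
    ultimately show False using w_notin_plists[of ys] that by (simp add: plists_from_def)
  qed
  show "(#) w ` plists_from G u \<inter> rev ` (#) w ` plists_from G u = {}"
  proof (rule equals0I, elim IntE imageE)
    fix x xs zs ys assume "x = w # xs" "xs \<in> plists_from G u" "x = rev zs" "zs = w # ys" "ys \<in> plists_from G u"
    then show False using neq[of xs ys] by simp
  qed
  have ne: "[w] \<noteq> w # xs" "[w] \<noteq> rev (w # xs)" if "xs \<in> plists_from G u" for xs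
    using that nil_notin(1)[of u] by auto
  show "[w] \<notin> (#) w ` plists_from G u \<union> rev ` (#) w ` plists_from G u"
  proof (rule notI, elim UnE imageE)
    fix zs ys assume "[w] = rev zs" "zs = w # ys" "ys \<in> plists_from G u"
    then show False using ne(2)[of ys] by blast
  next
    fix xs assume "[w] = w # xs" "xs \<in> plists_from G u"
    then show False using ne(1)[of xs] by blast
  qed
qed

lemma card_at_pend:
  "card {xs \<in> plists (pend G u w). w \<in> set xs} = 1 + 2 * card (plists_from G u)"
proof -
  have "finite ((#) w ` plists_from G u)" "card ((#) w ` plists_from G u) = card (plists_from G u)"
    using simple by (simp_all add: card_image)
  then show ?thesis unfolding at_pend by (simp add: card_insert_rev_closed[OF _ disjoint_parts])
qed

lemma sum_at_pend:
  "path_sum {xs \<in> plists (pend G u w). w \<in> set xs} =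
     2 * (path_sum (plists_from G u) + card (plists_from G u))"
proof -
  have "finite ((#) w ` plists_from G u)"
    "path_sum ((#) w ` plists_from G u) = path_sum (plists_from G u) + card (plists_from G u)"
    using simple nil_notin by (simp_all add: path_sum_Cons_image)
  then show ?thesis unfolding at_pend by (simp add: path_sum_insert_rev_closed[OF _ disjoint_parts])
qed

lemma plists_pend_split:
  "plists (pend G u w) = plists G \<union> {xs \<in> plists (pend G u w). w \<in> set xs}"
  "plists G \<inter> {xs \<in> plists (pend G u w). w \<in> set xs} = {}"
proof -
  let ?A = "(#) w ` plists_from G u"
  show "plists (pend G u w) = plists G \<union> {xs \<in> plists (pend G u w). w \<in> set xs}"
    unfolding at_pend unfolding plists_pend rev_Cons_image
    by (simp only: Un_assoc insert_is_Un[of "[w]" "?A \<union> rev ` ?A"])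
  show "plists G \<inter> {xs \<in> plists (pend G u w). w \<in> set xs} = {}"
    using w_notin_plists by blast
qed

text \<open>Each list from \<open>u\<close> yields two new lists; the extra 1 is \<open>[w]\<close>,
  which has length 0 and therefore leaves no trace in \<open>sum_plists_pend\<close>.\<close>

lemma card_plists_pend:
  "card (plists (pend G u w)) = card (plists G) + 1 + 2 * card (plists_from G u)"
  using card_Un_disjoint[OF _ _ plists_pend_split(2)] simple simple_pend
  unfolding plists_pend_split(1)[symmetric] card_at_pend by simp

lemma sum_plists_pend:
  "path_sum (plists (pend G u w)) =
     path_sum (plists G) + 2 * (path_sum (plists_from G u) + card (plists_from G u))"
  using path_sum_Un[OF _ _ plists_pend_split(2)] simple simple_pend
  unfolding plists_pend_split(1)[symmetric] sum_at_pend by simp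

lemma card_from_pend_new: "card (plists_from (pend G u w) w) = 1 + card (plists_from G u)"
  unfolding from_pend_new using simple nil_notin by (subst card_insert_disjoint) (auto simp: card_image)

lemma sum_from_pend_new:
  "path_sum (plists_from (pend G u w) w) = path_sum (plists_from G u) + card (plists_from G u)"
  unfolding from_pend_new using simple nil_notin
  by (subst path_sum_insert) (auto simp: path_sum_Cons_image)

lemma from_pend_disj: "plists_from G x \<inter> (\<lambda>xs. xs @ [w]) ` plists_between G x u = {}"
  using w_notin_plists by (fastforce simp: plists_from_def)

lemma card_from_pend_old:
  assumes x: "x \<in> verts G"
  shows "card (plists_from (pend G u w) x) = card (plists_from G x) + card (plists_between G x u)"
  unfolding from_pend_old[OF x] using simple from_pend_disj
  by (subst card_Un_disjoint) (auto simp: card_image inj_on_def)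

lemma sum_from_pend_old:
  assumes x: "x \<in> verts G"
  shows "path_sum (plists_from (pend G u w) x) =
    path_sum (plists_from G x) + path_sum (plists_between G x u) + card (plists_between G x u)"
proof -
  have "[] \<notin> rev ` plists_between G x u" using nil_notin by auto
  then show ?thesis
    unfolding from_pend_old[OF x] using simple from_pend_disj
    by (subst path_sum_Un)
      (simp_all add: append_image path_sum_Cons_image path_sum_rev_image card_rev_image)
qed

text \<open>Every path containing a pendant vertex ends there. The two orientations, together with
  the trivial path counted once more, exactly double numerator and denominator.\<close>

lemma avp_at_pend:
  "avp_at (pend G u w) w =
     path_sum (plists_from (pend G u w) w) / real (card (plists_from (pend G u w) w))"
proof -
  have "avp_at (pend G u w) w = real (2 * path_sum (plists_from (pend G u w) w)) /
      real (2 * card (plists_from (pend G u w) w))"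
    using avp_at_plists[OF simple_pend, of w] card_at_pend sum_at_pend
    by (simp add: sum_from_pend_new card_from_pend_new)
  then show ?thesis by simp
qed

lemma connected_pend:
  assumes "connected_graph G"
  shows "connected_graph (pend G u w)"
  unfolding connected_graph_plists
proof (intro conjI ballI)
  show "simple_graph (pend G u w)" by (rule simple_pend)
  show "verts (pend G u w) \<noteq> {}" by simp
  have G: "plists_between G x y \<noteq> {}" if "x \<in> verts G" "y \<in> verts G" for x y
    using assms that by (auto simp: connected_graph_plists)
  have sym: "rev ` plists_between (pend G u w) y x \<subseteq> plists_between (pend G u w) x y" for x y
    by (auto simp: plists_between_def hd_rev last_rev)
  fix x y assume "x \<in> verts (pend G u w)" "y \<in> verts (pend G u w)"
  then consider "x = w" "y = w" | "x \<in> verts G" "y = w" | "x = w" "y \<in> verts G" | "x \<in> verts G" "y \<in> verts G"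
    by auto
  then show "plists_between (pend G u w) x y \<noteq> {}"
  proof cases
    case 1
    then show ?thesis by (simp add: between_pend_self)
  next
    case 2
    then show ?thesis by (simp add: between_pend_new G u)
  next
    case 3
    then have "plists_between (pend G u w) y x \<noteq> {}" by (simp add: between_pend_new G u)
    then show ?thesis using sym[of y x] by blast
  next
    case 4
    then show ?thesis by (simp add: between_pend_old G)
  qed
qed

text \<open>A cycle through \<open>w\<close> would need an edge from \<open>w\<close> to the last
  vertex of a path from \<open>u\<close> with at least two vertices; but \<open>w\<close> is
  adjacent to \<open>u\<close> only, and \<open>u\<close> occurs just at the start of that
  path.\<close>

lemma tree_pend:
  assumes "tree G"
  shows "tree (pend G u w)"
proof -
  have con: "connected_graph (pend G u w)" using assms connected_pend by (simp add: tree_def)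
  have acy: "acyclic_graph G" using assms by (simp add: tree_def)
  have 1: "\<not> {w, last xs} \<in> insert {u, w} (edges G)" if as: "xs \<in> plists_from G u" "length xs \<ge> 2" for xs
  proof -
    obtain b ys where xs: "xs = u # b # ys" using as by (cases xs rule: list_edges.cases) (auto simp: plists_from_def)
    then have "last xs \<in> set (b # ys)" "u \<notin> set (b # ys)" using that by (auto simp: plists_from_def plists_alt)
    then have "last xs \<noteq> u" by metis
    moreover have "last xs \<noteq> w" using w_notin_plists[of xs] that(1) xs by (auto simp: plists_from_def)
    ultimately show ?thesis using w_notin_edge[of "{w, last xs}"] by (auto simp: doubleton_eq_iff)
  qed
  have "acyclic_graph (pend G u w)"
    unfolding acyclic_graph_plists[OF simple_pend]
  proof (intro notI, elim bexE conjE)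
    fix xs assume xs: "xs \<in> plists (pend G u w)" and l: "3 \<le> length xs"
      and e: "{last xs, hd xs} \<in> edges (pend G u w)"
    from xs consider "xs \<in> plists G" | "xs = [w]" | ys where "xs = w # ys" "ys \<in> plists_from G u"
      | ys where "xs = rev (w # ys)" "ys \<in> plists_from G u"
      unfolding plists_pend by blast
    then show False
    proof cases
      case 1
      then have "xs \<noteq> []" by (simp add: plists_alt)
      then have "w \<notin> {last xs, hd xs}" using w_notin_plists[OF 1] by auto
      then have "{last xs, hd xs} \<in> edges G" using e by auto
      then show ?thesis using acy 1 l by (auto simp: acyclic_graph_plists[OF simple])
    next
      case 2
      then show ?thesis using l by simp
    next
      case (3 ys)
      then have "ys \<noteq> []" by (auto simp: plists_from_def plists_alt)
      then show ?thesis using 1[OF 3(2)] 3 l e by (simp add: insert_commute)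
    next
      case (4 ys)
      then have "ys \<noteq> []" by (auto simp: plists_from_def plists_alt)
      then show ?thesis using 1[OF 4(2)] 4 l e by (simp add: insert_commute hd_append hd_rev)
    qed
  qed
  then show ?thesis using con by (simp add: tree_def)
qed

end

section \<open>Leaves, and induction over trees\<close>

lemma tree_simple: "tree G \<Longrightarrow> simple_graph G"
  by (simp add: tree_def connected_graph_def)

lemma connected_simple: "connected_graph G \<Longrightarrow> simple_graph G"
  by (simp add: connected_graph_def)

lemma tree_single: "tree (Graph {v} {})"
proof -
  have s: "simple_graph (Graph {v} {})" by (simp add: simple_graph_def)
  then show ?thesis by (auto simp: tree_def connected_graph_def acyclic_graph_plists)
qed

text \<open>A neighbour \<open>y\<close> of the last vertex \<open>w\<close> lies on
  \<open>xs\<close>, otherwise \<open>xs\<close> could be prolonged. Unless \<open>y\<close> is the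
  last vertex but one, the part of \<open>xs\<close> from \<open>y\<close> to \<open>w\<close>
  closes to a cycle. So \<open>w\<close> is a leaf. The longest path is explicit because moving a
  leaf later requires one far from \<open>c\<close>.\<close>

lemma longest_from_leaf:
  assumes T: "tree G" and xs: "xs \<in> plists_from G c" "length xs \<ge> 2"
    and max: "\<And>ys. ys \<in> plists_from G c \<Longrightarrow> length ys \<le> length xs"
  defines "w \<equiv> last xs" and "u \<equiv> last (butlast xs)"
  defines "G' \<equiv> Graph (verts G - {w}) (edges G - {{u, w}})"
  shows "tree G'" "u \<in> verts G'" "w \<notin> verts G'" "w \<noteq> c" "G = pend G' u w"
proof -
  have s: "simple_graph G" using T by (rule tree_simple)
  obtain zs where xs_eq: "xs = zs @ [u, w]"
  proof -
    have "xs = butlast xs @ [w]" using xs(2) unfolding w_def by (cases xs) auto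
    moreover have "butlast xs = butlast (butlast xs) @ [u]"
      using xs(2) unfolding u_def by (cases xs rule: list_edges.cases) auto
    ultimately show ?thesis using that[of "butlast (butlast xs)"] by (metis append.assoc append_Cons append_Nil)
  qed
  have p: "distinct xs" "set xs \<subseteq> verts G" "list_edges xs \<subseteq> edges G" "hd xs = c"
    using xs by (auto simp: plists_from_def plists_alt)
  have uw: "u \<noteq> w" and uV: "u \<in> verts G" and wV: "w \<in> verts G" and e: "{u, w} \<in> edges G"
    using p unfolding xs_eq by (auto simp: list_edges_append split: if_splits)
  show "u \<in> verts G'" "w \<notin> verts G'" using uw uV by (auto simp: G'_def)
  show "w \<noteq> c" using p(1,4) unfolding xs_eq by (cases zs) auto
  have only: "y = u" if y: "{w, y} \<in> edges G" for y
  proof -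
    have yw: "y \<noteq> w" using y s by (auto simp: simple_graph_def)
    have "y \<in> set xs"
    proof (rule ccontr)
      assume n: "y \<notin> set xs"
      have "y \<in> verts G" using y s by (auto simp: simple_graph_def)
      then have "xs @ [y] \<in> plists_from G c"
        using p n y xs(2) unfolding w_def by (auto simp: plists_from_def plists_alt list_edges_append hd_append)
      then show False using max by fastforce
    qed
    then obtain as bs where sp: "xs = as @ y # bs" by (meson split_list)
    have last: "last (y # bs) = w" using sp w_def by simp
    have "\<not> 3 \<le> length (y # bs)"
    proof
      assume 3: "3 \<le> length (y # bs)"
      have "y # bs \<in> plists G" using p unfolding sp by (auto simp: plists_alt list_edges_append split: if_splits)
      then show False using T 3 y last acyclic_graph_plists[OF s] unfolding tree_def
        by (metis list.sel(1))
    qed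
    moreover have "bs \<noteq> []" using last yw by auto
    ultimately obtain b where "bs = [b]" by (cases bs rule: list_edges.cases) auto
    then show "y = u" using sp xs_eq by auto
  qed
  show eq: "G = pend G' u w"
    using e wV by (intro graph_eqI) (auto simp: G'_def)
  have noedge: "w \<notin> d" if "d \<in> edges G'" for d
  proof
    assume "w \<in> d"
    from that have "d \<in> edges G" "d \<noteq> {u, w}" by (auto simp: G'_def)
    moreover then have "card d = 2" using s by (auto simp: simple_graph_def)
    then obtain y where "d = {w, y}" using \<open>w \<in> d\<close> by (auto simp: card_2_iff)
    ultimately show False using only by (auto simp: insert_commute)
  qed
  have s': "simple_graph G'" using s noedge by (auto simp: simple_graph_def G'_def)
  interpret pendant G' u w
    using s' \<open>u \<in> verts G'\<close> \<open>w \<notin> verts G'\<close> by unfold_locales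
  have "connected_graph G'"
    unfolding connected_graph_plists
  proof (intro conjI ballI)
    fix x y assume xy: "x \<in> verts G'" "y \<in> verts G'"
    then have "x \<in> verts G" "y \<in> verts G" by (auto simp: G'_def)
    then have "plists_between G x y \<noteq> {}" using T by (auto simp: tree_def connected_graph_plists)
    then show "plists_between G' x y \<noteq> {}" using between_pend_old[OF xy] eq by simp
  qed (use s' \<open>u \<in> verts G'\<close> in auto)
  moreover have "acyclic_graph G'"
    using T acyclic_graph_plists[OF s] acyclic_graph_plists[OF s'] plists_mono[of G' G]
    by (auto simp: tree_def G'_def)
  ultimately show "tree G'" by (simp add: tree_def)
qed

lemma ex_longest_from:
  assumes G: "connected_graph G" and c: "c \<in> verts G"
  obtains xs where "xs \<in> plists_from G c" "\<And>ys. ys \<in> plists_from G c \<Longrightarrow> length ys \<le> length xs"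
proof -
  have "[c] \<in> plists_from G c" using c by (simp add: plists_from_def plists_alt)
  moreover have "finite (plists_from G c)" using G by (simp add: connected_simple)
  ultimately have fin: "finite (length ` plists_from G c)" and "length ` plists_from G c \<noteq> {}" by auto
  then have "Max (length ` plists_from G c) \<in> length ` plists_from G c" by (rule Max_in)
  then obtain xs where "xs \<in> plists_from G c" "length xs = Max (length ` plists_from G c)" by auto
  then show ?thesis using that[of xs] Max_ge[OF fin] by simp
qed

lemma ex_long_from:
  assumes G: "connected_graph G" and c: "c \<in> verts G" and n: "graph_order G \<ge> 2"
  shows "\<exists>xs \<in> plists_from G c. length xs \<ge> 2"
proof -
  have "verts G \<noteq> {c}" using n by (auto simp: graph_order_def)
  then obtain v where "v \<in> verts G" "v \<noteq> c" using c by blast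
  then obtain xs where xs: "xs \<in> plists_between G c v" using G c by (auto simp: connected_graph_plists)
  then have "length xs \<ge> 2" using \<open>v \<noteq> c\<close>
    by (cases xs rule: list_edges.cases) (auto simp: plists_between_def plists_alt)
  then show ?thesis using xs by (auto simp: plists_from_def plists_between_def)
qed

text \<open>A leaf can be removed while a prescribed vertex \<open>c\<close> stays; inductions on
  sums of distances from a fixed vertex depend on this.\<close>

lemma tree_leaf:
  assumes T: "tree G" and c: "c \<in> verts G" and n: "graph_order G \<ge> 2"
  obtains G' u w where "tree G'" "u \<in> verts G'" "w \<notin> verts G'" "w \<noteq> c" "G = pend G' u w"
proof -
  have con: "connected_graph G" using T by (simp add: tree_def)
  obtain xs where xs: "xs \<in> plists_from G c" "\<And>ys. ys \<in> plists_from G c \<Longrightarrow> length ys \<le> length xs"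
    using ex_longest_from[OF con c] by blast
  have "length xs \<ge> 2" using ex_long_from[OF con c n] xs(2) by fastforce
  then show ?thesis using longest_from_leaf[OF T xs(1) _ xs(2)] that by blast
qed

lemma tree_induct [consumes 1, case_names single pend]:
  assumes T: "tree G" and base: "\<And>v. P (Graph {v} {})"
    and step: "\<And>G u w. tree G \<Longrightarrow> u \<in> verts G \<Longrightarrow> w \<notin> verts G \<Longrightarrow> P G \<Longrightarrow> P (pend G u w)"
  shows "P G"
  using T
proof (induction "graph_order G" arbitrary: G rule: less_induct)
  case less
  have con: "connected_graph G" using less.prems by (simp add: tree_def)
  then obtain c where c: "c \<in> verts G" by (auto simp: connected_graph_def)
  show ?case
  proof (cases "graph_order G \<ge> 2")
    case True
    then obtain G' u w where G': "tree G'" "u \<in> verts G'" "w \<notin> verts G'" "w \<noteq> c" "G = pend G' u w"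
      using tree_leaf[OF less.prems c] by blast
    interpret pendant G' u w using G' tree_simple by unfold_locales auto
    show ?thesis using less.hyps[of G'] G' step order_pend by auto
  next
    case False
    have fin: "finite (verts G)" using con by (simp add: connected_graph_def simple_graph_def)
    then have "card (verts G) > 0" using c by (auto simp: card_gt_0_iff)
    then have "card (verts G) = 1" using False by (simp add: graph_order_def)
    then have V: "verts G = {c}" using c by (auto simp: card_1_singleton_iff)
    have "edges G = {}"
    proof (rule ccontr)
      assume "edges G \<noteq> {}"
      then obtain e where "e \<subseteq> {c}" "card e = 2" using con V by (auto simp: connected_graph_def simple_graph_def)
      then show False using card_mono[of "{c}" e] by simp
    qed
    then have "G = Graph {c} {}" using V by (intro graph_eqI) auto
    then show ?thesis using base by simp
  qed
qed

lemma tree_edges_card: "tree G \<Longrightarrow> Suc (card (edges G)) = graph_order G \<and> finite (edges G)"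
proof (induction rule: tree_induct)
  case (pend G u w)
  interpret pendant G u w using pend tree_simple by unfold_locales auto
  have "{u, w} \<notin> edges G" using w_notin_edge by blast
  then show ?case using pend order_pend by simp
qed (simp add: graph_order_def)

lemma plists_single [simp]: "plists (Graph {v} {}) = {[v]}"
proof -
  have "xs = [v]" if "xs \<in> plists (Graph {v} {})" for xs
    using that by (cases xs rule: list_edges.cases) (auto simp: plists_alt)
  moreover have "[v] \<in> plists (Graph {v} {})" by (simp add: plists_alt)
  ultimately show ?thesis by blast
qed

lemma plists_between_self:
  assumes "x \<in> verts G"
  shows "plists_between G x x = {[x]}"
proof -
  have "xs = [x]" if "xs \<in> plists_between G x x" for xs
  proof (cases xs rule: list_edges.cases)
    case (1 a b ys)
    have "last (b # ys) \<in> set (b # ys)" by (rule last_in_set) simp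
    moreover have "last (b # ys) = a" "a \<notin> set (b # ys)"
      using that 1 by (auto simp: plists_between_def plists_alt)
    ultimately show ?thesis by metis
  qed (use that in \<open>simp_all add: plists_between_def plists_alt\<close>)
  moreover have "[x] \<in> plists_between G x x" using assms by (simp add: plists_between_def plists_alt)
  ultimately show ?thesis by blast
qed

text \<open>Uniqueness is inherited as a tree grows: a pendant vertex creates no path between old
  vertices, and a path to it is a path to its neighbour prolonged by one edge.\<close>

lemma tree_card_between:
  "tree G \<Longrightarrow> x \<in> verts G \<Longrightarrow> y \<in> verts G \<Longrightarrow> card (plists_between G x y) = 1"
proof (induction arbitrary: x y rule: tree_induct)
  case (single v)
  then show ?case by (simp add: plists_between_self)
next
  case (pend G u w)
  interpret pendant G u w using pend tree_simple by unfold_locales auto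
  have sym: "rev ` plists_between H y x = plists_between H x y" for H x y
  proof -
    have "rev ` plists_between H y x \<subseteq> plists_between H x y" for x y
      by (auto simp: plists_between_def hd_rev last_rev)
    then have "rev ` plists_between H y x \<subseteq> plists_between H x y"
      "rev ` rev ` plists_between H x y \<subseteq> rev ` plists_between H y x" by (blast intro: image_mono)+
    then show ?thesis by (simp add: image_image)
  qed
  have new: "card (plists_between (pend G u w) x w) = 1" if "x \<in> verts G" for x
    using pend.IH[OF that u] between_pend_new[OF that] by (simp add: card_image inj_on_def)
  have "card (plists_between (pend G u w) w x) = 1" if "x \<in> verts G" for x
    using new[OF that] card_rev_image[of "plists_between (pend G u w) w x"]
    unfolding sym by simp
  then show ?case using pend new between_pend_self between_pend_old by auto
qed

subsection \<open>Paths and stars among trees\<close>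

lemma tree_finite: "tree G \<Longrightarrow> finite (verts G)"
  by (simp add: tree_def connected_graph_def simple_graph_def)

lemma connected_order_pos: "connected_graph G \<Longrightarrow> graph_order G \<ge> 1"
  by (simp add: graph_order_def connected_graph_def simple_graph_def card_gt_0_iff Suc_le_eq)

lemma tree_order_pos: "tree G \<Longrightarrow> graph_order G \<ge> 1"
  unfolding tree_def using connected_order_pos by blast

lemma tree_card_from: "tree G \<Longrightarrow> x \<in> verts G \<Longrightarrow> card (plists_from G x) = graph_order G"
proof (induction arbitrary: x rule: tree_induct)
  case (single v)
  then have "plists_from (Graph {v} {}) x = plists_between (Graph {v} {}) x x"
    by (auto simp: plists_from_def plists_between_def)
  then show ?case using single plists_between_self[of x "Graph {v} {}"] by (simp add: graph_order_def)
next
  case (pend G u w)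
  interpret pendant G u w using pend tree_simple by unfold_locales auto
  show ?case
  proof (cases "x = w")
    case True
    then show ?thesis using pend card_from_pend_new order_pend by simp
  next
    case False
    then have x: "x \<in> verts G" using pend by simp
    show ?thesis using pend.IH[OF x] card_from_pend_old[OF x] order_pend
        tree_card_between[OF pend.hyps(1) x u] by simp
  qed
qed

lemma tree_card_plists: "tree G \<Longrightarrow> card (plists G) = (graph_order G)\<^sup>2"
proof (induction rule: tree_induct)
  case (pend G u w)
  interpret pendant G u w using pend tree_simple by unfold_locales auto
  show ?case using pend card_plists_pend order_pend tree_card_from[OF pend.hyps(1) u]
    by (simp add: power2_eq_square)
qed (simp add: graph_order_def)

lemma avp_tree:
  "tree G \<Longrightarrow> avp G = real (path_sum (plists G)) / (real (graph_order G) * real (graph_order G + 1))"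
  by (simp add: avp_plists tree_simple tree_card_plists power2_eq_square algebra_simps)

lemma path_sum_between_le:
  assumes "simple_graph G"
  shows "path_sum (plists_between G x y) + card (plists_between G x y) \<le> graph_order G * card (plists_between G x y)"
proof -
  have "(\<Sum>xs\<in>plists_between G x y. (length xs - 1) + 1) \<le> (\<Sum>xs\<in>plists_between G x y. graph_order G)"
  proof (rule sum_mono)
    fix xs assume "xs \<in> plists_between G x y"
    then have "xs \<in> plists G" "xs \<noteq> []" by (simp_all add: plists_between_def plists_alt)
    then show "length xs - 1 + 1 \<le> graph_order G" using length_plists[OF assms, of xs] by (cases xs) auto
  qed
  then show ?thesis by (simp add: path_sum_def sum.distrib mult.commute sum_Suc)
qed

text \<open>Removing a leaf other than \<open>x\<close> loses a single distance, which is at most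
  the order of the remaining tree; the bound is the sum 1 + ... + (n - 1), doubled.\<close>

lemma tree_sum_from_le:
  "tree G \<Longrightarrow> x \<in> verts G \<Longrightarrow> 2 * path_sum (plists_from G x) \<le> graph_order G * (graph_order G - 1)"
proof (induction "graph_order G" arbitrary: G rule: less_induct)
  case less
  show ?case
  proof (cases "graph_order G \<ge> 2")
    case True
    then obtain G' u w where G': "tree G'" "u \<in> verts G'" "w \<notin> verts G'" "w \<noteq> x" "G = pend G' u w"
      using tree_leaf[OF less.prems] by blast
    interpret pendant G' u w using G' tree_simple by unfold_locales auto
    have x: "x \<in> verts G'" using G' less.prems by auto
    define n where "n = graph_order G'"
    have "n \<ge> 1" using tree_order_pos[OF G'(1)] n_def by simp
    have "2 * path_sum (plists_from G' x) \<le> n * (n - 1)"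
      using less.hyps[of G'] G' order_pend x unfolding n_def by simp
    moreover have "path_sum (plists_between G' x u) + card (plists_between G' x u) \<le> n"
      using path_sum_between_le[OF simple, of x u] tree_card_between[OF G'(1) x u] n_def by simp
    ultimately have "2 * path_sum (plists_from G x) \<le> n * (n - 1) + 2 * n"
      unfolding G'(5) sum_from_pend_old[OF x] by simp
    also have "\<dots> = Suc n * n" using \<open>n \<ge> 1\<close> by (cases n) auto
    finally show ?thesis using order_pend G'(5) n_def by simp
  next
    case False
    then have n: "graph_order G = 1" using tree_order_pos[OF less.prems(1)] by simp
    have "length xs \<le> 1" if "xs \<in> plists_from G x" for xs
      using that n length_plists[OF tree_simple[OF less.prems(1)], of xs] by (simp add: plists_from_def)
    then have "path_sum (plists_from G x) = 0" by (simp add: path_sum_def)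
    then show ?thesis by simp
  qed
qed

text \<open>A pendant vertex adds twice its sum of distances, and by \<open>tree_sum_from_le\<close>
  this is at most what the next end vertex of a path adds. The right-hand side is the value for the
  path.\<close>

lemma tree_sum_le:
  "tree G \<Longrightarrow> 3 * path_sum (plists G) \<le> (graph_order G - 1) * graph_order G * (graph_order G + 1)"
proof (induction rule: tree_induct)
  case (pend G u w)
  interpret pendant G u w using pend tree_simple by unfold_locales auto
  define n where "n = graph_order G"
  have "n \<ge> 1" using tree_order_pos[OF pend.hyps(1)] n_def by simp
  then obtain k where k: "n = Suc k" by (cases n) auto
  have "2 * path_sum (plists_from G u) \<le> n * (n - 1)"
    using tree_sum_from_le[OF pend.hyps(1) u] n_def by simp
  moreover have "card (plists_from G u) = n" using tree_card_from[OF pend.hyps(1) u] n_def by simp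
  moreover have "3 * path_sum (plists G) \<le> (n - 1) * n * (n + 1)" using pend.IH n_def by simp
  moreover have "3 * path_sum (plists (pend G u w)) =
      3 * path_sum (plists G) + 3 * (2 * path_sum (plists_from G u)) + 6 * card (plists_from G u)"
    unfolding sum_plists_pend by simp
  ultimately have "3 * path_sum (plists (pend G u w)) \<le> (n - 1) * n * (n + 1) + 3 * (n * (n - 1)) + 6 * n"
    by (simp only:)
  also have "\<dots> = n * (n + 1) * (n + 2)" unfolding k by (simp add: algebra_simps)
  finally show ?case using order_pend n_def by simp
qed (simp add: graph_order_def path_sum_def)

section \<open>Paths and stars grown vertex by vertex\<close>

lemma order_path_graph [simp]: "graph_order (path_graph n) = n"
  and verts_path_graph [simp]: "verts (path_graph n) = {..<n}"
  by (simp_all add: graph_order_def path_graph_def)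

lemma order_star_graph [simp]: "graph_order (star_graph n) = n"
  and verts_star_graph [simp]: "verts (star_graph n) = {..<n}"
  by (simp_all add: graph_order_def star_graph_def)

lemma order_complete_graph [simp]: "graph_order (complete_graph n) = n"
  and verts_complete_graph [simp]: "verts (complete_graph n) = {..<n}"
  by (simp_all add: graph_order_def complete_graph_def)

lemma path_graph_1: "path_graph (Suc 0) = Graph {0} {}"
  by (rule graph_eqI) (auto simp: path_graph_def)

lemma path_graph_Suc: "path_graph (Suc (Suc n)) = pend (path_graph (Suc n)) n (Suc n)"
proof (rule graph_eqI)
  show "edges (path_graph (Suc (Suc n))) = edges (pend (path_graph (Suc n)) n (Suc n))"
    by (auto simp: path_graph_def less_Suc_eq)
qed auto

lemma path_graph_sums:
  "tree (path_graph (Suc n)) \<and> 2 * path_sum (plists_from (path_graph (Suc n)) n) = Suc n * n \<and>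
   3 * path_sum (plists (path_graph (Suc n))) = n * Suc n * Suc (Suc n)"
proof (induction n)
  case 0
  have "plists_from (Graph {0::nat} {}) 0 = {[0]}" unfolding plists_from_def by auto
  then show ?case by (simp add: path_graph_1 tree_single path_sum_def)
next
  case (Suc n)
  interpret pendant "path_graph (Suc n)" n "Suc n"
    using Suc tree_simple by unfold_locales auto
  have q: "card (plists_from (path_graph (Suc n)) n) = Suc n"
    using tree_card_from[of "path_graph (Suc n)" n] Suc by simp
  show ?case using Suc tree_pend unfolding path_graph_Suc
    by (simp add: sum_plists_pend sum_from_pend_new q algebra_simps)
qed

lemma avp_tree_le_path:
  assumes "tree G"
  shows "avp G \<le> avp (path_graph (graph_order G))"
proof -
  obtain n where n: "graph_order G = Suc n" using tree_order_pos[OF assms] by (cases "graph_order G") auto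
  have "path_sum (plists G) \<le> path_sum (plists (path_graph (Suc n)))"
    using tree_sum_le[OF assms] path_graph_sums[of n] n by simp
  then show ?thesis unfolding n using avp_tree[OF assms] path_graph_sums[of n] n
    by (simp add: avp_tree divide_right_mono)
qed

lemma star_graph_1: "star_graph (Suc 0) = Graph {0} {}"
  by (rule graph_eqI) (auto simp: star_graph_def)

lemma star_graph_Suc: "star_graph (Suc (Suc n)) = pend (star_graph (Suc n)) 0 (Suc n)"
proof (rule graph_eqI)
  show "edges (star_graph (Suc (Suc n))) = edges (pend (star_graph (Suc n)) 0 (Suc n))"
    by (auto simp: star_graph_def less_Suc_eq)
qed auto

lemma star_graph_sums:
  "tree (star_graph (Suc n)) \<and> path_sum (plists_from (star_graph (Suc n)) 0) = n \<and>
   path_sum (plists (star_graph (Suc n))) = 2 * n\<^sup>2"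
proof (induction n)
  case 0
  have "plists_from (Graph {0::nat} {}) 0 = {[0]}" unfolding plists_from_def by auto
  then show ?case by (simp add: star_graph_1 tree_single path_sum_def)
next
  case (Suc n)
  interpret pendant "star_graph (Suc n)" 0 "Suc n"
    using Suc tree_simple by unfold_locales auto
  have q: "card (plists_from (star_graph (Suc n)) 0) = Suc n"
    using tree_card_from[of "star_graph (Suc n)" 0] Suc by simp
  have b: "plists_between (star_graph (Suc n)) 0 0 = {[0]}" by (rule plists_between_self) simp
  show ?case using Suc tree_pend unfolding star_graph_Suc
    by (simp add: sum_plists_pend sum_from_pend_old q b path_sum_def[of "{[0]}"] power2_eq_square)
qed

lemma avp_star: "avp (star_graph (Suc n)) = 2 * real n ^ 2 / ((real n + 1) * (real n + 2))"
  using star_graph_sums[of n] by (simp add: avp_tree add.commute)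

subsection \<open>The upper bound for all graphs\<close>

text \<open>Wherever the quotients exist, the hypotheses bound a(i+1)/a(i) by b(i+1)/b(i): relative
  to \<open>a\<close>, the weights \<open>b\<close> lean towards large indices, hence have the
  larger mean. Working with products instead of quotients admits zero weights.\<close>

lemma sum_ratio_mono:
  fixes a b c :: "nat \<Rightarrow> real"
  assumes nonneg: "\<And>i. a i \<ge> 0" "\<And>i. b i \<ge> 0" "\<And>i. c i \<ge> 0"
    and a: "\<And>i. Suc i < n \<Longrightarrow> a (Suc i) \<le> c i * a i" and b: "\<And>i. Suc i < n \<Longrightarrow> b (Suc i) = c i * b i"
  shows "(\<Sum>i<n. i * a i) * (\<Sum>i<n. b i) \<le> (\<Sum>i<n. i * b i) * (\<Sum>i<n. a i)"
proof -
  have le: "a j * b i \<le> a i * b j" if "i \<le> j" "j < n" for i j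
    using that
  proof (induction j rule: dec_induct)
    case (step j)
    have "a (Suc j) * b i \<le> c j * (a j * b i)"
      using mult_right_mono[OF a[OF step(4)] nonneg(2)[of i]] by (simp add: mult.assoc)
    also have "\<dots> \<le> c j * (a i * b j)"
      using step by (intro mult_left_mono nonneg) auto
    also have "\<dots> = a i * b (Suc j)" using b[OF step(4)] by simp
    finally show ?case .
  qed simp
  \<comment> \<open>By \<open>le\<close> both factors of each summand have the same sign; expanding
    the double sum gives twice the difference of the two sides.\<close>
  have "0 \<le> (\<Sum>i<n. \<Sum>j<n. (real i - real j) * (a j * b i - a i * b j))"
  proof (intro sum_nonneg)
    fix i j assume ij: "i \<in> {..<n}" "j \<in> {..<n}"
    show "0 \<le> (real i - real j) * (a j * b i - a i * b j)"
    proof (cases "i \<le> j")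
      case True
      then show ?thesis using le[of i j] ij by (intro mult_nonpos_nonpos) auto
    next
      case False
      then show ?thesis using le[of j i] ij by (intro mult_nonneg_nonneg) (auto simp: mult.commute)
    qed
  qed
  also have "\<dots> = (\<Sum>i<n. \<Sum>j<n. (i * b i) * a j) - (\<Sum>i<n. \<Sum>j<n. (i * a i) * b j)
      - ((\<Sum>i<n. \<Sum>j<n. b i * (j * a j)) - (\<Sum>i<n. \<Sum>j<n. a i * (j * b j)))"
    unfolding sum_subtractf[symmetric] by (intro sum.cong refl) (simp add: algebra_simps)
  also have "\<dots> = 2 * ((\<Sum>i<n. i * b i) * (\<Sum>i<n. a i) - (\<Sum>i<n. i * a i) * (\<Sum>i<n. b i))"
    unfolding sum_product[symmetric] by (simp add: algebra_simps)
  finally show ?thesis by simp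
qed

definition plists_len :: "'a graph \<Rightarrow> nat \<Rightarrow> 'a list set" where
  "plists_len G i = {xs \<in> plists G. length xs = Suc i}"

text \<open>Extensions by one vertex off the list are counted exactly as pairs; adjacency only
  decides which of them are paths, and in a complete graph all of them are.\<close>

lemma plists_len_Suc:
  assumes G: "simple_graph G"
  shows "plists_len G (Suc i) \<subseteq> (\<lambda>(xs, v). xs @ [v]) ` (SIGMA xs:plists_len G i. verts G - set xs)"
    and "(\<And>u v. u \<in> verts G \<Longrightarrow> v \<in> verts G \<Longrightarrow> u \<noteq> v \<Longrightarrow> {u, v} \<in> edges G) \<Longrightarrow>
       (\<lambda>(xs, v). xs @ [v]) ` (SIGMA xs:plists_len G i. verts G - set xs) \<subseteq> plists_len G (Suc i)"
    and "card ((\<lambda>(xs, v). xs @ [v]) ` (SIGMA xs:plists_len G i. verts G - set xs)) =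
       (graph_order G - Suc i) * card (plists_len G i)"
proof -
  show "plists_len G (Suc i) \<subseteq> (\<lambda>(xs, v). xs @ [v]) ` (SIGMA xs:plists_len G i. verts G - set xs)"
  proof
    fix ys assume ys: "ys \<in> plists_len G (Suc i)"
    then have "length ys = Suc (Suc i)" by (simp add: plists_len_def)
    then obtain xs v where eq: "ys = xs @ [v]" "length xs = Suc i" by (cases ys rule: rev_cases) auto
    moreover have "xs \<noteq> []" using eq by auto
    ultimately have "xs \<in> plists_len G i" "v \<in> verts G - set xs"
      using ys by (simp_all add: plists_len_def plists_alt list_edges_append)
    then show "ys \<in> (\<lambda>(xs, v). xs @ [v]) ` (SIGMA xs:plists_len G i. verts G - set xs)"
      using eq by (intro image_eqI[of _ _ "(xs, v)"]) simp_all
  qed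
  show "(\<lambda>(xs, v). xs @ [v]) ` (SIGMA xs:plists_len G i. verts G - set xs) \<subseteq> plists_len G (Suc i)"
    if "\<And>u v. u \<in> verts G \<Longrightarrow> v \<in> verts G \<Longrightarrow> u \<noteq> v \<Longrightarrow> {u, v} \<in> edges G"
  proof (clarify)
    fix xs v assume xs: "xs \<in> plists_len G i" and v: "v \<in> verts G" "v \<notin> set xs"
    then have "xs \<noteq> []" by (simp add: plists_len_def plists_alt)
    then have "last xs \<in> set xs" by simp
    then have "last xs \<in> verts G" "last xs \<noteq> v" using xs v by (auto simp: plists_len_def plists_def)
    then have "{last xs, v} \<in> edges G" using that v by simp
    then show "xs @ [v] \<in> plists_len G (Suc i)"
      using xs v \<open>xs \<noteq> []\<close> by (simp add: plists_len_def plists_alt list_edges_append)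
  qed
  have fin: "finite (plists_len G i)" "finite (verts G)" using G by (simp_all add: plists_len_def simple_graph_def)
  have "card (verts G - set xs) = graph_order G - Suc i" if "xs \<in> plists_len G i" for xs
    using that fin by (simp add: plists_len_def plists_alt card_Diff_subset distinct_card graph_order_def)
  then have "card (SIGMA xs:plists_len G i. verts G - set xs) = card (plists_len G i) * (graph_order G - Suc i)"
    using fin by (subst card_SigmaI) auto
  moreover have "inj_on (\<lambda>(xs, v). xs @ [v]) (SIGMA xs:plists_len G i. verts G - set xs)"
    by (auto simp: inj_on_def)
  ultimately show "card ((\<lambda>(xs, v). xs @ [v]) ` (SIGMA xs:plists_len G i. verts G - set xs)) =
       (graph_order G - Suc i) * card (plists_len G i)"
    by (simp add: card_image mult.commute)
qed

lemma finite_plists_len: "simple_graph G \<Longrightarrow> finite (plists_len G i)"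
  by (simp add: plists_len_def)

lemma card_plists_len_Suc_le:
  assumes G: "simple_graph G"
  shows "card (plists_len G (Suc i)) \<le> (graph_order G - Suc i) * card (plists_len G i)"
proof -
  have "finite ((\<lambda>(xs, v). xs @ [v]) ` (SIGMA xs:plists_len G i. verts G - set xs))"
    using G by (intro finite_imageI finite_SigmaI finite_plists_len) (simp_all add: simple_graph_def)
  then show ?thesis using card_mono plists_len_Suc(1,3)[OF G] by metis
qed

lemma simple_complete_graph: "simple_graph (complete_graph n)"
  by (auto simp: simple_graph_def complete_graph_def)

lemma complete_graph_edge:
  "u \<in> verts (complete_graph n) \<Longrightarrow> v \<in> verts (complete_graph n) \<Longrightarrow> u \<noteq> v \<Longrightarrow> {u, v} \<in> edges (complete_graph n)"
  by (auto simp: complete_graph_def)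

lemma card_plists_len_complete_Suc:
  "card (plists_len (complete_graph n) (Suc i)) = (n - Suc i) * card (plists_len (complete_graph n) i)"
proof -
  have eq: "plists_len (complete_graph n) (Suc i) = (\<lambda>(xs, v). xs @ [v]) `
      (SIGMA xs:plists_len (complete_graph n) i. verts (complete_graph n) - set xs)"
    by (rule equalityI[OF plists_len_Suc(1)[OF simple_complete_graph]
      plists_len_Suc(2)[OF simple_complete_graph complete_graph_edge]])
  show ?thesis
    unfolding eq using plists_len_Suc(3)[OF simple_complete_graph, of n i]
    by (simp only: order_complete_graph)
qed

lemma card_plists_len_0: "card (plists_len G 0) = graph_order G"
  unfolding plists_len_def plists_singleton graph_order_def by (simp add: card_image inj_on_def)

lemma plists_by_length:
  assumes "simple_graph G"
  shows "path_sum (plists G) = (\<Sum>i<graph_order G. i * card (plists_len G i))"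
    and "card (plists G) = (\<Sum>i<graph_order G. card (plists_len G i))"
  using sum_plists_by_length[OF assms, of "\<lambda>i. i" "\<lambda>_. True"]
    sum_plists_by_length[OF assms, of "\<lambda>_. 1" "\<lambda>_. True"]
  by (simp_all add: plists_len_def path_sum_def)

text \<open>The doubled weight at length 0 absorbs the summand \<open>graph_order G\<close> of the
  denominator, so the average becomes an ordinary weighted mean of the lengths.\<close>

lemma avp_by_length:
  fixes G :: "'a graph" and a :: "nat \<Rightarrow> real"
  assumes G: "simple_graph G"
  defines "a \<equiv> \<lambda>i. real ((if i = 0 then 2 else 1) * card (plists_len G i))"
  shows "avp G = (\<Sum>i<graph_order G. i * a i) / (\<Sum>i<graph_order G. a i)"
proof -
  have "(\<Sum>i<graph_order G. i * a i) = path_sum (plists G)"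
    unfolding plists_by_length(1)[OF G] a_def by (simp, intro sum.cong) auto
  moreover have "(\<Sum>i<graph_order G. a i) = graph_order G + card (plists G)"
  proof -
    have "a i = (if i = 0 then real (graph_order G) else 0) + real (card (plists_len G i))" for i
      using card_plists_len_0[of G] by (simp add: a_def)
    then have "(\<Sum>i<graph_order G. a i) =
        (\<Sum>i<graph_order G. if i = 0 then real (graph_order G) else 0) + real (card (plists G))"
      unfolding plists_by_length(2)[OF G] by (simp add: sum.distrib)
    then show ?thesis by (cases "graph_order G = 0") (simp_all add: sum.delta)
  qed
  ultimately show ?thesis using avp_plists[OF G] by simp
qed

lemma avp_le_complete:
  fixes G :: "'a graph"
  assumes "connected_graph G"
  shows "avp G \<le> avp (complete_graph (graph_order G))"
proof -
  define n where "n = graph_order G"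
  define K where "K = complete_graph n"
  have G: "simple_graph G" and K: "simple_graph K" "graph_order K = n"
    using assms simple_complete_graph by (auto simp: connected_graph_def K_def)
  have n: "n \<ge> 1" using connected_order_pos[OF assms] by (simp add: n_def)
  define a :: "'a graph \<Rightarrow> nat \<Rightarrow> real"
    where "a H i = real ((if i = 0 then 2 else 1) * card (plists_len H i))" for H i
  define b :: "nat \<Rightarrow> real" where "b i = real ((if i = 0 then 2 else 1) * card (plists_len K i))" for i
  \<comment> \<open>The factor 1/2 at index 0 compensates for the doubled weight of the trivial
    paths in \<open>a\<close> and \<open>b\<close>.\<close>
  define c :: "nat \<Rightarrow> real" where "c i = real (n - Suc i) * (if i = 0 then 1 / 2 else 1)" for i
  have "(\<Sum>i<n. i * a G i) * (\<Sum>i<n. b i) \<le> (\<Sum>i<n. i * b i) * (\<Sum>i<n. a G i)"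
  proof (rule sum_ratio_mono[of _ _ c])
    show "a G (Suc i) \<le> c i * a G i" for i
    proof -
      have "real (card (plists_len G (Suc i))) \<le> real (n - Suc i) * real (card (plists_len G i))"
        using card_plists_len_Suc_le[OF G, of i] unfolding n_def[symmetric]
        by (metis of_nat_le_iff of_nat_mult)
      then show ?thesis by (cases "i = 0") (simp_all add: a_def c_def)
    qed
    show "b (Suc i) = c i * b i" for i
      using card_plists_len_complete_Suc[of n i] by (simp add: b_def c_def K_def)
  qed (simp_all add: a_def b_def c_def)
  moreover have pos: "(\<Sum>i<n. a G i) > 0" "(\<Sum>i<n. b i) > 0"
  proof -
    have "a G 0 > 0" "b 0 > 0" using n by (simp_all add: a_def b_def card_plists_len_0 n_def[symmetric] K)
    then show "(\<Sum>i<n. a G i) > 0" "(\<Sum>i<n. b i) > 0"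
      using n by (auto intro!: sum_pos2[of _ 0] simp: a_def b_def)
  qed
  ultimately have "(\<Sum>i<n. i * a G i) / (\<Sum>i<n. a G i) \<le> (\<Sum>i<n. i * b i) / (\<Sum>i<n. b i)"
    by (simp add: divide_simps)
  then show ?thesis
    using avp_by_length[OF G] avp_by_length[OF K(1)] K(2)
    unfolding a_def b_def n_def[symmetric] K_def[symmetric] by simp
qed

subsection \<open>The lower bound for all graphs\<close>

lemma delete_edge_sel [simp]:
  "verts (delete_edge G e) = verts G" "edges (delete_edge G e) = edges G - {e}"
  by (simp_all add: delete_edge_def)

lemma simple_delete_edge: "simple_graph G \<Longrightarrow> simple_graph (delete_edge G e)"
  by (simp add: simple_graph_def)

text \<open>The edge that closes a cycle can be bypassed along the rest of the cycle. With at least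
  three vertices it is not an edge of that rest, because the head of a path has only the second
  vertex as neighbour on it.\<close>

lemma ex_removable_edge:
  assumes con: "connected_graph G" and cyc: "\<not> acyclic_graph G"
  shows "\<exists>e\<in>edges G. connected_graph (delete_edge G e)"
proof -
  have G: "simple_graph G" using con by (rule connected_simple)
  obtain xs where xs: "xs \<in> plists G" "length xs \<ge> 3" and e: "{last xs, hd xs} \<in> edges G"
    using cyc acyclic_graph_plists[OF G] by blast
  have d: "distinct xs" "xs \<noteq> []" and le: "list_edges xs \<subseteq> edges G" using xs by (simp_all add: plists_alt)
  define E where "E = edges G - {{last xs, hd xs}}"
  let ?r = "{(x, y). {x, y} \<in> edges G}" and ?r' = "{(x, y). {x, y} \<in> E}"
  have "{hd xs, last xs} \<notin> list_edges xs"
  proof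
    assume h: "{hd xs, last xs} \<in> list_edges xs"
    obtain a b c ys where xs_eq: "xs = a # b # c # ys"
      using xs(2) by (metis Suc_le_length_iff numeral_3_eq_3)
    have "last xs = b" using list_edges_hd_unique[OF d(1) h, of b] xs_eq by simp
    moreover have "last xs \<in> set (c # ys)" unfolding xs_eq by simp
    ultimately show False using d xs_eq by auto
  qed
  then have "list_edges xs \<subseteq> E" using le unfolding E_def by (auto simp: insert_commute)
  then have hl: "(hd xs, last xs) \<in> ?r'\<^sup>*" using d(2) by (intro list_edges_rtrancl)
  have "sym (?r'\<^sup>*)" by (rule sym_rtrancl) (simp add: sym_def insert_commute)
  then have lh: "(last xs, hd xs) \<in> ?r'\<^sup>*" using hl by (rule symD)
  have "?r \<subseteq> ?r'\<^sup>*"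
  proof clarify
    fix x y assume xy: "{x, y} \<in> edges G"
    show "(x, y) \<in> ?r'\<^sup>*"
    proof (cases "{x, y} = {last xs, hd xs}")
      case True
      then show ?thesis using hl lh by (auto simp: doubleton_eq_iff)
    next
      case False
      then have "(x, y) \<in> ?r'" using xy by (simp add: E_def)
      then show ?thesis by (rule r_into_rtrancl)
    qed
  qed
  then have sub: "?r\<^sup>* \<subseteq> ?r'\<^sup>*" using rtrancl_subset_rtrancl by blast
  have "connected_graph (delete_edge G {last xs, hd xs})"
    unfolding connected_graph_def delete_edge_sel E_def[symmetric]
  proof (intro conjI ballI)
    show "simple_graph (delete_edge G {last xs, hd xs})" by (rule simple_delete_edge[OF G])
    show "verts G \<noteq> {}" using con by (simp add: connected_graph_def)
    fix u v assume "u \<in> verts G" "v \<in> verts G"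
    then have "(u, v) \<in> ?r\<^sup>*" using con unfolding connected_graph_def by blast
    then show "(u, v) \<in> ?r'\<^sup>*" using sub by blast
  qed
  then show ?thesis using e by blast
qed

definition long_plists :: "'a graph \<Rightarrow> 'a list set" where
  "long_plists G = {xs \<in> plists G. length xs \<ge> 3}"

lemma edge_subset: "simple_graph G \<Longrightarrow> e \<in> edges G \<Longrightarrow> e \<subseteq> verts G"
  by (simp add: simple_graph_def)

lemma finite_edges: "simple_graph G \<Longrightarrow> finite (edges G)"
  by (rule finite_subset[of _ "Pow (verts G)"]) (auto simp: simple_graph_def)

lemma card_plists_len_1:
  assumes G: "simple_graph G"
  shows "card (plists_len G 1) = 2 * card (edges G)"
proof -
  let ?A = "plists_len G 1"
  have len: "xs \<in> ?A \<longleftrightarrow> (\<exists>a b. xs = [a, b] \<and> a \<noteq> b \<and> {a, b} \<in> edges G)" for xs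
  proof
    assume "xs \<in> ?A"
    then show "\<exists>a b. xs = [a, b] \<and> a \<noteq> b \<and> {a, b} \<in> edges G"
      by (auto simp: plists_len_def plists_alt length_Suc_conv)
  next
    assume "\<exists>a b. xs = [a, b] \<and> a \<noteq> b \<and> {a, b} \<in> edges G"
    then obtain a b where "xs = [a, b]" "a \<noteq> b" "{a, b} \<in> edges G" by blast
    moreover then have "a \<in> verts G" "b \<in> verts G" using edge_subset[OF G, of "{a, b}"] by simp_all
    ultimately show "xs \<in> ?A" by (simp add: plists_len_def plists_alt)
  qed
  have "list_graph ` ?A = (\<lambda>e. Graph e {e}) ` edges G"
  proof (intro set_eqI iffI)
    fix H assume "H \<in> list_graph ` ?A"
    then show "H \<in> (\<lambda>e. Graph e {e}) ` edges G" using len by (auto simp: list_graph_def)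
  next
    fix H assume "H \<in> (\<lambda>e. Graph e {e}) ` edges G"
    then obtain e where e: "e \<in> edges G" "H = Graph e {e}" by blast
    then have "card e = 2" using G by (simp add: simple_graph_def)
    then obtain a b where ab: "e = {a, b}" "a \<noteq> b" by (auto simp: card_2_iff)
    then have "[a, b] \<in> ?A" using len e by blast
    moreover have "H = list_graph [a, b]" using e ab by (simp add: list_graph_def)
    ultimately show "H \<in> list_graph ` ?A" by blast
  qed
  moreover have "inj_on (\<lambda>e. Graph e {e}) (edges G)" by (auto simp: inj_on_def)
  ultimately have "card (list_graph ` ?A) = card (edges G)" by (simp add: card_image)
  moreover have "2 * card (list_graph ` ?A) = card ?A"
  proof (rule card_list_graph_image)
    show "finite ?A" by (rule finite_plists_len[OF G])
    show "distinct xs \<and> 2 \<le> length xs \<and> rev xs \<in> ?A" if "xs \<in> ?A" for xs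
      using that by (simp add: plists_len_def plists_alt)
  qed
  ultimately show ?thesis by simp
qed

text \<open>Charging every long list just 2 loses nothing for a star, where all long lists have
  exactly two edges; so the bound is sharp where the final comparison must be.\<close>

lemma plists_split_long:
  assumes G: "simple_graph G"
  shows "card (plists G) = graph_order G + 2 * card (edges G) + card (long_plists G)"
    and "path_sum (plists G) \<ge> 2 * card (edges G) + 2 * card (long_plists G)"
proof -
  have eq: "plists G = plists_len G 0 \<union> (plists_len G 1 \<union> long_plists G)"
  proof (intro set_eqI iffI)
    fix xs assume xs: "xs \<in> plists G"
    then have "length xs \<noteq> 0" by (simp add: plists_alt)
    then have "length xs = 1 \<or> length xs = 2 \<or> length xs \<ge> 3" by linarith
    then show "xs \<in> plists_len G 0 \<union> (plists_len G 1 \<union> long_plists G)"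
      using xs by (auto simp: plists_len_def long_plists_def)
  qed (auto simp: plists_len_def long_plists_def)
  have fin: "finite (plists_len G 0)" "finite (plists_len G 1)" "finite (long_plists G)"
    using G by (simp_all add: finite_plists_len long_plists_def)
  have disj: "plists_len G 0 \<inter> (plists_len G 1 \<union> long_plists G) = {}" "plists_len G 1 \<inter> long_plists G = {}"
    by (auto simp: plists_len_def long_plists_def)
  show "card (plists G) = graph_order G + 2 * card (edges G) + card (long_plists G)"
    unfolding eq using fin disj
    by (subst card_Un_disjoint, simp_all add: card_Un_disjoint card_plists_len_0)
      (simp add: card_plists_len_1[OF G, simplified])
  have "path_sum (plists G) = path_sum (plists_len G 0) + (path_sum (plists_len G 1) + path_sum (long_plists G))"
    unfolding eq using fin disj by (simp add: path_sum_Un)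
  moreover have "path_sum (plists_len G 1) = 2 * card (edges G)"
    using card_plists_len_1[OF G] by (simp add: path_sum_def plists_len_def)
  moreover have "path_sum (long_plists G) \<ge> (\<Sum>xs\<in>long_plists G. 2)"
    unfolding path_sum_def long_plists_def by (rule sum_mono, clarify, linarith)
  ultimately show "path_sum (plists G) \<ge> 2 * card (edges G) + 2 * card (long_plists G)" by simp
qed

text \<open>Every vertex off a non-bridge \<open>xy\<close> starts a path that ends by traversing \<open>xy\<close>.\<close>

lemma card_long_delete_edge:
  assumes G: "simple_graph G" and e: "e \<in> edges G" and con: "connected_graph (delete_edge G e)"
  shows "card (long_plists (delete_edge G e)) + 2 * (graph_order G - 2) \<le> card (long_plists G)"
proof -
  obtain x y where xy: "e = {x, y}" "x \<noteq> y"
    using G e by (metis card_2_iff simple_graph_def)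
  have V: "x \<in> verts G" "y \<in> verts G" using edge_subset[OF G e] xy by simp_all
  let ?H = "delete_edge G e"
  have ex: "\<exists>qs \<in> plists G. hd qs = w \<and> last qs \<in> {x, y} \<and> length qs \<ge> 3 \<and> e \<in> list_edges qs"
    if w: "w \<in> verts G - {x, y}" for w
  proof -
    have "plists_between ?H w x \<noteq> {}" using con w V unfolding connected_graph_plists by simp
    then obtain ps where "ps \<in> plists_between ?H w x" by blast
    then have ps: "ps \<noteq> []" "distinct ps" "set ps \<subseteq> verts G" "list_edges ps \<subseteq> edges G" "hd ps = w" "last ps = x"
      by (auto simp: plists_between_def plists_alt)
    \<comment> \<open>A path from \<open>w\<close> to \<open>x\<close> that avoids \<open>y\<close>
      is prolonged to \<open>y\<close>. One that meets \<open>y\<close> is cut there and sent across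
      the edge to \<open>x\<close>, a vertex that its initial part has not yet visited.\<close>
    show ?thesis
    proof (cases "y \<in> set ps")
      case False
      have "length ps \<ge> 2" using ps w by (cases ps rule: list_edges.cases) auto
      then show ?thesis using ps False V xy e
        by (intro bexI[of _ "ps @ [y]"]) (simp_all add: plists_alt list_edges_append hd_append)
    next
      case True
      then obtain as bs where sp: "ps = as @ y # bs" by (meson split_list)
      have as: "as \<noteq> []" using sp ps w by (cases as) auto
      have bs: "bs \<noteq> []" using sp ps xy by (cases bs) auto
      have last: "x \<in> set bs" using sp ps bs by (metis last.simps last_appendR last_in_set list.discI)
      have le: "list_edges as \<subseteq> edges G" "{last as, y} \<in> edges G"
        using ps(4) as unfolding sp list_edges_append by auto
      have "list_edges (as @ [y, x]) = list_edges as \<union> {{y, x}, {last as, y}}"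
        using as by (auto simp: list_edges_append)
      moreover have "{y, x} = e" using xy by blast
      ultimately have "as @ [y, x] \<in> plists G" "e \<in> list_edges (as @ [y, x])"
        using ps last V e le as xy by (auto simp: plists_alt sp)
      moreover have "hd (as @ [y, x]) = w" "length (as @ [y, x]) \<ge> 3" using as ps sp by (cases as; simp)+
      ultimately show ?thesis by (intro bexI[of _ "as @ [y, x]"]) simp_all
    qed
  qed
  define P where "P = (\<lambda>w qs. qs \<in> plists G \<and> hd qs = w \<and> last qs \<in> {x, y} \<and> length qs \<ge> 3 \<and> e \<in> list_edges qs)"
  define f where "f = (\<lambda>w. SOME qs. P w qs)"
  have f: "P w (f w)" if "w \<in> verts G - {x, y}" for w
  proof -
    have "\<exists>qs. P w qs" using ex[OF that] unfolding P_def by blast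
    then show ?thesis unfolding f_def by (rule someI_ex)
  qed
  define A where "A = f ` (verts G - {x, y})"
  have A: "qs \<in> plists G \<and> hd qs \<in> verts G - {x, y} \<and> last qs \<in> {x, y} \<and> length qs \<ge> 3 \<and> e \<in> list_edges qs"
    if qs: "qs \<in> A" for qs
  proof -
    obtain w where w: "w \<in> verts G - {x, y}" "qs = f w" using qs unfolding A_def by blast
    then have "P w qs" using f by blast
    then show ?thesis using w(1) unfolding P_def by blast
  qed
  have "inj_on f (verts G - {x, y})"
  proof (rule inj_onI)
    fix v w assume vw: "v \<in> verts G - {x, y}" "w \<in> verts G - {x, y}" "f v = f w"
    then have "hd (f v) = v" "hd (f w) = w" using f unfolding P_def by blast+
    then show "v = w" using vw(3) by metis
  qed
  then have "card A = card (verts G - {x, y})" unfolding A_def by (rule card_image)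
  then have cA: "card A = graph_order G - 2"
    using V xy G by (simp add: graph_order_def card_Diff_subset simple_graph_def)
  have finA: "finite A" unfolding A_def using G by (simp add: simple_graph_def)
  \<comment> \<open>Members of \<open>A\<close> start off \<open>{x, y}\<close> and end in it, so
    reversal gives entirely different lists and doubles the count.\<close>
  have disjA: "A \<inter> rev ` A = {}"
  proof (rule equals0I)
    fix qs assume "qs \<in> A \<inter> rev ` A"
    then obtain rs where rs: "qs \<in> A" "rs \<in> A" "qs = rev rs" by blast
    have "rs \<noteq> []" using A[OF rs(2)] by auto
    then have "hd qs = last rs" using rs(3) by (simp add: hd_rev)
    then show False using A[OF rs(1)] A[OF rs(2)] by auto
  qed
  have new: "qs \<in> long_plists G" "qs \<notin> long_plists ?H" if qs: "qs \<in> A \<union> rev ` A" for qs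
  proof -
    have "qs \<in> plists G \<and> length qs \<ge> 3 \<and> e \<in> list_edges qs"
    proof (cases "qs \<in> A")
      case True
      then show ?thesis using A by blast
    next
      case False
      then obtain rs where rs: "rs \<in> A" "qs = rev rs" using qs by blast
      then have "rs \<in> plists G" "length rs \<ge> 3" "e \<in> list_edges rs" using A[of rs] by blast+
      then show ?thesis unfolding rs(2) by simp
    qed
    then show "qs \<in> long_plists G" "qs \<notin> long_plists ?H"
      unfolding long_plists_def plists_alt by auto
  qed
  have finL: "finite (long_plists G)" "finite (long_plists ?H)"
    using G simple_delete_edge[OF G] by (simp_all add: long_plists_def)
  have "plists ?H \<subseteq> plists G" by (rule plists_mono) auto
  then have sub: "long_plists ?H \<union> (A \<union> rev ` A) \<subseteq> long_plists G"
    using new(1) unfolding long_plists_def by blast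
  have "long_plists ?H \<inter> (A \<union> rev ` A) = {}" using new(2) by blast
  then have "card (long_plists ?H \<union> (A \<union> rev ` A)) = card (long_plists ?H) + card (A \<union> rev ` A)"
    using finA finL by (intro card_Un_disjoint) simp_all
  also have "card (A \<union> rev ` A) = 2 * (graph_order G - 2)"
    using finA disjA cA by (simp add: card_Un_disjoint card_rev_image)
  finally show ?thesis using card_mono[OF finL(1) sub] by simp
qed

text \<open>A tree has n^2 lists, of which n + 2 * (n - 1) have at most two vertices, leaving (n -
  1) * (n - 2). Every edge beyond those of a tree contributes a further 2 * (n - 2).\<close>

lemma card_long_ge:
  assumes "connected_graph G"
  defines "n \<equiv> real (graph_order G)" and "m \<equiv> real (card (edges G))"
  shows "n - 1 \<le> m \<and> real (card (long_plists G)) \<ge> (n - 1) * (n - 2) + 2 * (m - (n - 1)) * (n - 2)"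
  using assms(1) unfolding n_def m_def
proof (induction "card (edges G)" arbitrary: G)
  case (0 G)
  have "acyclic_graph G"
    using ex_removable_edge[OF 0(2)] finite_edges[OF connected_simple[OF 0(2)]] 0(1) by auto
  then have T: "tree G" using 0 by (simp add: tree_def)
  have n: "graph_order G = 1" using tree_edges_card[OF T] 0 by simp
  then show ?case using 0(1)[symmetric] by simp
next
  case (Suc m G)
  have G: "simple_graph G" using Suc.prems by (rule connected_simple)
  show ?case
  proof (cases "acyclic_graph G")
    case True
    then have T: "tree G" using Suc.prems by (simp add: tree_def)
    have m: "real (card (edges G)) = real (graph_order G) - 1" using tree_edges_card[OF T] by linarith
    have "real ((graph_order G)\<^sup>2) = real (graph_order G + 2 * card (edges G) + card (long_plists G))"
      using plists_split_long(1)[OF G] tree_card_plists[OF T] by simp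
    then have "(real (graph_order G))\<^sup>2 = graph_order G + 2 * (real (graph_order G) - 1) + card (long_plists G)"
      using m by simp
    then show ?thesis using m by (simp add: algebra_simps power2_eq_square)
  next
    case False
    then obtain e where e: "e \<in> edges G" "connected_graph (delete_edge G e)"
      using ex_removable_edge[OF Suc.prems] by blast
    define H where "H = delete_edge G e"
    have m: "card (edges G) = Suc (card (edges H))"
      unfolding H_def delete_edge_sel by (rule card.remove[OF finite_edges[OF G] e(1)])
    have n: "graph_order H = graph_order G" by (simp add: H_def graph_order_def)
    have IH: "real (graph_order H) - 1 \<le> real (card (edges H)) \<and>
        real (card (long_plists H)) \<ge> (real (graph_order H) - 1) * (real (graph_order H) - 2) +
        2 * (real (card (edges H)) - (real (graph_order H) - 1)) * (real (graph_order H) - 2)"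
      using Suc.hyps m e(2) H_def by (intro Suc.hyps(1)) simp_all
    have "card e = 2" "e \<subseteq> verts G" "finite (verts G)" using G e(1) by (simp_all add: simple_graph_def)
    then have n2: "graph_order G \<ge> 2" using card_mono[of "verts G" e] by (simp add: graph_order_def)
    have "real (card (long_plists H) + 2 * (graph_order G - 2)) \<le> real (card (long_plists G))"
      using card_long_delete_edge[OF G e] by (simp only: H_def of_nat_le_iff)
    then have "real (card (long_plists H)) + 2 * (real (graph_order G) - 2) \<le> real (card (long_plists G))"
      using n2 by (simp add: of_nat_diff)
    then show ?thesis using IH unfolding n m by (simp add: algebra_simps)
  qed
qed

lemma avp_nonneg: "simple_graph G \<Longrightarrow> avp G \<ge> 0"
  by (simp add: avp_plists)

lemma avp_star_le:
  assumes con: "connected_graph G"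
  shows "avp (star_graph (graph_order G)) \<le> avp G"
proof -
  have G: "simple_graph G" using con by (rule connected_simple)
  obtain j where j: "graph_order G = Suc j"
    using connected_order_pos[OF con] by (cases "graph_order G") auto
  show ?thesis
  proof (cases "j = 0")
    case True
    then show ?thesis using avp_nonneg[OF G] avp_star[of 0] j by simp
  next
    case False
    define n where "n = real (graph_order G)"
    define m where "m = real (card (edges G))"
    define r where "r = real (card (long_plists G))"
    have n: "n = real j + 1" "n \<ge> 2" using j False by (simp_all add: n_def)
    \<comment> \<open>\<open>k\<close> is the excess of edges over a tree and \<open>d\<close> the
      surplus of long lists over their lower bound. In these variables the difference of the
      cross-multiplied sides is linear with nonnegative coefficients and vanishes at
      \<open>k = d = 0\<close>, the values for the star.\<close>
    define k d where "k = m - (n - 1)" and "d = r - ((n - 1) * (n - 2) + 2 * k * (n - 2))"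
    have kd: "k \<ge> 0" "d \<ge> 0" "m \<ge> 0" "r \<ge> 0"
      using card_long_ge[OF con] unfolding n_def m_def r_def k_def d_def by simp_all
    have m: "m = k + (n - 1)" and r: "r = d + (n - 1) * (n - 2) + 2 * k * (n - 2)" by (simp_all add: k_def d_def)
    have c: "5 * n\<^sup>2 - 9 * n + 2 \<ge> 0"
      using mult_mono[of 2 n 2 n] n(2) mult_right_mono[of 2 n n] by (simp add: power2_eq_square)
    have "(n + n\<^sup>2) * (m + r) - (n - 1)\<^sup>2 * (2 * n + 2 * m + r) = (3 * n - 1) * d + k * (5 * n\<^sup>2 - 9 * n + 2)"
      unfolding m r by (simp add: algebra_simps power2_eq_square power3_eq_cube)
    moreover have "3 * n - 1 \<ge> 0" using n by simp
    then have "(3 * n - 1) * d + k * (5 * n\<^sup>2 - 9 * n + 2) \<ge> 0"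
      by (intro add_nonneg_nonneg mult_nonneg_nonneg kd c)
    ultimately have main: "(n - 1)\<^sup>2 * (2 * n + 2 * m + r) \<le> (n + n\<^sup>2) * (m + r)" by simp
    have pos: "2 * n + 2 * m + r > 0" "n + n\<^sup>2 > 0" using kd n by (simp_all add: add_pos_nonneg)
    have "avp (star_graph (graph_order G)) = 2 * (n - 1)\<^sup>2 / (n + n\<^sup>2)"
      unfolding j avp_star n(1) by (simp add: power2_eq_square algebra_simps)
    also have "\<dots> \<le> (2 * m + 2 * r) / (2 * n + 2 * m + r)"
      using main pos by (simp add: divide_simps) (simp add: algebra_simps)
    also have "\<dots> \<le> path_sum (plists G) / (2 * n + 2 * m + r)"
    proof (rule divide_right_mono)
      have "real (2 * card (edges G) + 2 * card (long_plists G)) \<le> real (path_sum (plists G))"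
        using plists_split_long(2)[OF G] by (simp only: of_nat_le_iff)
      then show "2 * m + 2 * r \<le> real (path_sum (plists G))" by (simp add: m_def r_def)
    qed (use pos in simp)
    also have "\<dots> = avp G"
      unfolding avp_plists[OF G] plists_split_long(1)[OF G] by (simp add: n_def m_def r_def)
    finally show ?thesis .
  qed
qed

subsection \<open>Moving a leaf\<close>

text \<open>If no path from \<open>c\<close> goes beyond its neighbours, then \<open>c\<close> is
  adjacent to all other vertices, and these n - 1 edges are already all the edges of the
  tree.\<close>

lemma dominated_tree_iso_star:
  assumes T: "tree T" and c: "c \<in> verts T" and dom: "\<And>xs. xs \<in> plists_from T c \<Longrightarrow> length xs \<le> 2"
  shows "graph_iso T (star_graph (graph_order T))"
proof -
  define n where "n = graph_order T"
  have fin: "finite (verts T)" by (rule tree_finite[OF T])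
  have n: "n \<ge> 1" using tree_order_pos[OF T] n_def by simp
  define D where "D = (\<lambda>v. {c, v}) ` (verts T - {c})"
  have "D \<subseteq> edges T"
    unfolding D_def
  proof (rule image_subsetI)
    fix v assume "v \<in> verts T - {c}"
    then have v: "v \<in> verts T" "v \<noteq> c" by simp_all
    then have "plists_between T c v \<noteq> {}"
      using T c unfolding tree_def connected_graph_plists by blast
    then obtain xs where xs: "xs \<in> plists T" "hd xs = c" "last xs = v" by (auto simp: plists_between_def)
    then have "length xs \<le> 2" using dom by (simp add: plists_from_def)
    moreover have "xs \<noteq> []" using xs by (simp add: plists_alt)
    ultimately obtain b where "xs = [c, b]" using xs v
      by (cases xs rule: list_edges.cases) auto
    then show "{c, v} \<in> edges T" using xs by (simp add: plists_alt)
  qed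
  moreover have "inj_on (\<lambda>v. {c, v}) (verts T - {c})" by (auto simp: inj_on_def doubleton_eq_iff)
  then have "card D = n - 1" unfolding D_def n_def graph_order_def using c fin by (simp add: card_image)
  moreover have "n = Suc (card (edges T))" "finite (edges T)" using tree_edges_card[OF T] n_def by simp_all
  ultimately have D: "edges T = D"
    using card_subset_eq[of "edges T" D] by simp
  have "card (verts T - {c}) = card {1..<n}" using c fin by (simp add: n_def graph_order_def)
  then obtain h where h: "bij_betw h (verts T - {c}) {1..<n}"
    using finite_same_card_bij[of "verts T - {c}" "{1..<n}"] fin by auto
  define f where "f = (\<lambda>v. if v = c then 0 else h v)"
  have "bij_betw f (verts T - {c}) {1..<n}"
    using h by (subst bij_betw_cong[of _ f h]) (auto simp: f_def)
  moreover have "bij_betw f {c} {0}" by (simp add: f_def bij_betw_def)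
  ultimately have "bij_betw f ((verts T - {c}) \<union> {c}) ({1..<n} \<union> {0})" by (rule bij_betw_combine) simp
  moreover have "(verts T - {c}) \<union> {c} = verts T" "{1..<n} \<union> {0} = {..<n}" using c n by auto
  ultimately have bij: "bij_betw f (verts T) (verts (star_graph n))" by simp
  have "edges (star_graph n) = (\<lambda>i. {0, i}) ` {1..<n}" by (auto simp: star_graph_def)
  also have "\<dots> = (\<lambda>v. {0, h v}) ` (verts T - {c})"
  proof -
    have eq: "{1..<n} = h ` (verts T - {c})" using h by (simp add: bij_betw_def)
    show ?thesis unfolding eq image_image ..
  qed
  also have "\<dots> = (\<lambda>e. f ` e) ` edges T"
    unfolding D D_def image_image by (rule image_cong) (auto simp: f_def)
  finally show ?thesis unfolding graph_iso_def n_def[symmetric] using bij by blast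
qed

text \<open>Let \<open>G\<close> be \<open>T\<close> without the leaf \<open>w\<close> at
  \<open>u\<close>. In \<open>T\<close> the distance sum of \<open>u\<close> exceeds that in
  \<open>G\<close> by 1, while that of \<open>c\<close> exceeds it by at least 2, since
  \<open>T\<close> is no star and so \<open>u\<close> differs from \<open>c\<close>. Minimality of
  \<open>c\<close> in \<open>T\<close> thus makes its sum in \<open>G\<close> strictly smaller than
  that of \<open>u\<close>, and moving \<open>w\<close> changes the total by twice this
  difference.\<close>

lemma non_star_improve:
  assumes T: "tree T" and ns: "\<not> graph_iso T (star_graph (graph_order T))"
  shows "\<exists>T'. one_associate T' T \<and> avp T' < avp T"
proof -
  have ne: "verts T \<noteq> {}" "finite (verts T)" and con: "connected_graph T"
    using T by (auto simp: tree_def connected_graph_def tree_finite simple_graph_def)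
  define t where "t = (\<lambda>v. path_sum (plists_from T v))"
  obtain c where c: "c \<in> verts T" and min: "\<And>v. v \<in> verts T \<Longrightarrow> t c \<le> t v"
    using arg_min_if_finite[OF ne(2,1), of t] by (meson not_le)
  obtain xs where xs: "xs \<in> plists_from T c" and max: "\<And>ys. ys \<in> plists_from T c \<Longrightarrow> length ys \<le> length xs"
    using ex_longest_from[OF con c] by blast
  have len: "length xs \<ge> 3"
  proof (rule ccontr)
    assume "\<not> length xs \<ge> 3"
    then have "length ys \<le> 2" if "ys \<in> plists_from T c" for ys using max[OF that] by simp
    then show False using dominated_tree_iso_star[OF T c] ns by blast
  qed
  define w u where "w = last xs" and "u = last (butlast xs)"
  define G where "G = Graph (verts T - {w}) (edges T - {{u, w}})"
  have "length xs \<ge> 2" using len by simp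
  note leaf = longest_from_leaf[OF T xs this max, folded w_def u_def, folded G_def]
  have G: "tree G" "u \<in> verts G" "w \<notin> verts G" "w \<noteq> c" "T = pend G u w" using leaf by blast+
  interpret pu: pendant G u w using G tree_simple by unfold_locales auto
  have cG: "c \<in> verts G" using c G by auto
  interpret pc: pendant G c w using G tree_simple cG by unfold_locales auto
  have "u \<noteq> c"
  proof -
    obtain a b d zs where x: "xs = a # b # d # zs" using len by (metis Suc_le_length_iff numeral_3_eq_3)
    have "u \<in> set (b # butlast (d # zs))" unfolding u_def x by simp
    moreover have "set (butlast (d # zs)) \<subseteq> set (d # zs)" by (meson in_set_butlastD subsetI)
    moreover have "c = a" "a \<notin> set (b # d # zs)" using xs x by (auto simp: plists_from_def plists_alt)
    ultimately show ?thesis by auto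
  qed
  define T' where "T' = pend G c w"
  have T': "tree T'" unfolding T'_def by (rule pc.tree_pend[OF G(1)])
  have "one_associate T' T"
    unfolding one_associate_def
  proof (intro conjI bexI exI)
    show "tree T'" by (rule T')
    show "verts T' = verts T" unfolding T'_def G(5) by simp
    have uw: "{u, w} \<notin> edges G" "{c, w} \<notin> edges G" using pu.w_notin_edge by blast+
    show "{u, w} \<in> edges T" unfolding G(5) by simp
    show "{c, w} \<notin> edges T" unfolding G(5) using uw \<open>u \<noteq> c\<close> by (auto simp: doubleton_eq_iff)
    show "edges T' = insert {c, w} (edges T - {{u, w}})" unfolding T'_def G(5) using uw by simp
  qed
  moreover have "avp T' < avp T"
  proof -
    have tu: "t u = path_sum (plists_from G u) + 1"
      unfolding t_def G(5) pu.sum_from_pend_old[OF G(2)] plists_between_self[OF G(2)]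
      by (simp add: path_sum_def)
    have card1: "card (plists_between G c u) = 1" by (rule tree_card_between[OF G(1) cG G(2)])
    then obtain ps where ps: "plists_between G c u = {ps}" by (auto simp: card_1_singleton_iff)
    then have "ps \<noteq> []" "hd ps = c" "last ps = u" by (auto simp: plists_between_def plists_alt)
    then have "length ps \<ge> 2" using \<open>u \<noteq> c\<close> by (cases ps rule: list_edges.cases) auto
    then have "path_sum (plists_between G c u) \<ge> 1" unfolding ps by (simp add: path_sum_def)
    then have tc: "t c \<ge> path_sum (plists_from G c) + 2"
      unfolding t_def G(5) pu.sum_from_pend_old[OF cG] card1 by simp
    have "u \<in> verts T" using G by auto
    then have lt: "path_sum (plists_from G c) < path_sum (plists_from G u)"
      using min[of u] tu tc by simp
    have q: "card (plists_from G c) = card (plists_from G u)"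
      using tree_card_from[OF G(1)] cG G(2) by simp
    have "path_sum (plists T') < path_sum (plists T)"
      unfolding T'_def G(5) pu.sum_plists_pend pc.sum_plists_pend using lt q by simp
    moreover have "graph_order T' = graph_order T" unfolding T'_def G(5) pu.order_pend pc.order_pend ..
    ultimately show ?thesis
      using avp_tree[OF T] avp_tree[OF T'] tree_order_pos[OF T]
      by (simp add: divide_strict_right_mono)
  qed
  ultimately show ?thesis by blast
qed

subsection \<open>Short paths in graphs of large minimum degree\<close>

text \<open>Vertices outside the cover \<open>S\<close> are never consecutive on the path, so there
  is at most one more of them than of vertices in \<open>S\<close>.\<close>

lemma length_le_cover:
  assumes "finite S" "distinct xs" "successively (\<lambda>a b. a \<in> S \<or> b \<in> S) xs"
  shows "length xs \<le> 2 * card S + 1"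
proof -
  \<comment> \<open>The extra 1 is tied to a head outside \<open>S\<close>; this refinement is what
    makes the induction go through.\<close>
  have "length (filter (\<lambda>x. x \<notin> S) xs) \<le> length (filter (\<lambda>x. x \<in> S) xs) + (if xs \<noteq> [] \<and> hd xs \<notin> S then 1 else 0)"
    using assms(3) by (induction xs rule: list_edges.induct) auto
  moreover have "length (filter (\<lambda>x. x \<in> S) xs) + length (filter (\<lambda>x. x \<notin> S) xs) = length xs"
    by (rule sum_length_filter_compl)
  moreover have "length (filter (\<lambda>x. x \<in> S) xs) \<le> card S"
  proof -
    have "length (filter (\<lambda>x. x \<in> S) xs) = card (set (filter (\<lambda>x. x \<in> S) xs))"
      using assms(2) by (simp only: distinct_card distinct_filter)
    also have "\<dots> \<le> card S" by (rule card_mono[OF assms(1)]) auto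
    finally show ?thesis .
  qed
  ultimately show ?thesis by (simp split: if_splits)
qed

lemma avp_le_max:
  assumes G: "simple_graph G" and len: "\<And>xs. xs \<in> plists G \<Longrightarrow> length xs \<le> Suc k"
  shows "avp G \<le> k"
proof -
  have "path_sum (plists G) \<le> (\<Sum>xs\<in>plists G. k)"
    unfolding path_sum_def by (rule sum_mono) (use len in fastforce)
  also have "\<dots> \<le> k * (graph_order G + card (plists G))" by (simp add: algebra_simps)
  finally have "real (path_sum (plists G)) \<le> real k * real (graph_order G + card (plists G))"
    by (metis of_nat_le_iff of_nat_mult)
  then show ?thesis unfolding avp_plists[OF G]
    by (cases "graph_order G + card (plists G) = 0") (simp_all add: divide_simps)
qed

text \<open>The clique meets every edge, so each path has at most 2 * r edges and the average stays
  bounded; dividing by \<open>ln 2\<close> turns this bound into a logarithmic one.\<close>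

lemma ex_log_avp:
  assumes r: "r \<ge> 3"
  shows "\<exists>C :: real. \<forall>N. \<exists>G :: nat graph. connected_graph G \<and> graph_order G \<ge> N \<and>
       min_degree G \<ge> r \<and> avp G \<le> C * ln (real (graph_order G))"
proof (intro exI allI conjI)
  fix N
  \<comment> \<open>At least \<open>r\<close> vertices lie outside the clique, so that every clique
    vertex has the neighbours \<open>{r..<2 * r}\<close>.\<close>
  define M where "M = N + 2 * r"
  define G where "G = Graph {..<M} {{i, j} | i j. i < r \<and> i < j \<and> j < M}"
  have G: "verts G = {..<M}" "edges G = {{i, j} | i j. i < r \<and> i < j \<and> j < M}" "graph_order G = M"
    by (simp_all add: G_def graph_order_def)
  have M: "M \<ge> 2 * r" "r < M" using r by (simp_all add: M_def)
  have edge: "{a, b} \<in> edges G \<longleftrightarrow> a \<noteq> b \<and> a < M \<and> b < M \<and> (a < r \<or> b < r)" for a b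
  proof
    assume "{a, b} \<in> edges G"
    then show "a \<noteq> b \<and> a < M \<and> b < M \<and> (a < r \<or> b < r)" unfolding G by (auto simp: doubleton_eq_iff)
  next
    assume ab: "a \<noteq> b \<and> a < M \<and> b < M \<and> (a < r \<or> b < r)"
    show "{a, b} \<in> edges G"
    proof (cases "a < b")
      case True
      then have "a < r" using ab by auto
      then show ?thesis unfolding G(2) using ab True by blast
    next
      case False
      then have "b < a" "b < r" using ab by auto
      then show ?thesis unfolding G(2) using ab by (subst insert_commute) blast
    qed
  qed
  have s: "simple_graph G" unfolding simple_graph_def G by auto
  show "connected_graph G"
    unfolding connected_graph_def
  proof (intro conjI ballI)
    show "verts G \<noteq> {}" using M G by auto
    have to0: "(u, 0) \<in> {(x, y). {x, y} \<in> edges G}\<^sup>*" "(0, u) \<in> {(x, y). {x, y} \<in> edges G}\<^sup>*"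
      if "u \<in> verts G" for u
    proof -
      have "u = 0 \<or> {u, 0} \<in> edges G \<and> {0, u} \<in> edges G"
        unfolding edge using that r M unfolding G by auto
      then show "(u, 0) \<in> {(x, y). {x, y} \<in> edges G}\<^sup>*" "(0, u) \<in> {(x, y). {x, y} \<in> edges G}\<^sup>*"
        by (elim disjE; simp add: r_into_rtrancl)+
    qed
    show "(u, v) \<in> {(x, y). {x, y} \<in> edges G}\<^sup>*" if "u \<in> verts G" "v \<in> verts G" for u v
      using to0(1)[OF that(1)] to0(2)[OF that(2)] by (rule rtrancl_trans)
  qed (rule s)
  show "graph_order G \<ge> N" using G M_def by simp
  show "min_degree G \<ge> r"
    unfolding min_degree_def
  proof (rule Min.boundedI)
    show "finite (vertex_degree G ` verts G)" "vertex_degree G ` verts G \<noteq> {}" using M G by auto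
    fix d assume "d \<in> vertex_degree G ` verts G"
    then obtain v where v: "v < M" "d = vertex_degree G v" using G by auto
    \<comment> \<open>A set of \<open>r\<close> neighbours of \<open>v\<close> suffices: independent
      vertices for \<open>v\<close> in the clique, the whole clique otherwise.\<close>
    define S where "S = (if v < r then {r..<2 * r} else {..<r})"
    have "(\<lambda>i. {v, i}) ` S \<subseteq> {e \<in> edges G. v \<in> e}"
      using v M edge by (auto simp: S_def)
    then have "card ((\<lambda>i. {v, i}) ` S) \<le> d"
      unfolding v(2) vertex_degree_def using finite_edges[OF s] by (intro card_mono) simp_all
    moreover have "inj_on (\<lambda>i. {v, i}) S" by (auto simp: inj_on_def doubleton_eq_iff)
    then have "card ((\<lambda>i. {v, i}) ` S) = card S" by (rule card_image)
    moreover have "card S = r" by (simp add: S_def)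
    ultimately show "r \<le> d" by simp
  qed
  have "length xs \<le> Suc (2 * r)" if "xs \<in> plists G" for xs
  proof -
    have "distinct xs" "successively (\<lambda>a b. {a, b} \<in> edges G) xs" using that by (simp_all add: plists_def)
    moreover from this(2) have "successively (\<lambda>a b. a \<in> {..<r} \<or> b \<in> {..<r}) xs"
      by (rule successively_mono) (simp add: edge)
    ultimately show ?thesis using length_le_cover[of "{..<r}" xs] by simp
  qed
  then have "avp G \<le> real (2 * r)" by (rule avp_le_max[OF s])
  also have "\<dots> \<le> 2 * real r / ln 2 * ln (real M)"
  proof -
    have "ln 2 \<le> ln (real M)" using M r by (subst ln_le_cancel_iff) auto
    then show ?thesis by (simp add: divide_simps mult_left_mono)
  qed
  finally show "avp G \<le> 2 * real r / ln 2 * ln (real (graph_order G))" using G by simp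
qed

subsection \<open>Complete graphs\<close>

lemma connected_complete_graph: "n \<ge> 1 \<Longrightarrow> connected_graph (complete_graph n)"
  unfolding connected_graph_def
proof (intro conjI ballI)
  fix u v assume "u \<in> verts (complete_graph n)" "v \<in> verts (complete_graph n)"
  then show "(u, v) \<in> {(x, y). {x, y} \<in> edges (complete_graph n)}\<^sup>*"
    using complete_graph_edge[of u n v] by (cases "u = v") auto
qed (auto simp: simple_complete_graph lessThan_empty_iff)

text \<open>Transpositions are automorphisms, which makes all vertices of a complete graph alike,
  both for local averages and as starting points of paths.\<close>

lemma complete_graph_transpose:
  assumes "u < n" "v < n"
  defines "f \<equiv> \<lambda>x. if x = u then v else if x = v then u else x"
  shows "bij_betw f (verts (complete_graph n)) (verts (complete_graph n))"
    and "edges (complete_graph n) = (\<lambda>e. f ` e) ` edges (complete_graph n)"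
proof -
  have ff: "f (f x) = x" for x by (simp add: f_def)
  have r: "f x < n \<longleftrightarrow> x < n" for x using assms by (simp add: f_def)
  show "bij_betw f (verts (complete_graph n)) (verts (complete_graph n))"
    by (rule bij_betw_byWitness[of _ f]) (auto simp: ff r)
  have sub: "(\<lambda>e. f ` e) ` edges (complete_graph n) \<subseteq> edges (complete_graph n)"
  proof (rule image_subsetI)
    fix e assume "e \<in> edges (complete_graph n)"
    then obtain i j where "e = {i, j}" "i < n" "j < n" "i \<noteq> j" by (auto simp: complete_graph_def)
    moreover then have "f i \<noteq> f j" using ff by metis
    ultimately show "f ` e \<in> edges (complete_graph n)"
      using complete_graph_edge[of "f i" n "f j"] r by simp
  qed
  moreover have "f ` f ` e = e" for e by (simp add: image_image ff)
  then have "edges (complete_graph n) \<subseteq> (\<lambda>e. f ` e) ` edges (complete_graph n)"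
    using sub by (metis image_subset_iff image_eqI subsetI)
  ultimately show "edges (complete_graph n) = (\<lambda>e. f ` e) ` edges (complete_graph n)" by blast
qed

lemma degree_complete_graph:
  assumes "v < n"
  shows "vertex_degree (complete_graph n) v = n - 1"
proof -
  have "{e \<in> edges (complete_graph n). v \<in> e} = (\<lambda>i. {v, i}) ` ({..<n} - {v})"
    using assms by (auto simp: complete_graph_def)
  moreover have "inj_on (\<lambda>i. {v, i}) ({..<n} - {v})" by (auto simp: inj_on_def doubleton_eq_iff)
  ultimately show ?thesis using assms by (simp add: vertex_degree_def card_image)
qed

text \<open>By symmetry all local averages in the complete graph of order \<open>Suc d\<close>
  agree, so each of its vertices, all of degree \<open>d\<close>, attains the maximum.\<close>

lemma ex_max_local_degree:
  assumes "d \<ge> 1"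
  shows "\<exists>G :: nat graph. connected_graph G \<and>
    (\<exists>v\<in>verts G. vertex_degree G v = d \<and> (\<forall>w\<in>verts G. avp_at G w \<le> avp_at G v))"
proof (intro exI conjI bexI ballI)
  show "connected_graph (complete_graph (Suc d))" by (rule connected_complete_graph) simp
  show "vertex_degree (complete_graph (Suc d)) 0 = d" by (simp add: degree_complete_graph)
  show "0 \<in> verts (complete_graph (Suc d))" by simp
  fix w assume "w \<in> verts (complete_graph (Suc d))"
  then have w: "w < Suc d" by simp
  show "avp_at (complete_graph (Suc d)) w \<le> avp_at (complete_graph (Suc d)) 0"
    using avp_at_iso[OF simple_complete_graph simple_complete_graph complete_graph_transpose[OF w, of 0], of w] w
    by simp
qed

subsection \<open>The ratio of local to global averages in trees\<close>

locale finite_tree =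
  fixes T :: "'a graph"
  assumes tree: "tree T"
begin

definition tpath :: "'a \<Rightarrow> 'a \<Rightarrow> 'a list" where
  "tpath x y = the_elem (plists_between T x y)"

definition tdist :: "'a \<Rightarrow> 'a \<Rightarrow> nat" where
  "tdist x y = length (tpath x y) - 1"

lemma between_tpath:
  assumes "x \<in> verts T" "y \<in> verts T"
  shows "plists_between T x y = {tpath x y}"
proof -
  have "card (plists_between T x y) = 1" by (rule tree_card_between[OF tree assms])
  then obtain p where "plists_between T x y = {p}" by (auto simp: card_1_singleton_iff)
  then show ?thesis by (simp add: tpath_def)
qed

lemma tpath:
  assumes "x \<in> verts T" "y \<in> verts T"
  shows "tpath x y \<in> plists T" "hd (tpath x y) = x" "last (tpath x y) = y" "tpath x y \<noteq> []"
    "set (tpath x y) \<subseteq> verts T" "list_edges (tpath x y) \<subseteq> edges T" "distinct (tpath x y)"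
proof -
  have "tpath x y \<in> plists_between T x y" using between_tpath[OF assms] by simp
  then show "tpath x y \<in> plists T" "hd (tpath x y) = x" "last (tpath x y) = y" "tpath x y \<noteq> []"
    "set (tpath x y) \<subseteq> verts T" "list_edges (tpath x y) \<subseteq> edges T" "distinct (tpath x y)"
    by (simp_all add: plists_between_def plists_alt)
qed

lemma tpath_unique:
  assumes "xs \<in> plists T"
  shows "tpath (hd xs) (last xs) = xs"
proof -
  have "xs \<noteq> []" "set xs \<subseteq> verts T" using assms by (simp_all add: plists_alt)
  then have "hd xs \<in> verts T" "last xs \<in> verts T" by auto
  moreover have "xs \<in> plists_between T (hd xs) (last xs)" using assms by (simp add: plists_between_def)
  ultimately show ?thesis using between_tpath[of "hd xs" "last xs"] by simp
qed

lemma tpath_rev: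
  assumes "x \<in> verts T" "y \<in> verts T"
  shows "tpath y x = rev (tpath x y)"
  using tpath_unique[of "rev (tpath x y)"] tpath[OF assms] by (simp add: hd_rev last_rev)

lemma tdist_sym: "x \<in> verts T \<Longrightarrow> y \<in> verts T \<Longrightarrow> tdist y x = tdist x y"
  using tpath_rev[of x y] by (simp add: tdist_def)

text \<open>Joining the two paths gives a walk from \<open>x\<close> to \<open>z\<close>, and the
  path extracted from it must be the unique one.\<close>

lemma tpath_via:
  assumes x: "x \<in> verts T" and y: "y \<in> verts T" and z: "z \<in> verts T"
  shows "set (tpath x z) \<subseteq> set (tpath x y) \<union> set (tpath y z)" "tdist x z \<le> tdist x y + tdist y z"
proof -
  obtain qs where q: "tpath y z = y # qs" using tpath[OF y z] by (cases "tpath y z") auto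
  define xs where "xs = tpath x y @ qs"
  have ne: "xs \<noteq> []" using tpath(4)[OF x y] by (simp add: xs_def)
  have "hd xs = x" using tpath[OF x y] by (simp add: xs_def)
  moreover have "last xs = z" using tpath(3)[OF x y] tpath(3)[OF y z] q
    by (cases qs) (simp_all add: xs_def)
  moreover have "set xs \<subseteq> verts T" using tpath(5)[OF x y] tpath(5)[OF y z] q by (simp add: xs_def)
  moreover have "list_edges xs \<subseteq> edges T"
    using tpath(3,6)[OF x y] tpath(6)[OF y z] q
    by (cases qs) (simp_all add: xs_def list_edges_append)
  ultimately obtain ys where ys: "ys \<in> plists_between T x z" "set ys \<subseteq> set xs" "length ys \<le> length xs"
    using walk_imp_plist[OF ne] by blast
  have "ys = tpath x z" using ys(1) between_tpath[OF x z] by simp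
  moreover have "set xs \<subseteq> set (tpath x y) \<union> set (tpath y z)" using q by (auto simp: xs_def)
  ultimately show "set (tpath x z) \<subseteq> set (tpath x y) \<union> set (tpath y z)" using ys(2) by blast
  have "length xs = length (tpath x y) + (length (tpath y z) - 1)" using q by (simp add: xs_def)
  then show "tdist x z \<le> tdist x y + tdist y z"
    using ys(3) tpath(4)[OF x y] unfolding \<open>ys = tpath x z\<close> tdist_def
    by (cases "tpath x y") simp_all
qed

lemma tdist_through:
  assumes x: "x \<in> verts T" and y: "y \<in> verts T" and v: "v \<in> set (tpath x y)"
  shows "tdist x y = tdist x v + tdist v y"
proof -
  obtain as bs where sp: "tpath x y = as @ v # bs" using v by (meson split_list)
  have p: "distinct (as @ v # bs)" "set (as @ v # bs) \<subseteq> verts T" "list_edges (as @ v # bs) \<subseteq> edges T"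
    using tpath[OF x y] unfolding sp by blast+
  have "list_edges (as @ v # bs) = list_edges (as @ [v]) \<union> list_edges (v # bs)"
    by (auto simp: list_edges_append)
  then have "as @ [v] \<in> plists T" "v # bs \<in> plists T" using p by (auto simp: plists_alt)
  then have "tpath (hd (as @ [v])) v = as @ [v]" "tpath v (last (v # bs)) = v # bs"
    using tpath_unique[of "as @ [v]"] tpath_unique[of "v # bs"] by simp_all
  moreover have "hd (as @ [v]) = x" using tpath(2)[OF x y] unfolding sp by (cases as) simp_all
  moreover have "last (v # bs) = y" using tpath(3)[OF x y] unfolding sp by simp
  ultimately show ?thesis by (simp add: tdist_def sp)
qed

lemma tpath_self: "x \<in> verts T \<Longrightarrow> tpath x x = [x]"
  using plists_between_self[of x T] by (simp add: tpath_def)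

lemma tdist_pos: "x \<in> verts T \<Longrightarrow> y \<in> verts T \<Longrightarrow> x \<noteq> y \<Longrightarrow> tdist x y > 0"
  using tpath[of x y] by (cases "tpath x y" rule: list_edges.cases) (simp_all add: tdist_def)

lemma plists_image:
  "{xs \<in> plists T. Q xs} = (\<lambda>(x, y). tpath x y) ` {(x, y) \<in> verts T \<times> verts T. Q (tpath x y)}"
  and plists_image_inj: "inj_on (\<lambda>(x, y). tpath x y) (verts T \<times> verts T)"
proof -
  show "{xs \<in> plists T. Q xs} = (\<lambda>(x, y). tpath x y) ` {(x, y) \<in> verts T \<times> verts T. Q (tpath x y)}"
  proof (intro set_eqI iffI)
    fix xs assume "xs \<in> {xs \<in> plists T. Q xs}"
    then have xs: "xs \<in> plists T" "Q xs" by simp_all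
    then have "xs \<noteq> []" "set xs \<subseteq> verts T" by (simp_all add: plists_alt)
    then have "hd xs \<in> verts T" "last xs \<in> verts T" by auto
    then show "xs \<in> (\<lambda>(x, y). tpath x y) ` {(x, y) \<in> verts T \<times> verts T. Q (tpath x y)}"
      using tpath_unique[OF xs(1)] xs(2) by (intro image_eqI[of _ _ "(hd xs, last xs)"]) simp_all
  next
    fix xs assume "xs \<in> (\<lambda>(x, y). tpath x y) ` {(x, y) \<in> verts T \<times> verts T. Q (tpath x y)}"
    then obtain x y where "x \<in> verts T" "y \<in> verts T" "Q (tpath x y)" "xs = tpath x y" by auto
    then show "xs \<in> {xs \<in> plists T. Q xs}" using tpath(1) by simp
  qed
  show "inj_on (\<lambda>(x, y). tpath x y) (verts T \<times> verts T)"
  proof (rule inj_onI, clarify)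
    fix x y x' y' assume "x \<in> verts T" "y \<in> verts T" "x' \<in> verts T" "y' \<in> verts T" "tpath x y = tpath x' y'"
    then show "x = x' \<and> y = y'" using tpath(2,3) by metis
  qed
qed

lemma path_sum_plists_where:
  "path_sum {xs \<in> plists T. Q xs} = (\<Sum>(x, y) | (x, y) \<in> verts T \<times> verts T \<and> Q (tpath x y). tdist x y)"
  "card {xs \<in> plists T. Q xs} = card {(x, y) \<in> verts T \<times> verts T. Q (tpath x y)}"
proof -
  have inj: "inj_on (\<lambda>(x, y). tpath x y) {(x, y) \<in> verts T \<times> verts T. Q (tpath x y)}"
    by (rule inj_on_subset[OF plists_image_inj]) auto
  show "path_sum {xs \<in> plists T. Q xs} = (\<Sum>(x, y) | (x, y) \<in> verts T \<times> verts T \<and> Q (tpath x y). tdist x y)"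
    unfolding path_sum_def plists_image[of Q] sum.reindex[OF inj]
    by (rule sum.cong) (auto simp: tdist_def)
  show "card {xs \<in> plists T. Q xs} = card {(x, y) \<in> verts T \<times> verts T. Q (tpath x y)}"
    unfolding plists_image[of Q] by (rule card_image[OF inj])
qed

end

section \<open>Branches at a vertex of a tree\<close>

locale tree_vertex = finite_tree T for T :: "'a graph" +
  fixes v :: 'a
  assumes v: "v \<in> verts T" and order: "graph_order T \<ge> 2"
begin

text \<open>The branch at \<open>v\<close> that contains \<open>x\<close>; it is empty for \<open>x = v\<close>.\<close>

definition branch :: "'a \<Rightarrow> 'a set" where
  "branch x = {y \<in> verts T. v \<notin> set (tpath x y)}"

abbreviation n where "n \<equiv> graph_order T"

lemma fin: "finite (verts T)" by (rule tree_finite[OF tree])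

lemma fin_branch: "finite (branch x)" using fin by (simp add: branch_def)

lemma branch_subset: "branch x \<subseteq> verts T" by (auto simp: branch_def)

lemma branch_sym: "x \<in> verts T \<Longrightarrow> y \<in> branch x \<Longrightarrow> x \<in> branch y"
  using tpath_rev[of x y] unfolding branch_def by simp

lemma branch_trans:
  assumes "x \<in> verts T" "y \<in> branch x" "z \<in> branch y"
  shows "z \<in> branch x"
  using tpath_via(1)[of x y z] assms by (auto simp: branch_def)

lemma branch_eq: "x \<in> verts T \<Longrightarrow> y \<in> branch x \<Longrightarrow> branch y = branch x"
  using branch_trans branch_sym branch_subset by (intro set_eqI iffI) blast+

lemma branch_v: "branch v = {}"
proof -
  have "v \<in> set (tpath v y)" if "y \<in> verts T" for y
    using tpath(2,4)[OF v that] hd_in_set[of "tpath v y"] by simp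
  then show ?thesis by (auto simp: branch_def)
qed

lemma v_notin_branch: "x \<in> verts T \<Longrightarrow> v \<notin> branch x"
  using branch_sym branch_v by blast

lemma self_in_branch: "x \<in> verts T \<Longrightarrow> x \<noteq> v \<Longrightarrow> x \<in> branch x"
  by (simp add: branch_def tpath_self)

definition b :: "'a \<Rightarrow> real" where "b x = real (card (branch x))"

definition \<delta> :: "'a \<Rightarrow> real" where "\<delta> x = real (tdist x v)"

text \<open>The number of ordered pairs whose path avoids \<open>v\<close>, equal to the sum of the
  squares of the sizes of the branches.\<close>

definition S :: real where "S = (\<Sum>x\<in>verts T. b x)"

lemma b_le: "x \<in> verts T \<Longrightarrow> b x \<le> real n - 1"
proof -
  assume "x \<in> verts T"
  then have "card (branch x) \<le> card (verts T - {v})"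
    using v_notin_branch branch_subset fin by (intro card_mono) auto
  then have "card (branch x) \<le> n - 1" using v fin by (simp add: graph_order_def)
  then show ?thesis using order by (simp add: b_def)
qed

text \<open>All members of a branch have the same branch, so a branch of size a contributes a^2 to
  \<open>S\<close>.\<close>

lemma S_ge: "x \<in> verts T \<Longrightarrow> (b x)\<^sup>2 \<le> S"
proof -
  assume x: "x \<in> verts T"
  have "(b x)\<^sup>2 = (\<Sum>y\<in>branch x. b x)" by (simp add: b_def power2_eq_square)
  also have "\<dots> = (\<Sum>y\<in>branch x. b y)"
    by (rule sum.cong) (simp_all add: b_def branch_eq[OF x])
  also have "\<dots> \<le> S" unfolding S_def
    using fin branch_subset by (intro sum_mono2) (auto simp: b_def)
  finally show ?thesis .
qed

text \<open>Double counting: lying in the same branch is a symmetric relation, so each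
  \<open>y\<close> is summed once for every member of its branch.\<close>

lemma swap_branch:
  "(\<Sum>x\<in>verts T. \<Sum>y\<in>branch x. f y) = (\<Sum>x\<in>verts T. b x * f x)"
proof -
  have "(\<Sum>x\<in>verts T. \<Sum>y\<in>branch x. f y) = (\<Sum>y\<in>verts T. \<Sum>x | x \<in> verts T \<and> y \<in> branch x. f y)"
    using sum.swap_restrict[OF fin fin, of "\<lambda>x y. f y" "\<lambda>x y. y \<in> branch x"]
      branch_subset by (simp add: branch_def)
  also have "\<dots> = (\<Sum>y\<in>verts T. b y * f y)"
  proof (rule sum.cong[OF refl])
    fix y assume y: "y \<in> verts T"
    have "{x \<in> verts T. y \<in> branch x} = branch y" using branch_sym branch_subset y by blast
    then show "(\<Sum>x | x \<in> verts T \<and> y \<in> branch x. f y) = b y * f y" by (simp add: b_def)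
  qed
  finally show ?thesis .
qed

text \<open>A path through \<open>v\<close> has length \<open>\<delta> x + \<delta> y\<close>, and
  \<open>x\<close> has \<open>n - b x\<close> partners reached through \<open>v\<close>; the factor
  2 comes from the two ends.\<close>

lemma sum_through:
  "real (path_sum {xs \<in> plists T. v \<in> set xs}) = 2 * (\<Sum>x\<in>verts T. \<delta> x * (real n - b x))"
proof -
  have eq: "{(x, y) \<in> verts T \<times> verts T. v \<in> set (tpath x y)} = (SIGMA x:verts T. verts T - branch x)"
    by (auto simp: branch_def)
  have "real (path_sum {xs \<in> plists T. v \<in> set xs}) =
      (\<Sum>(x, y) | (x, y) \<in> verts T \<times> verts T \<and> v \<in> set (tpath x y). real (tdist x y))"
    unfolding path_sum_plists_where(1) of_nat_sum by (rule sum.cong) auto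
  also have "\<dots> = (\<Sum>x\<in>verts T. \<Sum>y\<in>verts T - branch x. real (tdist x y))"
    unfolding eq using fin by (subst sum.Sigma) auto
  also have "\<dots> = (\<Sum>x\<in>verts T. \<Sum>y\<in>verts T - branch x. \<delta> x + \<delta> y)"
  proof (intro sum.cong refl)
    fix x y assume "x \<in> verts T" "y \<in> verts T - branch x"
    then show "real (tdist x y) = \<delta> x + \<delta> y"
      using tdist_through[of x y v] tdist_sym[OF v, of y] by (simp add: branch_def \<delta>_def)
  qed
  also have "\<dots> = (\<Sum>x\<in>verts T. (\<Sum>y\<in>verts T. \<delta> x + \<delta> y) - (\<Sum>y\<in>branch x. \<delta> x + \<delta> y))"
    using fin branch_subset by (simp add: sum_diff)
  also have "\<dots> = (\<Sum>x\<in>verts T. real n * \<delta> x + (\<Sum>y\<in>verts T. \<delta> y) - (b x * \<delta> x + (\<Sum>y\<in>branch x. \<delta> y)))"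
    by (simp add: sum.distrib graph_order_def b_def)
  also have "\<dots> = (\<Sum>x\<in>verts T. real n * \<delta> x) + real n * (\<Sum>y\<in>verts T. \<delta> y)
      - ((\<Sum>x\<in>verts T. b x * \<delta> x) + (\<Sum>x\<in>verts T. b x * \<delta> x))"
    unfolding sum_subtractf sum.distrib swap_branch by (simp add: graph_order_def)
  also have "\<dots> = 2 * (\<Sum>x\<in>verts T. \<delta> x * (real n - b x))"
    by (simp add: right_diff_distrib sum_subtractf sum_distrib_left sum_distrib_right mult.commute)
  finally show ?thesis .
qed

lemma card_through: "real (card {xs \<in> plists T. v \<in> set xs}) = (real n)\<^sup>2 - S"
proof -
  have eq: "{(x, y) \<in> verts T \<times> verts T. v \<in> set (tpath x y)} = (SIGMA x:verts T. verts T - branch x)"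
    by (auto simp: branch_def)
  have "real (card {xs \<in> plists T. v \<in> set xs}) = (\<Sum>x\<in>verts T. real (card (verts T - branch x)))"
    unfolding path_sum_plists_where(2) eq using fin by (subst card_SigmaI) auto
  also have "\<dots> = (\<Sum>x\<in>verts T. real n - b x)"
  proof (rule sum.cong[OF refl])
    fix x assume "x \<in> verts T"
    show "real (card (verts T - branch x)) = real n - b x"
      using card_Diff_subset[OF fin_branch branch_subset, of x] card_mono[OF fin branch_subset, of x]
      by (simp add: b_def graph_order_def of_nat_diff)
  qed
  finally show ?thesis by (simp add: sum_subtractf S_def graph_order_def power2_eq_square)
qed

text \<open>Inside a branch the distance is at most that of the detour through \<open>v\<close>.
  Leaving out the pair of \<open>x\<close> with itself replaces \<open>b x\<close> by
  \<open>b x - 1\<close>; thanks to this saving the branch sizes cancel when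
  \<open>sum_through\<close> is added, and the total is at most \<open>2 * (n - 1)\<close> times the
  sum of all \<open>\<delta> x\<close>.\<close>

lemma sum_avoiding:
  "real (path_sum {xs \<in> plists T. v \<notin> set xs}) \<le> 2 * (\<Sum>x\<in>verts T. \<delta> x * (b x - 1))"
proof -
  have eq: "{(x, y) \<in> verts T \<times> verts T. v \<notin> set (tpath x y)} = (SIGMA x:verts T. branch x)"
    by (auto simp: branch_def)
  have "real (path_sum {xs \<in> plists T. v \<notin> set xs}) =
      (\<Sum>(x, y) | (x, y) \<in> verts T \<times> verts T \<and> v \<notin> set (tpath x y). real (tdist x y))"
    unfolding path_sum_plists_where(1) of_nat_sum by (rule sum.cong) auto
  also have "\<dots> = (\<Sum>x\<in>verts T. \<Sum>y\<in>branch x. real (tdist x y))"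
    unfolding eq using fin fin_branch by (subst sum.Sigma) auto
  also have "\<dots> \<le> (\<Sum>x\<in>verts T. (\<Sum>y\<in>branch x. \<delta> x + \<delta> y) - 2 * \<delta> x)"
  proof (rule sum_mono)
    fix x assume x: "x \<in> verts T"
    show "(\<Sum>y\<in>branch x. real (tdist x y)) \<le> (\<Sum>y\<in>branch x. \<delta> x + \<delta> y) - 2 * \<delta> x"
    proof (cases "x = v")
      case True
      then show ?thesis by (simp add: branch_v \<delta>_def tdist_def tpath_self[OF v])
    next
      case False
      have xb: "x \<in> branch x" by (rule self_in_branch[OF x False])
      have "(\<Sum>y\<in>branch x. real (tdist x y)) = (\<Sum>y\<in>branch x - {x}. real (tdist x y))"
        using sum.remove[OF fin_branch xb, of "\<lambda>y. real (tdist x y)"] x by (simp add: tdist_def tpath_self)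
      also have "\<dots> \<le> (\<Sum>y\<in>branch x - {x}. \<delta> x + \<delta> y)"
      proof (rule sum_mono)
        fix y assume "y \<in> branch x - {x}"
        then have y: "y \<in> verts T" using branch_subset by blast
        have "real (tdist x y) \<le> real (tdist x v + tdist v y)"
          using tpath_via(2)[OF x v y] by (simp only: of_nat_le_iff)
        then show "real (tdist x y) \<le> \<delta> x + \<delta> y" using tdist_sym[OF v y] by (simp add: \<delta>_def)
      qed
      also have "\<dots> = (\<Sum>y\<in>branch x. \<delta> x + \<delta> y) - 2 * \<delta> x"
        using sum.remove[OF fin_branch xb, of "\<lambda>y. \<delta> x + \<delta> y"] by simp
      finally show ?thesis .
    qed
  qed
  also have "\<dots> = 2 * (\<Sum>x\<in>verts T. b x * \<delta> x) - 2 * (\<Sum>x\<in>verts T. \<delta> x)"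
    unfolding sum_subtractf sum.distrib swap_branch by (simp add: b_def sum_distrib_left)
  also have "\<dots> = 2 * (\<Sum>x\<in>verts T. \<delta> x * (b x - 1))"
    by (simp add: right_diff_distrib sum_subtractf mult.commute)
  finally show ?thesis .
qed

lemma avp_at_gt_half: "avp_at T v > avp T / 2"
proof -
  define N where "N = real n"
  define D where "D = (\<Sum>x\<in>verts T. \<delta> x)"
  define A where "A = (\<Sum>x\<in>verts T. \<delta> x * (N - b x))"
  have N: "N \<ge> 2" using order by (simp add: N_def)
  have simple: "simple_graph T" by (rule tree_simple[OF tree])
  have finp: "finite (plists T)" using simple by simp
  have "path_sum (plists T) = path_sum {xs \<in> plists T. v \<in> set xs} + path_sum {xs \<in> plists T. v \<notin> set xs}"
    using path_sum_Un[of "{xs \<in> plists T. v \<in> set xs}" "{xs \<in> plists T. v \<notin> set xs}"] finp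
    by (simp add: disjoint_iff Un_def conj_disj_distribL[symmetric] flip: Collect_disj_eq)
  then have "real (path_sum (plists T)) \<le> 2 * A + 2 * (\<Sum>x\<in>verts T. \<delta> x * (b x - 1))"
    using sum_through sum_avoiding by (simp add: A_def N_def)
  also have "\<dots> = 2 * (\<Sum>x\<in>verts T. \<delta> x * (N - b x) + \<delta> x * (b x - 1))"
    by (simp add: A_def sum.distrib)
  also have "(\<Sum>x\<in>verts T. \<delta> x * (N - b x) + \<delta> x * (b x - 1)) = (N - 1) * D"
    unfolding D_def sum_distrib_left by (rule sum.cong) (simp_all add: algebra_simps)
  finally have glob: "real (path_sum (plists T)) \<le> 2 * ((N - 1) * D)" .
  have Mpos: "1 + N\<^sup>2 - S > 0"
    using card_through by (simp add: N_def)
  \<comment> \<open>After cross-multiplication of the exact local average with half the bound for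
    the global one, the required inequality holds for the coefficient of every
    \<open>\<delta> x\<close> separately. Of \<open>S\<close> only the square of the size of the
    branch of \<open>x\<close> is kept.\<close>
  have pointwise: "(1 + N\<^sup>2 - S) * (N - 1) < 2 * (N\<^sup>2 + N) * (N - b x)" if x: "x \<in> verts T" for x
  proof -
    define a where "a = b x"
    have a: "0 \<le> a" "a \<le> N - 1" using b_le[OF x] by (simp_all add: a_def N_def b_def)
    have "(1 + N\<^sup>2 - S) * (N - 1) \<le> (1 + N\<^sup>2 - a\<^sup>2) * (N - 1)"
      using S_ge[OF x] N by (intro mult_right_mono) (auto simp: a_def)
    also have "\<dots> = (N - 1) + (N - a) * ((N + a) * (N - 1))" by (simp add: algebra_simps power2_eq_square)
    also have "\<dots> \<le> (N - 1) + (N - a) * ((2 * N) * (N - 1))"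
      using a N by (intro add_left_mono mult_left_mono mult_right_mono) auto
    also have "\<dots> < 4 * N * (N - a) + (N - a) * ((2 * N) * (N - 1))"
    proof -
      have "4 * N * 1 \<le> 4 * N * (N - a)" using a N by (intro mult_left_mono) auto
      then show ?thesis using N by linarith
    qed
    also have "\<dots> = 2 * (N\<^sup>2 + N) * (N - a)" by (simp add: algebra_simps power2_eq_square)
    finally show ?thesis by (simp add: a_def)
  qed
  \<comment> \<open>The sums differ strictly only through a vertex with positive distance to
    \<open>v\<close>, and \<open>v\<close> itself contributes 0.\<close>
  have "verts T \<noteq> {v}" using order by (auto simp: graph_order_def)
  then obtain z where z: "z \<in> verts T" "z \<noteq> v" using v by blast
  have "(1 + N\<^sup>2 - S) * ((N - 1) * D) = (\<Sum>x\<in>verts T. \<delta> x * ((1 + N\<^sup>2 - S) * (N - 1)))"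
    unfolding D_def sum_distrib_left by (rule sum.cong) (simp_all add: algebra_simps)
  also have "\<dots> < (\<Sum>x\<in>verts T. \<delta> x * (2 * (N\<^sup>2 + N) * (N - b x)))"
  proof (rule sum_strict_mono_ex1[OF fin])
    show "\<forall>x\<in>verts T. \<delta> x * ((1 + N\<^sup>2 - S) * (N - 1)) \<le> \<delta> x * (2 * (N\<^sup>2 + N) * (N - b x))"
      using pointwise by (intro ballI mult_left_mono) (auto simp: \<delta>_def less_imp_le)
    have "\<delta> z > 0" using tdist_pos[OF z(1) v z(2)] by (simp add: \<delta>_def)
    then show "\<exists>x\<in>verts T. \<delta> x * ((1 + N\<^sup>2 - S) * (N - 1)) < \<delta> x * (2 * (N\<^sup>2 + N) * (N - b x))"
      using pointwise[OF z(1)] z(1) by (intro bexI[of _ z]) (auto intro: mult_strict_left_mono)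
  qed
  also have "\<dots> = 2 * (N\<^sup>2 + N) * A"
    unfolding A_def sum_distrib_left by (rule sum.cong) (simp_all add: algebra_simps)
  finally have main: "(1 + N\<^sup>2 - S) * ((N - 1) * D) < 2 * (N\<^sup>2 + N) * A" .
  have "avp T = real (path_sum (plists T)) / (N\<^sup>2 + N)"
    using avp_tree[OF tree] by (simp add: N_def power2_eq_square algebra_simps)
  also have "\<dots> \<le> 2 * ((N - 1) * D) / (N\<^sup>2 + N)"
    using glob N by (intro divide_right_mono) auto
  finally have 1: "avp T \<le> 2 * ((N - 1) * D / (N\<^sup>2 + N))" by (simp only: times_divide_eq_right)
  define K M where "K = N\<^sup>2 + N" and "M = 1 + N\<^sup>2 - S"
  have KM: "K > 0" "M > 0" using N Mpos by (simp_all add: K_def M_def add_pos_pos)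
  have "(N - 1) * D / K = (M * ((N - 1) * D)) / (K * M)" using KM by simp
  also have "\<dots> < (2 * K * A) / (K * M)"
    using main KM by (intro divide_strict_right_mono) (simp_all add: K_def M_def)
  also have "\<dots> = 2 * A / M" using KM by simp
  finally have "(N - 1) * D / (N\<^sup>2 + N) < 2 * A / (1 + N\<^sup>2 - S)" by (simp only: K_def M_def)
  also have "\<dots> = avp_at T v"
    unfolding avp_at_plists[OF simple v] sum_through using card_through by (simp add: A_def N_def)
  finally show ?thesis using 1 by linarith
qed

end

lemma path_sum_pos: "finite A \<Longrightarrow> xs \<in> A \<Longrightarrow> length xs \<ge> 2 \<Longrightarrow> path_sum A > 0"
  unfolding path_sum_def by (rule sum_pos2) auto

lemma connected_avp_pos:
  assumes G: "connected_graph G" and n: "graph_order G \<ge> 2" and v: "v \<in> verts G"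
  shows "avp G > 0" "avp_at G v > 0"
proof -
  have s: "simple_graph G" by (rule connected_simple[OF G])
  obtain xs where xs: "xs \<in> plists_from G v" "length xs \<ge> 2" using ex_long_from[OF G v n] by blast
  then have "xs \<in> plists G" "hd xs = v" by (simp_all add: plists_from_def)
  moreover then have "v \<in> set xs" using xs(2) by (cases xs) auto
  ultimately have "path_sum (plists G) > 0" "path_sum {xs \<in> plists G. v \<in> set xs} > 0"
    using s xs(2) by (auto intro!: path_sum_pos[of _ xs])
  then show "avp G > 0" "avp_at G v > 0"
    using n by (simp_all add: avp_plists[OF s] avp_at_plists[OF s v] divide_pos_pos add_pos_nonneg)
qed

lemma tree_ratio_gt_half:
  assumes "tree T" "graph_order T \<ge> 2" "v \<in> verts T"
  shows "avp_at T v / avp T > 1 / 2"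
proof -
  interpret tree_vertex T v using assms by unfold_locales
  have "avp T > 0" using connected_avp_pos(1) assms by (auto simp: tree_def)
  then show ?thesis using avp_at_gt_half by (simp add: divide_simps)
qed

subsection \<open>Attaching legs and leaves\<close>

text \<open>These four quantities suffice for the pendant-vertex recurrences below. They are
  real-valued because the closed forms for legs contain halves and thirds.\<close>

definition count_from :: "'a graph \<Rightarrow> 'a \<Rightarrow> real" where "count_from G x = real (card (plists_from G x))"
definition length_from :: "'a graph \<Rightarrow> 'a \<Rightarrow> real" where "length_from G x = real (path_sum (plists_from G x))"
definition count_paths :: "'a graph \<Rightarrow> real" where "count_paths G = real (card (plists G))"
definition length_paths :: "'a graph \<Rightarrow> real" where "length_paths G = real (path_sum (plists G))"

context pendant
begin

lemma count_from_pend_new: "count_from (pend G u w) w = 1 + count_from G u"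
  and length_from_pend_new: "length_from (pend G u w) w = length_from G u + count_from G u"
  and count_paths_pend: "count_paths (pend G u w) = count_paths G + 1 + 2 * count_from G u"
  and length_paths_pend: "length_paths (pend G u w) = length_paths G + 2 * (length_from G u + count_from G u)"
  by (simp_all add: count_from_def length_from_def count_paths_def length_paths_def card_from_pend_new sum_from_pend_new card_plists_pend sum_plists_pend)

lemma count_from_pend_old: "x \<in> verts G \<Longrightarrow> card (plists_between G x u) = 1 \<Longrightarrow> count_from (pend G u w) x = count_from G x + 1"
  by (simp add: count_from_def card_from_pend_old)

lemma length_from_pend_old: "x \<in> verts G \<Longrightarrow> card (plists_between G x u) = 1 \<Longrightarrow>
    length_from (pend G u w) x = length_from G x + path_sum (plists_between G x u) + 1"
  by (simp add: length_from_def sum_from_pend_old)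

lemma between_pend_new_sums:
  assumes x: "x \<in> verts G"
  shows "card (plists_between (pend G u w) x w) = card (plists_between G x u)"
    "path_sum (plists_between (pend G u w) x w) = path_sum (plists_between G x u) + card (plists_between G x u)"
proof -
  have "[] \<notin> rev ` plists_between G x u" using nil_notin by auto
  then show "path_sum (plists_between (pend G u w) x w) = path_sum (plists_between G x u) + card (plists_between G x u)"
    unfolding between_pend_new[OF x] using simple
    by (simp_all add: append_image path_sum_Cons_image path_sum_rev_image card_rev_image)
  show "card (plists_between (pend G u w) x w) = card (plists_between G x u)"
    unfolding between_pend_new[OF x] by (rule card_image) (simp add: inj_on_def)
qed

lemma avp_at_pend_ratio: "avp_at (pend G u w) w = length_from (pend G u w) w / count_from (pend G u w) w"
  by (simp add: avp_at_pend count_from_def length_from_def)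

end

lemma avp_P_W: "simple_graph G \<Longrightarrow> avp G = length_paths G / (graph_order G + count_paths G)"
  by (simp add: avp_plists length_paths_def count_paths_def)

text \<open>A leg or brush attached to a graph on \<open>{..<N}\<close> receives the numbers from
  \<open>N\<close> upwards, so successive attachments need no renaming. A leg of length 0 ends at
  its root \<open>c\<close>.\<close>

definition tip :: "nat \<Rightarrow> nat \<Rightarrow> nat \<Rightarrow> nat" where
  "tip c N l = (if l = 0 then c else N + l - 1)"

fun leg :: "nat graph \<Rightarrow> nat \<Rightarrow> nat \<Rightarrow> nat \<Rightarrow> nat graph" where
  "leg G c N 0 = G"
| "leg G c N (Suc l) = pend (leg G c N l) (tip c N l) (N + l)"

fun brush :: "nat graph \<Rightarrow> nat \<Rightarrow> nat \<Rightarrow> nat \<Rightarrow> nat graph" where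
  "brush G c N 0 = G"
| "brush G c N (Suc m) = pend (brush G c N m) c (N + m)"

text \<open>The values at the tip are needed to prolong the leg, those at \<open>c\<close> to attach
  the next one, so a single induction carries both. In the last formula, lists of \<open>G\<close>
  from \<open>c\<close> prolonged by 1, ..., l edges give the terms with \<open>length_from\<close>
  and \<open>count_from\<close>; the last summand is the distance sum inside the leg.\<close>

lemma leg_invariant:
  assumes G: "connected_graph G" "verts G = {..<N}" and c: "c < N"
  shows "connected_graph (leg G c N l) \<and> (tree G \<longrightarrow> tree (leg G c N l)) \<and> verts (leg G c N l) = {..<N + l} \<and>
    count_from (leg G c N l) c = count_from G c + l \<and> length_from (leg G c N l) c = length_from G c + real l * (real l + 1) / 2 \<and>
    card (plists_between (leg G c N l) c (tip c N l)) = 1 \<and>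
    path_sum (plists_between (leg G c N l) c (tip c N l)) = l \<and>
    count_from (leg G c N l) (tip c N l) = count_from G c + l \<and>
    length_from (leg G c N l) (tip c N l) = length_from G c + real l * count_from G c + real l * (real l - 1) / 2 \<and>
    count_paths (leg G c N l) = count_paths G + 2 * real l * count_from G c + real l ^ 2 \<and>
    length_paths (leg G c N l) = length_paths G + 2 * real l * length_from G c + count_from G c * real l * (real l + 1) + (real l - 1) * real l * (real l + 1) / 3"
proof (induction l)
  case 0
  have "plists_between G c c = {[c]}" by (rule plists_between_self) (use G c in simp)
  then show ?case using G by (simp add: tip_def path_sum_def)
next
  case (Suc l)
  let ?G = "leg G c N l" and ?u = "tip c N l" and ?w = "N + l"
  have V: "verts ?G = {..<N + l}" and con: "connected_graph ?G"
    by (insert Suc.IH, (elim conjE, assumption)+)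
  have u: "?u \<in> verts ?G" unfolding V using c by (simp add: tip_def)
  interpret pendant ?G ?u ?w
    using V con u by unfold_locales (simp_all add: connected_simple)
  have cV: "c \<in> verts ?G" unfolding V using c by simp
  have tip: "tip c N (Suc l) = ?w" by (simp add: tip_def)
  have b: "card (plists_between ?G c ?u) = 1" "path_sum (plists_between ?G c ?u) = l"
    by (insert Suc.IH, (elim conjE, assumption)+)
  have e: "count_from ?G c = count_from G c + l" "length_from ?G c = length_from G c + real l * (real l + 1) / 2" "count_from ?G ?u = count_from G c + l"
    "length_from ?G ?u = length_from G c + real l * count_from G c + real l * (real l - 1) / 2"
    "count_paths ?G = count_paths G + 2 * real l * count_from G c + real l ^ 2"
    "length_paths ?G = length_paths G + 2 * real l * length_from G c + count_from G c * real l * (real l + 1) + (real l - 1) * real l * (real l + 1) / 3"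
    by (insert Suc.IH, (elim conjE, assumption)+)
  show ?case unfolding leg.simps tip
  proof (intro conjI impI)
    show "connected_graph (pend ?G ?u ?w)" by (rule connected_pend[OF con])
    show "tree (pend ?G ?u ?w)" if "tree G" using tree_pend Suc.IH that by simp
    show "verts (pend ?G ?u ?w) = {..<N + Suc l}" unfolding verts_pend V by (simp add: lessThan_Suc)
    show "count_from (pend ?G ?u ?w) c = count_from G c + real (Suc l)" using count_from_pend_old[OF cV b(1)] e by simp
    show "length_from (pend ?G ?u ?w) c = length_from G c + real (Suc l) * (real (Suc l) + 1) / 2"
      using length_from_pend_old[OF cV b(1)] b(2) e by (simp add: field_simps)
    show "card (plists_between (pend ?G ?u ?w) c ?w) = 1" using between_pend_new_sums[OF cV] b by simp
    show "path_sum (plists_between (pend ?G ?u ?w) c ?w) = Suc l" using between_pend_new_sums[OF cV] b by simp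
    show "count_from (pend ?G ?u ?w) ?w = count_from G c + real (Suc l)" using count_from_pend_new e by simp
    show "length_from (pend ?G ?u ?w) ?w = length_from G c + real (Suc l) * count_from G c + real (Suc l) * (real (Suc l) - 1) / 2"
      using length_from_pend_new e by (simp add: field_simps)
    show "count_paths (pend ?G ?u ?w) = count_paths G + 2 * real (Suc l) * count_from G c + (real (Suc l))\<^sup>2"
      using count_paths_pend e by (simp add: field_simps power2_eq_square)
    show "length_paths (pend ?G ?u ?w) = length_paths G + 2 * real (Suc l) * length_from G c + count_from G c * real (Suc l) * (real (Suc l) + 1) +
        (real (Suc l) - 1) * real (Suc l) * (real (Suc l) + 1) / 3"
      using length_paths_pend e by (simp add: field_simps)
  qed
qed

text \<open>Each leaf prolongs the lists of \<open>G\<close> from \<open>c\<close> by one edge; the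
  last summand accounts for ordered pairs of new leaves, at distance 2.\<close>

lemma brush_invariant:
  assumes G: "connected_graph G" "verts G = {..<N}" and c: "c < N"
  shows "connected_graph (brush G c N m) \<and> (tree G \<longrightarrow> tree (brush G c N m)) \<and> verts (brush G c N m) = {..<N + m} \<and>
    count_from (brush G c N m) c = count_from G c + m \<and> length_from (brush G c N m) c = length_from G c + m \<and>
    length_paths (brush G c N m) = length_paths G + 2 * real m * (length_from G c + count_from G c) + 2 * real m * (real m - 1)"
proof (induction m)
  case 0
  then show ?case using G by simp
next
  case (Suc m)
  let ?G = "brush G c N m" and ?w = "N + m"
  have V: "verts ?G = {..<N + m}" and con: "connected_graph ?G"
    by (insert Suc.IH, (elim conjE, assumption)+)
  have cV: "c \<in> verts ?G" unfolding V using c by simp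
  interpret pendant ?G c ?w
    using V con cV by unfold_locales (simp_all add: connected_simple)
  have self: "plists_between ?G c c = {[c]}" by (rule plists_between_self[OF cV])
  then have b: "card (plists_between ?G c c) = 1" "path_sum (plists_between ?G c c) = 0"
    by (simp_all add: path_sum_def)
  have e: "count_from ?G c = count_from G c + m" "length_from ?G c = length_from G c + m"
    "length_paths ?G = length_paths G + 2 * real m * (length_from G c + count_from G c) + 2 * real m * (real m - 1)"
    by (insert Suc.IH, (elim conjE, assumption)+)
  show ?case unfolding brush.simps
  proof (intro conjI impI)
    show "connected_graph (pend ?G c ?w)" by (rule connected_pend[OF con])
    show "tree (pend ?G c ?w)" if "tree G" using tree_pend Suc.IH that by simp
    show "verts (pend ?G c ?w) = {..<N + Suc m}" unfolding verts_pend V by (simp add: lessThan_Suc)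
    show "count_from (pend ?G c ?w) c = count_from G c + real (Suc m)" using count_from_pend_old[OF cV b(1)] e by simp
    show "length_from (pend ?G c ?w) c = length_from G c + real (Suc m)" using length_from_pend_old[OF cV b(1)] b(2) e by simp
    show "length_paths (pend ?G c ?w) = length_paths G + 2 * real (Suc m) * (length_from G c + count_from G c) + 2 * real (Suc m) * (real (Suc m) - 1)"
      using length_paths_pend e by (simp add: field_simps)
  qed
qed

lemmas leg_connected = leg_invariant[THEN conjunct1]
  and leg_tree = leg_invariant[THEN conjunct2, THEN conjunct1, rule_format]
  and leg_verts = leg_invariant[THEN conjunct2, THEN conjunct2, THEN conjunct1]
  and brush_connected = brush_invariant[THEN conjunct1]
  and brush_tree = brush_invariant[THEN conjunct2, THEN conjunct1, rule_format]
  and brush_verts = brush_invariant[THEN conjunct2, THEN conjunct2, THEN conjunct1]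

definition dot :: "nat graph" where "dot = Graph {0} {}"

lemma dot: "tree dot" "connected_graph dot" "verts dot = {..<1}" "edges dot = {}"
  "count_from dot 0 = 1" "length_from dot 0 = 0" "count_paths dot = 1" "length_paths dot = 0"
proof -
  show t: "tree dot" unfolding dot_def by (rule tree_single)
  then show "connected_graph dot" by (simp add: tree_def)
  show "verts dot = {..<1}" "edges dot = {}" by (auto simp: dot_def)
  have "plists_from dot 0 = {[0]}" unfolding plists_from_def dot_def by auto
  then show "count_from dot 0 = 1" "length_from dot 0 = 0" by (simp_all add: count_from_def length_from_def path_sum_def)
  show "count_paths dot = 1" "length_paths dot = 0" by (simp_all add: count_paths_def length_paths_def dot_def path_sum_def)
qed

subsection \<open>Two trees with equal average path length\<close>

lemma (in pendant) degree_pend: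
  "vertex_degree (pend G u w) x = vertex_degree G x + (if x = u \<or> x = w then 1 else 0)"
proof -
  have uwE: "{u, w} \<notin> edges G" using w_notin_edge by blast
  have "{e \<in> edges (pend G u w). x \<in> e} =
    (if x = u \<or> x = w then insert {u, w} {e \<in> edges G. x \<in> e} else {e \<in> edges G. x \<in> e})" by auto
  moreover have "finite {e \<in> edges G. x \<in> e}" using finite_edges[OF simple] by simp
  ultimately show ?thesis using uwE by (simp add: vertex_degree_def)
qed

lemma degree_leg:
  assumes G: "connected_graph G" "verts G = {..<N}" and c: "c < N"
  shows "vertex_degree (leg G c N l) x = vertex_degree G x +
    (if x = c \<and> l > 0 then 1 else 0) + (if N \<le> x \<and> x < N + l then if x = N + l - 1 then 1 else 2 else 0)"
proof (induction l)
  case (Suc l)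
  have u: "tip c N l \<in> verts (leg G c N l)" unfolding leg_verts[OF G c] using c by (simp add: tip_def)
  interpret pendant "leg G c N l" "tip c N l" "N + l"
    using u leg_verts[OF G c] leg_connected[OF G c]
    by unfold_locales (simp_all add: connected_simple)
  \<comment> \<open>Numbers from \<open>N\<close> on are not vertices of \<open>G\<close> and have
    degree 0 there, so one additive formula covers old and new vertices.\<close>
  have iso: "vertex_degree G y = 0" if "y \<ge> N" for y
  proof -
    have "{e \<in> edges G. y \<in> e} = {}" using edge_subset[OF connected_simple[OF G(1)]] G(2) that by fastforce
    then show ?thesis unfolding vertex_degree_def by (simp only: card.empty)
  qed
  show ?case unfolding leg.simps degree_pend Suc.IH using c iso[of x]
    by (auto simp: tip_def)
qed simp

lemma degree_iso:
  assumes G: "simple_graph G"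
    and f: "bij_betw f (verts G) (verts H)" and e: "edges H = (\<lambda>e. f ` e) ` edges G" and v: "v \<in> verts G"
  shows "vertex_degree H (f v) = vertex_degree G v"
proof -
  have inj: "inj_on f (verts G)" using f by (simp add: bij_betw_def)
  have "{d \<in> edges H. f v \<in> d} = (\<lambda>e. f ` e) ` {d \<in> edges G. v \<in> d}"
  proof -
    have "f v \<in> f ` d \<longleftrightarrow> v \<in> d" if "d \<in> edges G" for d
      using inj_on_image_mem_iff[OF inj v edge_subset[OF G that]] .
    then show ?thesis unfolding e by auto
  qed
  moreover have "inj_on (\<lambda>e. f ` e) {d \<in> edges G. v \<in> d}"
    using edge_subset[OF G] by (intro inj_on_subset[OF inj_on_image_Pow[OF inj]]) auto
  ultimately show ?thesis by (simp add: vertex_degree_def card_image)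
qed

text \<open>Both spiders have order 9 and total length 208, and for trees these two numbers
  determine the average. They are told apart by a vertex of degree 4 against a maximum degree of at
  most 3.\<close>

lemma ex_equal_avp:
  "\<exists>(T1 :: nat graph) (T2 :: nat graph). tree T1 \<and> tree T2 \<and> \<not> graph_iso T1 T2 \<and>
     graph_order T1 = graph_order T2 \<and> avp T1 = avp T2"
proof -
  define A1 where "A1 = leg dot 0 1 5"
  define B1 where "B1 = leg A1 0 6 1"
  define C1 where "C1 = leg B1 0 7 1"
  define T1 where "T1 = leg C1 0 8 1"
  define A2 where "A2 = leg dot 0 1 4"
  define B2 where "B2 = leg A2 0 5 2"
  define T2 where "T2 = leg B2 0 7 2"
  note A1 = leg_invariant[OF dot(2,3), of 0 5, folded A1_def, simplified dot, simplified]
  then have A1V: "connected_graph A1" "verts A1 = {..<6}" "(0::nat) < 6" by simp_all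
  note B1 = leg_invariant[OF A1V, of 1, folded B1_def, simplified A1, simplified]
  then have B1V: "connected_graph B1" "verts B1 = {..<7}" "(0::nat) < 7" by simp_all
  note C1 = leg_invariant[OF B1V, of 1, folded C1_def, simplified B1, simplified]
  then have C1V: "connected_graph C1" "verts C1 = {..<8}" "(0::nat) < 8" by simp_all
  note T1 = leg_invariant[OF C1V, of 1, folded T1_def, simplified C1, simplified]
  note A2 = leg_invariant[OF dot(2,3), of 0 4, folded A2_def, simplified dot, simplified]
  then have A2V: "connected_graph A2" "verts A2 = {..<5}" "(0::nat) < 5" by simp_all
  note B2 = leg_invariant[OF A2V, of 2, folded B2_def, simplified A2, simplified]
  then have B2V: "connected_graph B2" "verts B2 = {..<7}" "(0::nat) < 7" by simp_all
  note T2 = leg_invariant[OF B2V, of 2, folded T2_def, simplified B2, simplified]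
  have t: "tree T1" "tree T2" using T1 T2 by simp_all
  have V: "verts T1 = {..<9}" "verts T2 = {..<9}" using T1 T2 by simp_all
  then have o: "graph_order T1 = 9" "graph_order T2 = 9" by (simp_all add: graph_order_def)
  have "length_paths T1 = 208" "length_paths T2 = 208" using T1 T2 by simp_all
  then have "avp T1 = avp T2" using o t by (simp add: avp_tree length_paths_def)
  moreover have "\<not> graph_iso T1 T2"
  proof
    assume "graph_iso T1 T2"
    then obtain f where f: "bij_betw f (verts T1) (verts T2)" "edges T2 = (\<lambda>e. f ` e) ` edges T1"
      by (auto simp: graph_iso_def)
    have d0: "vertex_degree dot x = 0" for x by (simp add: vertex_degree_def dot)
    have "vertex_degree T1 0 = 4"
      using degree_leg[OF C1V, of 1 0, folded T1_def] degree_leg[OF B1V, of 1 0, folded C1_def]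
        degree_leg[OF A1V, of 1 0, folded B1_def] degree_leg[OF dot(2,3), of 0 5 0, folded A1_def]
      by (simp add: d0)
    moreover have le3: "vertex_degree T2 x \<le> 3" for x
      using degree_leg[OF B2V, of 2 x, folded T2_def] degree_leg[OF A2V, of 2 x, folded B2_def]
        degree_leg[OF dot(2,3), of 0 4 x, folded A2_def]
      by (simp add: d0)
    moreover have "vertex_degree T2 (f 0) = vertex_degree T1 0"
      using degree_iso[OF tree_simple[OF t(1)] f, of 0] V by simp
    ultimately show False using le3[of "f 0"] by simp
  qed
  ultimately show ?thesis using t o by (intro exI[of _ T1] exI[of _ T2]) simp
qed

subsection \<open>Deleting or contracting an edge can increase the average\<close>

lemma simple_graph_image:
  assumes G: "simple_graph G" and f: "bij_betw f (verts G) (verts H)" "edges H = (\<lambda>e. f ` e) ` edges G"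
  shows "simple_graph H"
  unfolding simple_graph_def
proof (intro conjI ballI)
  have inj: "inj_on f (verts G)" and im: "verts H = f ` verts G" using f(1) by (simp_all add: bij_betw_def)
  show "finite (verts H)" unfolding im using G by (simp add: simple_graph_def)
  fix e assume "e \<in> edges H"
  then obtain d where d: "d \<in> edges G" "e = f ` d" using f(2) by blast
  have dV: "d \<subseteq> verts G" by (rule edge_subset[OF G d(1)])
  then show "e \<subseteq> verts H" unfolding d(2) im by (rule image_mono)
  have "card e = card d" unfolding d(2) by (rule card_image[OF inj_on_subset[OF inj dV]])
  then show "card e = 2" using G d(1) by (simp add: simple_graph_def)
qed

text \<open>Contracting the edge at a pendant vertex undoes its attachment, up to the renaming
  \<open>h\<close> of \<open>u\<close> to \<open>{u, w}\<close> and of every other vertex to its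
  singleton.\<close>

lemma (in pendant) avp_contract_pend: "avp (contract_edge (pend G u w) {u, w}) = avp G"
proof -
  define h where "h = (\<lambda>x. if x = u then {u, w} else {x})"
  define H where "H = contract_edge (pend G u w) {u, w}"
  define V where "V = insert {u, w} ((\<lambda>x. {x}) ` (insert w (verts G) - {u, w}))"
  have V: "V = h ` verts G"
  proof -
    have "insert w (verts G) - {u, w} = verts G - {u}" using w by auto
    moreover have "h ` verts G = insert (h u) (h ` (verts G - {u}))" using u by blast
    moreover have "h ` (verts G - {u}) = (\<lambda>x. {x}) ` (verts G - {u})"
      by (rule image_cong) (simp_all add: h_def)
    ultimately show ?thesis by (simp add: V_def h_def)
  qed
  have HV: "verts H = V"
    and HE: "edges H = {{A, B} | A B. A \<in> V \<and> B \<in> V \<and> A \<noteq> B \<and> (\<exists>a\<in>A. \<exists>b\<in>B. {a, b} \<in> insert {u, w} (edges G))}"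
    unfolding H_def contract_edge_def Let_def V_def by simp_all
  have h_mem: "x \<in> h x" for x by (simp add: h_def)
  have h_only: "a = x" if "x \<in> verts G" "a \<in> h x" "a \<noteq> w" for a x
    using that by (simp add: h_def split: if_splits)
  have h_u: "x = u" if "x \<in> verts G" "a \<in> h x" "a \<in> {u, w}" for a x
    using that w by (auto simp: h_def split: if_splits)
  have inj: "inj_on h (verts G)"
  proof (rule inj_onI)
    fix x y assume xy: "x \<in> verts G" "y \<in> verts G" "h x = h y"
    have "x \<in> h y" using h_mem[of x] xy(3) by simp
    moreover have "x \<noteq> w" using xy w by auto
    ultimately show "x = y" using h_only[OF xy(2)] by blast
  qed
  have bij: "bij_betw h (verts G) (verts H)" unfolding HV V using inj by (simp add: bij_betw_def)
  have E: "edges H = (\<lambda>e. h ` e) ` edges G"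
  proof (intro set_eqI iffI)
    fix e assume "e \<in> edges H"
    then obtain A B a b where e: "e = {A, B}" "A \<in> V" "B \<in> V" "A \<noteq> B" "a \<in> A" "b \<in> B"
      "{a, b} \<in> insert {u, w} (edges G)" unfolding HE by blast
    obtain x y where xy: "x \<in> verts G" "A = h x" "y \<in> verts G" "B = h y" using e(2,3) unfolding V by blast
    have "{a, b} \<noteq> {u, w}"
    proof
      assume "{a, b} = {u, w}"
      then have "a \<in> {u, w}" "b \<in> {u, w}" by blast+
      then have "x = u" "y = u" using h_u[OF xy(1)] h_u[OF xy(3)] e(5,6) xy by blast+
      then show False using e(4) xy by simp
    qed
    then have ab: "{a, b} \<in> edges G" using e(7) by blast
    then have "a \<noteq> w" "b \<noteq> w" using w_notin_edge[of "{a, b}"] by auto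
    then have "a = x" "b = y" using h_only[OF xy(1)] h_only[OF xy(3)] e(5,6) xy by blast+
    then have "e = h ` {a, b}" using e(1) xy by simp
    then show "e \<in> (\<lambda>e. h ` e) ` edges G" using ab by blast
  next
    fix e assume "e \<in> (\<lambda>e. h ` e) ` edges G"
    then obtain d where d: "d \<in> edges G" "e = h ` d" by blast
    have "card d = 2" "d \<subseteq> verts G" using simple d(1) by (simp_all add: simple_graph_def)
    then obtain x y where xy: "d = {x, y}" "x \<noteq> y" "x \<in> verts G" "y \<in> verts G" by (auto simp: card_2_iff)
    have "h x \<noteq> h y" using inj xy by (auto dest: inj_onD)
    moreover have "h x \<in> V" "h y \<in> V" unfolding V using xy by simp_all
    moreover have "e = {h x, h y}" "{x, y} \<in> insert {u, w} (edges G)" using d xy by simp_all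
    ultimately show "e \<in> edges H" unfolding HE using h_mem[of x] h_mem[of y] by blast
  qed
  have "graph_iso G H" unfolding graph_iso_def using bij E by blast
  then show ?thesis
    using avp_iso[OF simple simple_graph_image[OF simple bij E]] by (simp add: H_def)
qed

text \<open>On a long path of n vertices the distances from the middle average about n/4, against
  n/3 over all pairs, so a leaf at the middle lowers the average and contracting its edge restores
  it. Two legs of length 8 are long enough: 1810/342 is below 1632/306.\<close>

lemma ex_contract_increase:
  "\<exists>(T :: nat graph). \<exists>f\<in>edges T. tree T \<and> avp (contract_edge T f) > avp T"
proof -
  define A where "A = leg dot 0 1 8"
  define B where "B = leg A 0 9 8"
  note A = leg_invariant[OF dot(2,3), of 0 8, folded A_def, simplified dot, simplified]
  then have AV: "connected_graph A" "verts A = {..<9}" "(0::nat) < 9" by simp_all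
  note B = leg_invariant[OF AV, of 8, folded B_def, simplified A, simplified]
  then have BT: "tree B" and BV: "verts B = {..<17}" and BW: "length_paths B = 1632" "length_from B 0 = 72" "count_from B 0 = 17" by simp_all
  interpret pendant B 0 17 using BT BV by unfold_locales (simp_all add: tree_simple)
  have T: "tree (pend B 0 17)" by (rule tree_pend[OF BT])
  have oB: "graph_order B = 17" using BV by (simp add: graph_order_def)
  have "avp B = 1632 / (17 * 18)" using avp_tree[OF BT] oB BW by (simp add: length_paths_def)
  moreover have "avp (pend B 0 17) = 1810 / (18 * 19)"
    using avp_tree[OF T] order_pend oB BW length_paths_pend by (simp add: length_paths_def)
  ultimately have "avp (pend B 0 17) < avp (contract_edge (pend B 0 17) {0, 17})"
    by (simp add: avp_contract_pend)
  then show ?thesis using T by (intro exI[of _ "pend B 0 17"] bexI[of _ "{0, 17}"]) simp_all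
qed

section \<open>Deletion in a triangle with two legs\<close>

lemma delete_pend: "e \<noteq> {u, w} \<Longrightarrow> delete_edge (pend G u w) e = pend (delete_edge G e) u w"
  by (rule graph_eqI) auto

text \<open>Deleting an old edge commutes with attaching a leg, so the deletion can take place in
  the bare triangle.\<close>

lemma delete_leg:
  assumes "e \<subseteq> {..<N}"
  shows "delete_edge (leg G c N l) e = leg (delete_edge G e) c N l"
proof (induction l)
  case (Suc l)
  have "N + l \<notin> e" using assms by auto
  then have "e \<noteq> {tip c N l, N + l}" by auto
  then show ?case using Suc by (simp add: delete_pend)
qed simp

lemma plists_from_iso:
  assumes "simple_graph G" "simple_graph H"
    "bij_betw f (verts G) (verts H)" "edges H = (\<lambda>d. f ` d) ` edges G" and v: "v \<in> verts G"
  shows "plists_from H (f v) = map f ` plists_from G v"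
proof -
  have inj: "inj_on f (verts G)" using assms(3) by (simp add: bij_betw_def)
  have "hd (map f xs) = f v \<longleftrightarrow> hd xs = v" if "xs \<in> plists G" for xs
  proof -
    have "xs \<noteq> []" "set xs \<subseteq> verts G" using that by (simp_all add: plists_alt)
    then have "hd xs \<in> verts G" by auto
    then show ?thesis using \<open>xs \<noteq> []\<close> inj_onD[OF inj, of "hd xs" v] v by (auto simp: hd_map)
  qed
  then show ?thesis unfolding plists_from_def plists_iso[OF assms(1-4)] by blast
qed

lemma complete_graph_from:
  assumes "x < n" "y < n"
  shows "count_from (complete_graph n) x = count_from (complete_graph n) y" "length_from (complete_graph n) x = length_from (complete_graph n) y"
proof -
  define f where "f = (\<lambda>z. if z = x then y else if z = y then x else z)"
  note f = complete_graph_transpose[OF assms, folded f_def]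
  have eq: "plists_from (complete_graph n) y = map f ` plists_from (complete_graph n) x"
    using plists_from_iso[OF simple_complete_graph simple_complete_graph f, of x] assms by (simp add: f_def)
  have inj: "inj_on (map f) (plists_from (complete_graph n) x)"
    by (rule inj_on_subset[OF inj_map_plists[OF f(1)]]) (auto simp: plists_from_def)
  show "count_from (complete_graph n) x = count_from (complete_graph n) y"
    unfolding count_from_def eq using inj by (simp add: card_image)
  show "length_from (complete_graph n) x = length_from (complete_graph n) y"
    unfolding length_from_def eq path_sum_def using inj by (simp add: sum.reindex)
qed

lemma sum_plists_from:
  assumes G: "simple_graph G"
  shows "(\<Sum>x\<in>verts G. count_from G x) = count_paths G" "(\<Sum>x\<in>verts G. length_from G x) = length_paths G"
proof -
  have fin: "finite (verts G)" "finite (plists G)" using G by (simp_all add: simple_graph_def)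
  have im: "hd ` plists G \<subseteq> verts G"
  proof (rule image_subsetI)
    fix xs assume "xs \<in> plists G"
    then have "xs \<noteq> []" "set xs \<subseteq> verts G" by (simp_all add: plists_alt)
    then show "hd xs \<in> verts G" by auto
  qed
  have "(\<Sum>x\<in>verts G. \<Sum>xs\<in>plists_from G x. g xs) = (\<Sum>xs\<in>plists G. g xs)" for g :: "'a list \<Rightarrow> nat"
    unfolding plists_from_def by (rule sum.group[OF fin(2,1) im])
  from this[of "\<lambda>_. 1"] this[of "\<lambda>xs. length xs - 1"]
  show "(\<Sum>x\<in>verts G. count_from G x) = count_paths G" "(\<Sum>x\<in>verts G. length_from G x) = length_paths G"
    unfolding count_from_def length_from_def count_paths_def length_paths_def path_sum_def of_nat_sum[symmetric] by simp_all
qed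

lemma complete_graph_sums:
  assumes "n \<ge> 1"
  shows "count_paths (complete_graph n) = n * count_from (complete_graph n) 0" "length_paths (complete_graph n) = n * length_from (complete_graph n) 0"
proof -
  have c: "count_from (complete_graph n) x = count_from (complete_graph n) 0" "length_from (complete_graph n) x = length_from (complete_graph n) 0"
    if "x \<in> {..<n}" for x
    using complete_graph_from[of x n 0] that assms by simp_all
  have "count_paths (complete_graph n) = (\<Sum>x<n. count_from (complete_graph n) x)"
    using sum_plists_from(1)[OF simple_complete_graph, of n] by (simp only: verts_complete_graph)
  also have "\<dots> = (\<Sum>x<n. count_from (complete_graph n) 0)" by (rule sum.cong[OF refl c(1)])
  finally show "count_paths (complete_graph n) = n * count_from (complete_graph n) 0" by (simp only: sum_constant card_lessThan)
  have "length_paths (complete_graph n) = (\<Sum>x<n. length_from (complete_graph n) x)"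
    using sum_plists_from(2)[OF simple_complete_graph, of n] by (simp only: verts_complete_graph)
  also have "\<dots> = (\<Sum>x<n. length_from (complete_graph n) 0)" by (rule sum.cong[OF refl c(2)])
  finally show "length_paths (complete_graph n) = n * length_from (complete_graph n) 0" by (simp only: sum_constant card_lessThan)
qed

text \<open>With \<open>{1, 2}\<close> present, five instead of three lists of the triangle start at
  vertex 0. The extra paths into a leg reach only from that leg to the middle and are slightly
  shorter than average once the legs are long. For legs of length 14 the deletion removes 118 lists
  of total length 1074, and 10154/1110 becomes the larger 9080/992.\<close>

lemma ex_delete_increase:
  "\<exists>(G :: nat graph). \<exists>e\<in>edges G. connected_graph G \<and>
     connected_graph (delete_edge G e) \<and> avp (delete_edge G e) > avp G"
proof -
  define K where "K = complete_graph 3"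
  define S where "S = star_graph 3"
  have KV: "connected_graph K" "verts K = {..<3}" "(0::nat) < 3"
    using connected_complete_graph by (simp_all add: K_def)
  have len: "card (plists_len K 0) = 3" "card (plists_len K 1) = 6" "card (plists_len K 2) = 6"
    using card_plists_len_0[of K] card_plists_len_complete_Suc[of 3 0] card_plists_len_complete_Suc[of 3 1]
    by (simp_all add: K_def numeral_2_eq_2)
  have "{..<3} = {0, 1, 2::nat}" by auto
  then have PW: "count_paths K = 15" "length_paths K = 18"
    using plists_by_length[OF connected_simple[OF KV(1)]] len by (simp_all add: count_paths_def length_paths_def K_def)
  have KQ: "count_from K 0 = 5" "length_from K 0 = 6"
    using complete_graph_sums[of 3] PW by (simp_all add: K_def)
  have S3: "tree S" "length_from S 0 = 2" "length_paths S = 8"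
    using star_graph_sums[of 2] by (simp_all add: S_def length_from_def length_paths_def numeral_3_eq_3)
  then have SV: "connected_graph S" "verts S = {..<3}" by (simp_all add: tree_def S_def)
  have SQ: "count_from S 0 = 3" "count_paths S = 9"
    using tree_card_from[OF S3(1), of 0] tree_card_plists[OF S3(1)] by (simp_all add: count_from_def count_paths_def S_def)
  have e12: "{1, 2} \<in> edges K" by (simp add: K_def complete_graph_edge)
  have KS: "delete_edge K {1, 2} = S"
  proof (rule graph_eqI)
    show "verts (delete_edge K {1, 2}) = verts S" by (simp add: K_def S_def)
    have K3: "edges K = {{0, 1}, {0, 2}, {1, 2}}"
    proof (intro set_eqI iffI)
      fix e assume "e \<in> edges K"
      then obtain i j where e: "e = {i, j}" "i < 3" "j < 3" "i \<noteq> j" by (auto simp: K_def complete_graph_def)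
      then have "i = 0 \<or> i = 1 \<or> i = 2" "j = 0 \<or> j = 1 \<or> j = 2" by auto
      then show "e \<in> {{0, 1}, {0, 2}, {1, 2}}" using e by auto
    next
      fix e assume "e \<in> {{0, 1}, {0, 2}, {1, 2::nat}}"
      then show "e \<in> edges K" unfolding K_def by (auto intro!: complete_graph_edge)
    qed
    have S': "edges S = {{0, 1}, {0, 2}}"
    proof -
      have "0 < i \<and> i < (3::nat) \<longleftrightarrow> i = 1 \<or> i = 2" for i by auto
      then show ?thesis by (auto simp: S_def star_graph_def)
    qed
    have "{0, 1} \<noteq> {1, 2::nat}" "{0, 2} \<noteq> {1, 2::nat}" by (simp_all add: doubleton_eq_iff)
    then show "edges (delete_edge K {1, 2}) = edges S"
      unfolding delete_edge_sel(2) K3 S' by (simp add: insert_Diff_if)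
  qed
  define A where "A = leg K 0 3 14"
  define G where "G = leg A 0 17 14"
  define B where "B = leg S 0 3 14"
  define H where "H = leg B 0 17 14"
  note A = leg_invariant[OF KV, of 14, folded A_def, simplified PW KQ, simplified]
  then have AV: "connected_graph A" "verts A = {..<17}" "(0::nat) < 17" by simp_all
  note G = leg_invariant[OF AV, of 14, folded G_def, simplified A, simplified]
  note B = leg_invariant[OF SV KV(3), of 14, folded B_def, simplified S3 SQ, simplified]
  then have BV: "connected_graph B" "verts B = {..<17}" by simp_all
  note H = leg_invariant[OF BV AV(3), of 14, folded H_def, simplified B, simplified]
  have GH: "delete_edge G {1, 2} = H"
    unfolding G_def H_def A_def B_def using KS by (simp add: delete_leg)
  have con: "connected_graph G" "connected_graph H" using G H by simp_all
  have o: "graph_order G = 31" "graph_order H = 31" using G H by (simp_all add: graph_order_def)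
  have "count_paths G = 1079" "length_paths G = 10154" "count_paths H = 961" "length_paths H = 9080" using G H by simp_all
  then have "avp G < avp H" using o avp_P_W[OF connected_simple[OF con(1)]] avp_P_W[OF connected_simple[OF con(2)]]
    by simp
  moreover have "{1, 2} \<in> edges G"
  proof -
    have "edges K \<subseteq> edges (leg K 0 3 l)" for l by (induction l) auto
    moreover have "edges A \<subseteq> edges (leg A 0 17 l)" for l by (induction l) auto
    ultimately show ?thesis using e12 unfolding G_def A_def by blast
  qed
  ultimately show ?thesis using con GH by (intro exI[of _ G] bexI[of _ "{1, 2}"]) simp_all
qed

subsection \<open>Density of the ratios\<close>

abbreviation tree_ratios :: "real set" where
  "tree_ratios \<equiv> {avp_at T v / avp T | (T :: nat graph) v. tree T \<and> graph_order T \<ge> 2 \<and> v \<in> verts T}"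

abbreviation graph_ratios :: "real set" where
  "graph_ratios \<equiv>
     {avp_at G v / avp G | (G :: nat graph) v. connected_graph G \<and> graph_order G \<ge> 2 \<and> v \<in> verts G}"

lemma in_closure_limI:
  fixes a :: real
  assumes "f \<longlonglongrightarrow> a" "\<forall>\<^sub>F k in sequentially. f k \<in> S"
  shows "a \<in> closure S"
  using assms by (rule Lim_in_closed_set[OF closed_closure, rotated 2, where F = sequentially, simplified,
      OF _ eventually_mono]) (use closure_subset in auto)

text \<open>A star with \<open>M\<close> leaves and two further legs of lengths \<open>k\<close> and \<open>l\<close> at its centre; the vertex is
  the end of the leg of length \<open>l\<close>. The long leg has length of order \<open>sqrt M\<close>, so that it contributes to
  the average path length a constant that can be tuned.\<close>

lemma spider_ratio:
  fixes k M l :: nat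
  assumes l: "l \<ge> 1"
  defines "r \<equiv> (real k * (real k + 1) / 2 + M) + l * (1 + real k + M) + real l * (real l - 1) / 2"
    and "q \<equiv> 1 + real k + M + l"
    and "w \<equiv> (real k * (real k + 1) + (real k - 1) * real k * (real k + 1) / 3)
      + 2 * real M * (real k * (real k + 1) / 2 + (1 + real k)) + 2 * real M * (real M - 1)
      + 2 * real l * (real k * (real k + 1) / 2 + M) + (1 + real k + M) * real l * (real l + 1)
      + (real l - 1) * real l * (real l + 1) / 3"
  shows "\<exists>(T :: nat graph) v. tree T \<and> graph_order T \<ge> 2 \<and> v \<in> verts T \<and>
    avp_at T v / avp T = (r / q) / (w / (q * (q + 1)))"
proof -
  define A where "A = leg dot 0 1 k"
  define B where "B = brush A 0 (1 + k) M"
  define C where "C = leg B 0 (1 + k + M) l"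
  note A = leg_invariant[OF dot(2,3), of 0 k, folded A_def, simplified dot]
  then have AV: "connected_graph A" "verts A = {..<1 + k}" "0 < 1 + k" by simp_all
  note B = brush_invariant[OF AV, of M, folded B_def]
  then have BV: "connected_graph B" "verts B = {..<1 + k + M}" "0 < 1 + k + M" by simp_all
  note C = leg_invariant[OF BV, of l, folded C_def]
  have T: "tree C" using A B C dot by simp
  have vA: "count_from A 0 = 1 + real k" "length_from A 0 = real k * (real k + 1) / 2"
    "length_paths A = real k * (real k + 1) + (real k - 1) * real k * (real k + 1) / 3"
    using A by simp_all
  have vB: "count_from B 0 = 1 + real k + M" "length_from B 0 = real k * (real k + 1) / 2 + M"
    "length_paths B = (real k * (real k + 1) + (real k - 1) * real k * (real k + 1) / 3)
      + 2 * real M * (real k * (real k + 1) / 2 + (1 + real k)) + 2 * real M * (real M - 1)"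
    by (insert B[unfolded vA], (elim conjE, assumption)+)
  \<comment> \<open>Peeling off the last edge of the nonempty leg shows its end as a pendant vertex,
    so that its local average is the mean over the lists starting there.\<close>
  obtain m where m: "l = Suc m" using l by (cases l) auto
  define v where "v = 1 + k + M + m"
  have tip: "tip 0 (1 + k + M) l = v" by (simp add: tip_def m v_def)
  have V: "verts C = {..<1 + k + M + l}" using C by simp
  then have o: "real (graph_order C) = q" by (simp add: graph_order_def q_def)
  have "tip 0 (1 + k + M) m \<in> verts (leg B 0 (1 + k + M) m)"
    unfolding leg_verts[OF BV] by (simp add: tip_def)
  then interpret pendant "leg B 0 (1 + k + M) m" "tip 0 (1 + k + M) m" v
    using leg_connected[OF BV, of m] leg_verts[OF BV, of m]
    by unfold_locales (simp_all add: connected_simple v_def)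
  have Cm: "C = pend (leg B 0 (1 + k + M) m) (tip 0 (1 + k + M) m) v"
    by (simp add: C_def m v_def)
  have "avp_at C v = length_from C v / count_from C v" unfolding Cm by (rule avp_at_pend_ratio)
  moreover have "count_from C v = q" "length_from C v = r"
    using A B C unfolding tip q_def r_def by simp_all
  moreover have "length_paths C = w" using C unfolding vB w_def by (elim conjE)
  moreover have "avp C = length_paths C / (q * (q + 1))"
    using avp_tree[OF T] o by (simp add: length_paths_def add.commute)
  ultimately have "avp_at C v / avp C = (r / q) / (w / (q * (q + 1)))" by simp
  moreover have "v \<in> verts C" "graph_order C \<ge> 2" using V l by (simp_all add: v_def m graph_order_def)
  ultimately show ?thesis using T by blast
qed

text \<open>With \<open>M\<close> close to k^2 / y the leg of length \<open>k\<close> holds a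
  vanishing share of the vertices, yet its distances sum to about k^2 / 2 from each leaf. The mean
  distance thus tends to 2 + y overall and to l + 1 + y / 2 from the end of the short leg.\<close>

lemma spider_limit:
  fixes y :: real and l :: nat
  assumes y: "y > 0" and l: "l \<ge> 1"
  shows "(real l + 1 + y / 2) / (2 + y) \<in>
    closure tree_ratios"
proof -
  \<comment> \<open>Everything is normalised by powers of \<open>k\<close>: \<open>m k\<close> is M
    / k^2, \<open>u k\<close> is 1 / k, and \<open>r\<close>, \<open>q\<close>, \<open>w\<close> are
    the quantities of \<open>spider_ratio\<close> divided by k^2, k^2 and k^4. They are polynomials
    in \<open>u k\<close> and \<open>m k\<close>, so their limits are immediate.\<close>
  define m where "m k = real (nat \<lfloor>real k ^ 2 / y\<rfloor>) / real k ^ 2" for k :: nat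
  define u where "u k = 1 / real k" for k :: nat
  define L where "L = real l"
  define r where "r k = (1 + u k) / 2 + m k + L * (u k ^ 2 + u k + m k) + L * (L - 1) / 2 * u k ^ 2" for k
  define q where "q k = u k ^ 2 + u k + m k + L * u k ^ 2" for k
  define w where "w k = (u k ^ 2 * (1 + u k) + (1 - u k) * (1 + u k) * u k / 3)
      + 2 * m k * ((1 + u k) / 2 + (u k ^ 2 + u k)) + 2 * m k * (m k - u k ^ 2)
      + 2 * L * ((1 + u k) / 2 + m k) * u k ^ 2 + (u k ^ 2 + u k + m k) * L * (L + 1) * u k ^ 2
      + (L - 1) * L * (L + 1) / 3 * u k ^ 4" for k
  define g where "g k = (r k / q k) / (w k / (q k * (q k + u k ^ 2)))" for k
  have scale: "(a * K / (b * K)) / ((c * (K * K)) / ((b * K) * (d * K))) = (a / b) / (c / (b * d))"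
    if "K \<noteq> 0" for a b c d K :: real
    using that by simp
  have u: "u \<longlonglongrightarrow> 0" unfolding u_def by (rule lim_1_over_n)
  have m: "m \<longlonglongrightarrow> 1 / y"
  proof (rule tendsto_sandwich)
    show "\<forall>\<^sub>F k in sequentially. 1 / y - u k ^ 2 \<le> m k"
      using eventually_gt_at_top[of 0]
    proof eventually_elim
      case (elim k)
      have "real k ^ 2 / y - 1 \<le> real (nat \<lfloor>real k ^ 2 / y\<rfloor>)" by linarith
      then have "(real k ^ 2 / y - 1) / real k ^ 2 \<le> m k" unfolding m_def by (rule divide_right_mono) simp
      then show ?case using elim by (simp add: u_def diff_divide_distrib power_one_over)
    qed
    show "\<forall>\<^sub>F k in sequentially. m k \<le> 1 / y"
      using eventually_gt_at_top[of 0]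
    proof eventually_elim
      case (elim k)
      have "real (nat \<lfloor>real k ^ 2 / y\<rfloor>) \<le> real k ^ 2 / y" using y by simp
      then have "m k \<le> (real k ^ 2 / y) / real k ^ 2" unfolding m_def by (rule divide_right_mono) simp
      then show ?case using elim by simp
    qed
    show "(\<lambda>k. 1 / y - u k ^ 2) \<longlonglongrightarrow> 1 / y" by (rule tendsto_eq_intros u refl | simp)+
  qed simp
  have rl: "r \<longlonglongrightarrow> 1 / 2 + 1 / y + L * (1 / y)"
    unfolding r_def by (rule tendsto_eq_intros u m refl | simp)+
  have ql: "q \<longlonglongrightarrow> 1 / y"
    unfolding q_def by (rule tendsto_eq_intros u m refl | simp)+
  have wl: "w \<longlonglongrightarrow> 1 / y + 2 * (1 / y)\<^sup>2"
    unfolding w_def by (rule tendsto_eq_intros u m refl | simp add: power2_eq_square)+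
  have pos: "1 / y > 0" "1 / y + 2 * (1 / y)\<^sup>2 > 0" using y by (simp_all add: add_pos_pos)
  have "g \<longlonglongrightarrow> ((1 / 2 + 1 / y + L * (1 / y)) / (1 / y)) / ((1 / y + 2 * (1 / y)\<^sup>2) / (1 / y * (1 / y + 0\<^sup>2)))"
    unfolding g_def by (intro tendsto_intros rl ql wl u) (use pos in auto)
  also have "((1 / 2 + 1 / y + L * (1 / y)) / (1 / y)) / ((1 / y + 2 * (1 / y)\<^sup>2) / (1 / y * (1 / y + 0\<^sup>2)))
      = (real l + 1 + y / 2) / (2 + y)"
    using y by (simp add: L_def power2_eq_square divide_simps) (simp add: algebra_simps)
  finally have lim: "g \<longlonglongrightarrow> (real l + 1 + y / 2) / (2 + y)" .
  show ?thesis
  proof (rule in_closure_limI[OF lim])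
    show "\<forall>\<^sub>F k in sequentially. g k \<in> tree_ratios"
      using eventually_gt_at_top[of 0]
    proof eventually_elim
      case (elim k)
      define M where "M = nat \<lfloor>real k ^ 2 / y\<rfloor>"
      have k: "real k > 0" using elim by simp
      have M: "real M = m k * real k ^ 2" unfolding M_def m_def using k by simp
      have ku: "u k * real k = 1" using k by (simp add: u_def)
      have k2: "u k ^ 2 * real k ^ 2 = 1" "u k * real k ^ 2 = real k" "u k * real k ^ 4 = real k ^ 3"
        "u k ^ 2 * real k ^ 4 = real k ^ 2" "u k ^ 3 * real k ^ 4 = real k" "u k ^ 4 * real k ^ 4 = 1"
        using k by (simp_all add: u_def field_simps eval_nat_numeral)
      obtain T :: "nat graph" and v where T: "tree T" "graph_order T \<ge> 2" "v \<in> verts T"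
        and ratio: "avp_at T v / avp T =
          (((real k * (real k + 1) / 2 + M) + l * (1 + real k + M) + real l * (real l - 1) / 2) / (1 + real k + M + l)) /
          (((real k * (real k + 1) + (real k - 1) * real k * (real k + 1) / 3)
            + 2 * real M * (real k * (real k + 1) / 2 + (1 + real k)) + 2 * real M * (real M - 1)
            + 2 * real l * (real k * (real k + 1) / 2 + M) + (1 + real k + M) * real l * (real l + 1)
            + (real l - 1) * real l * (real l + 1) / 3) / ((1 + real k + M + l) * ((1 + real k + M + l) + 1)))"
        using spider_ratio[OF l, of k M] by blast
      have r': "(real k * (real k + 1) / 2 + M) + l * (1 + real k + M) + real l * (real l - 1) / 2 = r k * real k ^ 2"
        unfolding r_def M L_def using k by (simp add: u_def field_simps power2_eq_square)
      have q': "1 + real k + M + l = q k * real k ^ 2"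
        unfolding q_def M L_def using k by (simp add: u_def field_simps power2_eq_square)
      have q1': "q k * real k ^ 2 + 1 = (q k + u k ^ 2) * real k ^ 2"
        using k by (simp add: u_def field_simps power2_eq_square)
      have w': "(real k * (real k + 1) + (real k - 1) * real k * (real k + 1) / 3)
            + 2 * real M * (real k * (real k + 1) / 2 + (1 + real k)) + 2 * real M * (real M - 1)
            + 2 * real l * (real k * (real k + 1) / 2 + M) + (1 + real k + M) * real l * (real l + 1)
            + (real l - 1) * real l * (real l + 1) / 3 = w k * (real k ^ 2 * real k ^ 2)"
        unfolding w_def M L_def using k by (simp add: u_def field_simps eval_nat_numeral)
      have "avp_at T v / avp T = g k"
        unfolding ratio r' w' q' q1' g_def by (rule scale) (use k in simp)
      then show ?case using T by (intro CollectI exI[of _ T] exI[of _ v]) simp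
    qed
  qed
qed

text \<open>For fixed \<open>l\<close> the limits fall continuously from (l + 1) / 2 to 1/2 as y
  grows; so \<open>l > 2 * a\<close> is taken and the equation limit = \<open>a\<close> is solved
  for y.\<close>

lemma dense_trees:
  "dense_in tree_ratios {1/2<..}"
  unfolding dense_in_def
proof (intro conjI subsetI)
  fix x assume "x \<in> tree_ratios"
  then show "x \<in> {1/2<..}" using tree_ratio_gt_half by auto
next
  fix a :: real assume "a \<in> {1/2<..}"
  then have a: "a > 1 / 2" by simp
  obtain l :: nat where l: "2 * a < l" using reals_Archimedean2 by blast
  define y where "y = (l + 1 - 2 * a) / (a - 1 / 2)"
  have y: "y > 0" using a l by (simp add: y_def)
  have l1: "l \<ge> 1" using l a by (cases l) simp_all
  have "y * (a - 1 / 2) = l + 1 - 2 * a" using a by (simp add: y_def)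
  then have "a * (2 + y) = real l + 1 + y / 2" by (simp add: algebra_simps)
  then have "(real l + 1 + y / 2) / (2 + y) = (a * (2 + y)) / (2 + y)" by simp
  also have "\<dots> = a" using y by simp
  finally show "a \<in> closure tree_ratios"
    using spider_limit[OF y l1] by simp
qed

text \<open>If \<open>a i\<close> counts the lists of length i, then (n - 1 - i) * a i = a (i + 1).
  Summation shows that the total shortfall of lengths from n - 1 is the sum of all a (i + 1), hence
  between 0 and the number of lists: the mean length lies between n - 2 and n - 1. The cubic bound,
  from lists of four vertices, makes \<open>q\<close> outweigh any leg of linear length.\<close>

lemma complete_graph_bounds:
  fixes n :: nat
  assumes n: "n \<ge> 6"
  defines "q \<equiv> count_from (complete_graph n) 0" and "t \<equiv> length_from (complete_graph n) 0"
  shows "q > 0" "t \<le> (real n - 1) * q" "t \<ge> (real n - 2) * q" "real n ^ 3 \<le> 8 * q"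
proof -
  let ?K = "complete_graph n"
  define a where "a i = real (card (plists_len ?K i))" for i
  have a_Suc: "a (Suc i) = real (n - Suc i) * a i" for i
    unfolding a_def card_plists_len_complete_Suc by simp
  have PW: "count_paths ?K = (\<Sum>i<n. a i)" "length_paths ?K = (\<Sum>i<n. i * a i)"
    using plists_by_length[OF simple_complete_graph, of n] by (simp_all add: count_paths_def length_paths_def a_def)
  have Pq: "count_paths ?K = n * q" "length_paths ?K = n * t"
    using complete_graph_sums[of n] n by (simp_all add: q_def t_def)
  have "(real n - 1) * count_paths ?K - length_paths ?K = (\<Sum>i<n. (real n - 1) * a i - i * a i)"
    unfolding PW by (simp add: sum_subtractf sum_distrib_left)
  also have "\<dots> = (\<Sum>i<n. a (Suc i))"
  proof (rule sum.cong[OF refl])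
    fix i assume "i \<in> {..<n}"
    then have "real (n - Suc i) = real n - 1 - real i" by (simp add: of_nat_diff)
    then show "(real n - 1) * a i - i * a i = a (Suc i)" unfolding a_Suc by (simp add: algebra_simps)
  qed
  finally have eq: "(real n - 1) * count_paths ?K - length_paths ?K = (\<Sum>i<n. a (Suc i))" .
  have an: "a n = 0"
  proof -
    obtain k where "n = Suc k" using n by (cases n) auto
    then show ?thesis using a_Suc[of k] by simp
  qed
  have "(\<Sum>i<n. a (Suc i)) + a 0 = (\<Sum>i<n. a i) + a n"
    using sum.lessThan_Suc_shift[of a n] sum.lessThan_Suc[of a n] by simp
  then have le: "(\<Sum>i<n. a (Suc i)) \<le> count_paths ?K" unfolding PW(1) an by (simp add: a_def)
  have ge: "(\<Sum>i<n. a (Suc i)) \<ge> 0" by (rule sum_nonneg) (simp add: a_def)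
  have "real n * t \<le> real n * ((real n - 1) * q)" using ge eq unfolding Pq by (simp add: algebra_simps)
  then show "t \<le> (real n - 1) * q" using n by simp
  have "real n * ((real n - 2) * q) \<le> real n * t" using le eq unfolding Pq by (simp add: algebra_simps)
  then show "t \<ge> (real n - 2) * q" using n by simp
  have n6: "real n \<ge> 6" using n by simp
  have "a 0 = n" unfolding a_def by (simp add: card_plists_len_0)
  then have "a 1 = real n * (real n - 1)" using a_Suc[of 0] n by (simp add: of_nat_diff)
  then have "a 2 = real n * (real n - 1) * (real n - 2)"
    using a_Suc[of 1] n by (simp add: of_nat_diff numeral_2_eq_2)
  then have a3: "a 3 = real n * ((real n - 1) * (real n - 2) * (real n - 3))"
    using a_Suc[of 2] n by (simp add: of_nat_diff numeral_3_eq_3 numeral_2_eq_2)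
  \<comment> \<open>Order at least 6 is used here: it gives n - 3 >= n / 2.\<close>
  have "real n * ((real n / 2) * (real n / 2) * (real n / 2)) \<le> real n * ((real n - 1) * (real n - 2) * (real n - 3))"
    using n6 by (intro mult_left_mono mult_mono) auto
  also have "\<dots> \<le> count_paths ?K"
    unfolding a3[symmetric] PW(1) using n by (intro member_le_sum) (auto simp: a_def)
  also have "\<dots> = real n * q" by (rule Pq(1))
  finally have "(real n / 2) * (real n / 2) * (real n / 2) \<le> q" using n by simp
  then show q: "real n ^ 3 \<le> 8 * q" by (simp add: power3_eq_cube)
  have "0 < real n ^ 3" using n by simp
  also note q
  finally show "q > 0" by simp
qed

text \<open>A complete graph with a leg of length \<open>L\<close> and a pendant vertex at the same vertex; the vertex is
  the pendant one. Its paths mostly end in the complete graph, while a typical path overall extends into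
  the leg.\<close>

lemma clique_ratio:
  fixes n L :: nat
  assumes n: "n \<ge> 1"
  defines "q \<equiv> count_from (complete_graph n) 0" and "t \<equiv> length_from (complete_graph n) 0"
  defines "r \<equiv> t + real L * (real L + 1) / 2 + (q + real L)"
  shows "\<exists>(G :: nat graph) v. connected_graph G \<and> graph_order G \<ge> 2 \<and> v \<in> verts G \<and>
    avp_at G v / avp G = (r / (1 + (q + real L))) /
      ((real n * t + 2 * real L * t + q * real L * (real L + 1) + (real L - 1) * real L * (real L + 1) / 3 + 2 * r) /
       ((real n + real L + 1) + (real n * q + 2 * real L * q + real L ^ 2 + 1 + 2 * (q + real L))))"
proof -
  let ?K = "complete_graph n"
  have K: "connected_graph ?K" "verts ?K = {..<n}" "0 < n"
    using connected_complete_graph n by simp_all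
  define A where "A = leg ?K 0 n L"
  note A = leg_invariant[OF K, of L, folded A_def]
  then have AV: "connected_graph A" "verts A = {..<n + L}" by simp_all
  interpret pendant A 0 "n + L" using AV n by unfold_locales (simp_all add: connected_simple)
  define C where "C = pend A 0 (n + L)"
  have C: "connected_graph C" unfolding C_def by (rule connected_pend[OF AV(1)])
  have o: "graph_order C = n + L + 1" unfolding C_def order_pend using AV by (simp add: graph_order_def)
  have PW: "count_paths ?K = real n * q" "length_paths ?K = real n * t" using complete_graph_sums[OF n] by (simp_all add: q_def t_def)
  have e: "count_from A 0 = q + real L" "length_from A 0 = t + real L * (real L + 1) / 2"
    "count_paths A = real n * q + 2 * real L * q + real L ^ 2"
    "length_paths A = real n * t + 2 * real L * t + q * real L * (real L + 1) + (real L - 1) * real L * (real L + 1) / 3"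
    using A PW by (simp_all add: q_def t_def)
  have "avp_at C (n + L) = r / (1 + (q + real L))"
    unfolding C_def avp_at_pend_ratio count_from_pend_new length_from_pend_new e r_def by simp
  moreover have "avp C = (length_paths A + 2 * r) / (real (n + L + 1) + (count_paths A + 1 + 2 * (q + real L)))"
    unfolding avp_P_W[OF connected_simple[OF C]] o unfolding C_def count_paths_pend length_paths_pend e r_def by simp
  ultimately have "avp_at C (n + L) / avp C = (r / (1 + (q + real L))) /
      ((real n * t + 2 * real L * t + q * real L * (real L + 1) + (real L - 1) * real L * (real L + 1) / 3 + 2 * r) /
       ((real n + real L + 1) + (real n * q + 2 * real L * q + real L ^ 2 + 1 + 2 * (q + real L))))"
    unfolding e by (simp add: add.assoc)
  moreover have "n + L \<in> verts C" unfolding C_def by simp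
  moreover have "graph_order C \<ge> 2" using o n by simp
  ultimately show ?thesis using C by blast
qed

text \<open>Let \<open>L\<close> be about y * n. To leading order n * q lists stay in the clique and
  2 * L * q have one end in the leg; their total length is q * n^2 * (1 + 2 * y + y^2). This gives
  the average n * (1 + y)^2 / (1 + 2 * y), while the local average is about n.\<close>

lemma clique_limit:
  fixes y :: real
  assumes y: "y > 0"
  shows "(1 + 2 * y) / (1 + y)\<^sup>2 \<in>
    closure graph_ratios"
proof -
  \<comment> \<open>Of the clique only two limits matter: \<open>x\<close>, the mean length of lists
    from a vertex divided by n, tends to 1, and \<open>z\<close> = n / q tends to 0. The terms
    \<open>r\<close>, \<open>d\<close>, \<open>w\<close>, \<open>e\<close> are the four quantities
    of \<open>clique_ratio\<close> divided by q * n, q, q * n^2 and q * n.\<close>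
  define qq where "qq n = count_from (complete_graph n) 0" for n
  define tt where "tt n = length_from (complete_graph n) 0" for n
  define u where "u n = 1 / real n" for n :: nat
  define z where "z n = real n / qq n" for n :: nat
  define x where "x n = tt n / (qq n * real n)" for n :: nat
  define m where "m n = real (nat \<lfloor>y * real n\<rfloor>) / real n" for n :: nat
  define r where "r n = x n + m n * (m n + u n) / 2 * z n + (u n + m n * z n * u n)" for n
  define d where "d n = z n * u n + (1 + m n * z n)" for n
  define w where "w n = x n + 2 * m n * x n + m n * (m n + u n) + (m n - u n) * m n * (m n + u n) / 3 * z n + 2 * u n * r n" for n
  define e where "e n = (1 + m n + u n) * z n * u n + (1 + 2 * m n + m n ^ 2 * z n + z n * u n ^ 2 + 2 * (u n + m n * z n * u n))" for n
  define g where "g n = (r n / d n) / (w n / e n)" for n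
  have scale: "(a * (c * N) / (b * c)) / ((d * (c * N * N)) / (f * (c * N))) = (a / b) / (d / f)"
    if "c \<noteq> 0" "N \<noteq> 0" for a b c d f N :: real
    using that by simp
  have u: "u \<longlonglongrightarrow> 0" unfolding u_def by (rule lim_1_over_n)
  have z: "z \<longlonglongrightarrow> 0"
  proof (rule tendsto_sandwich)
    show "\<forall>\<^sub>F n in sequentially. 0 \<le> z n"
      using eventually_ge_at_top[of 6]
    proof eventually_elim
      case (elim n)
      then show ?case using complete_graph_bounds(1)[OF elim] by (simp add: z_def qq_def)
    qed
    show "\<forall>\<^sub>F n in sequentially. z n \<le> 8 * u n ^ 2"
      using eventually_ge_at_top[of 6]
    proof eventually_elim
      case (elim n)
      have q: "qq n > 0" "real n ^ 3 \<le> 8 * qq n"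
        using complete_graph_bounds(1,4)[OF elim] by (simp_all add: qq_def)
      have "z n = (real n ^ 3) / (qq n * real n ^ 2)"
        using elim by (simp add: z_def power3_eq_cube power2_eq_square)
      also have "\<dots> \<le> (8 * qq n) / (qq n * real n ^ 2)"
        using q by (intro divide_right_mono) simp_all
      also have "\<dots> = 8 * u n ^ 2" using q by (simp add: u_def power_one_over)
      finally show ?case .
    qed
    show "(\<lambda>n. 8 * u n ^ 2) \<longlonglongrightarrow> 0" by (rule tendsto_eq_intros u refl | simp)+
  qed simp
  have x: "x \<longlonglongrightarrow> 1"
  proof (rule tendsto_sandwich)
    show "\<forall>\<^sub>F n in sequentially. 1 - 2 * u n \<le> x n"
      using eventually_ge_at_top[of 6]
    proof eventually_elim
      case (elim n)
      have q: "qq n > 0" "(real n - 2) * qq n \<le> tt n"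
        using complete_graph_bounds(1,3)[OF elim] by (simp_all add: qq_def tt_def)
      have "1 - 2 * u n = ((real n - 2) * qq n) / (qq n * real n)"
        using q elim by (simp add: u_def diff_divide_distrib)
      also have "\<dots> \<le> x n" unfolding x_def using q by (intro divide_right_mono) simp_all
      finally show ?case .
    qed
    show "\<forall>\<^sub>F n in sequentially. x n \<le> 1"
      using eventually_ge_at_top[of 6]
    proof eventually_elim
      case (elim n)
      have q: "qq n > 0" "tt n \<le> (real n - 1) * qq n"
        using complete_graph_bounds(1,2)[OF elim] by (simp_all add: qq_def tt_def)
      have "(real n - 1) * qq n \<le> real n * qq n" using q(1) by (intro mult_right_mono) simp_all
      then have "tt n \<le> qq n * real n" using q(2) by (simp add: mult.commute)
      then show ?case unfolding x_def using q elim by simp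
    qed
    show "(\<lambda>n. 1 - 2 * u n) \<longlonglongrightarrow> 1" by (rule tendsto_eq_intros u refl | simp)+
  qed simp
  have m: "m \<longlonglongrightarrow> y"
  proof (rule tendsto_sandwich)
    show "\<forall>\<^sub>F n in sequentially. y - u n \<le> m n"
      using eventually_gt_at_top[of 0]
    proof eventually_elim
      case (elim n)
      have "y * real n - 1 \<le> real (nat \<lfloor>y * real n\<rfloor>)" by linarith
      then have "(y * real n - 1) / real n \<le> m n" unfolding m_def by (rule divide_right_mono) simp
      then show ?case using elim by (simp add: u_def diff_divide_distrib)
    qed
    show "\<forall>\<^sub>F n in sequentially. m n \<le> y"
      using eventually_gt_at_top[of 0]
    proof eventually_elim
      case (elim n)
      have "real (nat \<lfloor>y * real n\<rfloor>) \<le> y * real n" using y by simp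
      then have "m n \<le> (y * real n) / real n" unfolding m_def by (rule divide_right_mono) simp
      then show ?case using elim by simp
    qed
    show "(\<lambda>n. y - u n) \<longlonglongrightarrow> y" by (rule tendsto_eq_intros u refl | simp)+
  qed simp
  have rl: "r \<longlonglongrightarrow> 1"
    unfolding r_def by (rule tendsto_eq_intros u m z x refl | simp)+
  have dl: "d \<longlonglongrightarrow> 1"
    unfolding d_def by (rule tendsto_eq_intros u m z x refl | simp)+
  have wl: "w \<longlonglongrightarrow> 1 + 2 * y + y * y"
    unfolding w_def by (rule tendsto_eq_intros u m z x rl refl | simp)+
  have el: "e \<longlonglongrightarrow> 1 + 2 * y"
    unfolding e_def by (rule tendsto_eq_intros u m z x refl | simp)+
  have pos: "1 + 2 * y > 0" "1 + 2 * y + y * y > 0" using y by (simp_all add: add_pos_pos)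
  have "g \<longlonglongrightarrow> (1 / 1) / ((1 + 2 * y + y * y) / (1 + 2 * y))"
    unfolding g_def by (intro tendsto_intros rl dl wl el) (use pos in auto)
  also have "(1 / 1) / ((1 + 2 * y + y * y) / (1 + 2 * y)) = (1 + 2 * y) / (1 + y)\<^sup>2"
    by (simp add: power2_eq_square algebra_simps)
  finally have lim: "g \<longlonglongrightarrow> (1 + 2 * y) / (1 + y)\<^sup>2" .
  show ?thesis
  proof (rule in_closure_limI[OF lim])
    show "\<forall>\<^sub>F n in sequentially. g n \<in> graph_ratios"
      using eventually_ge_at_top[of 6]
    proof eventually_elim
      case (elim n)
      define L where "L = nat \<lfloor>y * real n\<rfloor>"
      have k: "real n > 0" "1 \<le> n" using elim by simp_all
      have q: "qq n > 0" using complete_graph_bounds(1)[OF elim] by (simp add: qq_def)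
      define N where "N = real n"
      define c where "c = qq n"
      have Nc: "N > 0" "c > 0" using k q by (simp_all add: N_def c_def)
      have L: "real L = m n * N" unfolding L_def m_def N_def using k by simp
      have t: "tt n = x n * c * N" using Nc by (simp add: x_def N_def c_def)
      have un: "u n = 1 / N" and zn: "z n = N / c" by (simp_all add: u_def z_def N_def c_def)
      define \<rho> where "\<rho> = tt n + real L * (real L + 1) / 2 + (c + real L)"
      obtain G :: "nat graph" and v where G: "connected_graph G" "graph_order G \<ge> 2" "v \<in> verts G"
        and ratio: "avp_at G v / avp G = (\<rho> / (1 + (c + real L))) /
          ((N * tt n + 2 * real L * tt n + c * real L * (real L + 1) + (real L - 1) * real L * (real L + 1) / 3 + 2 * \<rho>) /
           ((N + real L + 1) + (N * c + 2 * real L * c + real L ^ 2 + 1 + 2 * (c + real L))))"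
        using clique_ratio[OF k(2), of L] unfolding \<rho>_def N_def c_def qq_def tt_def by blast
      have r': "\<rho> = r n * (c * N)"
        unfolding \<rho>_def r_def L t un zn using Nc by (simp add: field_simps power2_eq_square)
      have d': "1 + (c + real L) = d n * c"
        unfolding d_def L un zn using Nc by (simp add: field_simps)
      have w': "N * tt n + 2 * real L * tt n + c * real L * (real L + 1) + (real L - 1) * real L * (real L + 1) / 3 + 2 * \<rho>
          = w n * (c * N * N)"
        unfolding w_def r' L t unfolding un zn using Nc by (simp add: field_simps power2_eq_square)
      have e': "(N + real L + 1) + (N * c + 2 * real L * c + real L ^ 2 + 1 + 2 * (c + real L)) = e n * (c * N)"
        unfolding e_def L un zn using Nc by (simp add: field_simps power2_eq_square)
      have "avp_at G v / avp G = g n"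
        unfolding ratio w' e' d' unfolding r' g_def by (rule scale) (use Nc in simp_all)
      then show ?case using G by (intro CollectI exI[of _ G] exI[of _ v]) simp
    qed
  qed
qed

lemma dense_graphs:
  "dense_in graph_ratios {0<..}"
  unfolding dense_in_def
proof (intro conjI subsetI)
  fix x assume "x \<in> graph_ratios"
  then obtain G :: "nat graph" and v where x: "x = avp_at G v / avp G"
    and G: "connected_graph G" "graph_order G \<ge> 2" "v \<in> verts G" by blast
  show "x \<in> {0<..}" unfolding x using connected_avp_pos[OF G] by simp
next
  fix a :: real assume "a \<in> {0<..}"
  then have a0: "a > 0" by simp
  show "a \<in> closure graph_ratios"
  proof (cases "a > 1 / 2")
    case True
    have "a \<in> closure tree_ratios" using dense_trees True unfolding dense_in_def by auto
    moreover have "tree_ratios \<subseteq> graph_ratios" unfolding tree_def by blast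
    ultimately show ?thesis using closure_mono by blast
  next
    case False
    \<comment> \<open>The clique limit equals 1 - (y / (1 + y))^2, so y is found from y / (1 + y) =
      sqrt (1 - a).\<close>
    define s where "s = sqrt (1 - a)"
    have s: "0 < s" "s < 1" "s\<^sup>2 = 1 - a" using a0 False by (simp_all add: s_def)
    define y where "y = s / (1 - s)"
    have y: "y > 0" using s by (simp add: y_def)
    have eq: "1 + y = 1 / (1 - s)" "1 + 2 * y = (1 + s) / (1 - s)" using s by (simp_all add: y_def field_simps)
    have "(b / d) / (1 / d)\<^sup>2 = b * d" if "d \<noteq> 0" for b d :: real
      using that by (simp add: power2_eq_square)
    then have "(1 + 2 * y) / (1 + y)\<^sup>2 = (1 + s) * (1 - s)"
      unfolding eq using s by simp
    also have "\<dots> = a" using s(3) by (simp add: algebra_simps power2_eq_square)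
    finally show ?thesis using clique_limit[OF y] by simp
  qed
qed

theorem theorem1:
  shows
   "(\<forall>T :: 'a graph. tree T \<longrightarrow>
       avp (star_graph (graph_order T)) \<le> avp T \<and> avp T \<le> avp (path_graph (graph_order T))) \<and>
    (\<exists>(T1 :: nat graph) (T2 :: nat graph). tree T1 \<and> tree T2 \<and> \<not> graph_iso T1 T2 \<and>
       graph_order T1 = graph_order T2 \<and> avp T1 = avp T2) \<and>
    (dense_in {avp_at G v / avp G | (G :: nat graph) v.
                 connected_graph G \<and> graph_order G \<ge> 2 \<and> v \<in> verts G} {0<..} \<and>
     dense_in {avp_at T v / avp T | (T :: nat graph) v.
                 tree T \<and> graph_order T \<ge> 2 \<and> v \<in> verts T} {1/2<..}) \<and>
    (\<forall>d\<ge>1. \<exists>(G :: nat graph). connected_graph G \<and>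
       (\<exists>v\<in>verts G. vertex_degree G v = d \<and> (\<forall>w\<in>verts G. avp_at G w \<le> avp_at G v))) \<and>
    (\<forall>T :: 'a graph. tree T \<and> \<not> graph_iso T (star_graph (graph_order T)) \<longrightarrow>
       (\<exists>T'. one_associate T' T \<and> avp T' < avp T)) \<and>
    ((\<exists>(G :: nat graph). \<exists>e\<in>edges G. connected_graph G \<and>
        connected_graph (delete_edge G e) \<and> avp (delete_edge G e) > avp G) \<and>
     (\<exists>(T :: nat graph). \<exists>f\<in>edges T. tree T \<and> avp (contract_edge T f) > avp T)) \<and>
    (\<forall>r\<ge>3. \<exists>C :: real. \<forall>N. \<exists>(G :: nat graph). connected_graph G \<and> graph_order G \<ge> N \<and>
       min_degree G \<ge> r \<and> avp G \<le> C * ln (real (graph_order G))) \<and>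
    (\<forall>G :: 'a graph. connected_graph G \<longrightarrow>
       avp (star_graph (graph_order G)) \<le> avp G \<and> avp G \<le> avp (complete_graph (graph_order G)))"
proof (intro conjI allI impI ballI; (elim conjE)?)
  fix T :: "'a graph" assume T: "tree T"
  show "avp (star_graph (graph_order T)) \<le> avp T" using T by (intro avp_star_le) (simp add: tree_def)
  show "avp T \<le> avp (path_graph (graph_order T))" by (rule avp_tree_le_path[OF T])
qed (use ex_equal_avp dense_graphs dense_trees ex_max_local_degree non_star_improve ex_delete_increase
    ex_contract_increase ex_log_avp avp_star_le avp_le_complete in \<open>blast+\<close>)

end
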